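(* For each noncyclic quadrilateral $Q^{(1)}=A_1B_1C_1D_1$ there is a unique point $W$ that has any (and, therefore, all) of the following properties: (1) $W$ is the center of the spiral similarity for any two odd (even) generation quadrilaterals in the iterative process. (2) Depending on the value of the ratio of similarity $r$ in the iterative process, there are the following possibilities: (a) if $|r|<1$, the quadrilaterals in the iterated perpendicular bisectors construction converge to $W$; (b) if $|r|=1$, the iterative process is periodic (with period $2$ or $4$), and $W$ is the common center of rotations for any two odd (even) generation quadrilaterals; (c) if $|r|>1$, the quadrilaterals in the reverse iterative process (obtained by isogonal conjugation) converge to $W$. (3) $W$ is the common point of the six circles of similitude $CS(o_i,o_j)$ for any pair of triad circles $o_i,o_j$, $i,j\in\{1,2,3,4\}$, where $o_1=(D_1A_1B_1)$, $o_2=(A_1B_1C_1)$, $o_3=(B_1C_1D_1)$, $o_4=(C_1D_1A_1)$. (4) (Isoptic property) Each of the triad circles is visible from $W$ at the same angle. (5) (Generalization of circumcenter) The (directed) angle subtended by any of the quadrilateral's sides at $W$ equals the sum of the angles subtended by the same side at the two remaining vertices. (6) (Isodynamic property) The distance from $W$ to any vertex is inversely proportional to the radius of the triad circle determined by the remaining three vertices. (7) $W$ is obtained by inversion of any of the vertices of the original quadrilateral in the corresponding triad circle of the second generation: $W=\mathrm{Inv}_{o_1^{(2)}}(A_1)=\mathrm{Inv}_{o_2^{(2)}}(B_1)=\mathrm{Inv}_{o_3^{(2)}}(C_1)=\mathrm{Inv}_{o_4^{(2)}}(D_1)$, where $o_1^{(2)}=(D_2A_2B_2)$, $o_2^{(2)}=(A_2B_2C_2)$,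 $o_3^{(2)}=(B_2C_2D_2)$, $o_4^{(2)}=(C_2D_2A_2)$. (8) $W$ is obtained by composition of isogonal conjugation of a vertex in the triangle formed by the remaining vertices and inversion in the circumcircle of that triangle. (9) $W$ is the center of spiral similarity for any pair of triad circles (of possibly different generations). That is, $W\in CS(o_i^{(k)},o_j^{(l)})$ for all $i,j,k,l$. (10) The pedal quadrilateral of $W$ is a (nondegenerate) parallelogram. Moreover, its angles equal the angles of the Varignon parallelogram.
   Context: Quadrilaterals are nondegenerate. $(XYZ)$ denotes the circle through $X,Y,Z$. $W$ is allowed to be the point at infinity. Iterative process (iterated perpendicular bisectors construction): given $Q^{(n)}=A_nB_nC_nD_n$, its triad circles are $o_1^{(n)}=(D_nA_nB_n)$, $o_2^{(n)}=(A_nB_nC_n)$, $o_3^{(n)}=(B_nC_nD_n)$, $o_4^{(n)}=(C_nD_nA_n)$ (with $o_i=o_i^{(1)}$), and the vertices $A_{n+1},B_{n+1},C_{n+1},D_{n+1}$ of $Q^{(n+1)}$ are the centers of $o_1^{(n)},o_2^{(n)},o_3^{(n)},o_4^{(n)}$ respectively. $Q^{(n)}$ is an odd or even generation according to the parity of $n$. The reverse iterative process recovers $Q^{(n)}$ from $Q^{(n+1)}$: each vertex of $Q^{(n)}$ is an isogonal conjugate of a vertex of $Q^{(n+1)}$ in the triangle formed by the other three, namely $A_n=\mathrm{Iso}_{\triangle D_{n+1}A_{n+1}B_{n+1}}(C_{n+1})$, $B_n=\mathrm{Iso}_{\triangle A_{n+1}B_{n+1}C_{n+1}}(D_{n+1})$,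 $C_n=\mathrm{Iso}_{\triangle B_{n+1}C_{n+1}D_{n+1}}(A_{n+1})$, $D_n=\mathrm{Iso}_{\triangle C_{n+1}D_{n+1}A_{n+1}}(B_{n+1})$; it continues to earlier generations $Q^{(0)},Q^{(-1)},\dots$. Here $\mathrm{Iso}_{\triangle XYZ}(P)$ is the common point of the reflections of the lines $XP,YP,ZP$ in the angle bisectors at $X,Y,Z$. The ratio of similarity is $r=\frac14(\cot\alpha+\cot\gamma)(\cot\beta+\cot\delta)$, where $\alpha,\beta,\gamma,\delta$ are the angles of $Q^{(1)}$ at $A_1,B_1,C_1,D_1$. A spiral similarity is the composition of a rotation and a homothety with the same center. For circles $o,o'$ with centers $O,O'$ and radii $R,R'$, the circle of similitude $CS(o,o')$ is the set of points $P$ with $|PO|/|PO'|=R/R'$ (a line if $R=R'$); it is the locus of centers of spiral similarities taking $o$ into $o'$. $\mathrm{Inv}_k$ is inversion in the circle $k$. The angle at which a circle with center $O$ is visible from $P$ is the angle between the tangents from $P$ if $P$ is outside the circle, and the angle $\angle TOT'$, where $TT'$ is the chord through $P$ perpendicular to $OP$, if $P$ is inside. The pedal quadrilateral of a point has as vertices the feet of the perpendiculars from the point to the side lines of $Q^{(1)}$. The Varignon parallelogram is formed by the midpoints of the sides of $Q^{(1)}$.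
   Formalization: In (4) the point must lie outside all triad circles or inside all (mixed views can give a second point); in (1), (2b), if all same-parity generations coincide, W is the point at infinity by convention; (10) is claimed only when the Varignon parallelogram is nondegenerate. *)

theory Defs
  imports "HOL-Analysis.Analysis"
begin

text \<open>
  The Euclidean plane is \<^typ>\<open>complex\<close>; the plane with the point at infinity is
  \<^typ>\<open>complex option\<close>, where \<^term>\<open>None\<close> is the point at infinity. A statement about distances
  or angles at the point at infinity is read as the limiting statement for a finite point tending
  to infinity.
\<close>

datatype 'a quad = Quad (vA: 'a) (vB: 'a) (vC: 'a) (vD: 'a)

datatype circle = Circle (center: complex) (radius: real)

definition circumcircle :: "complex \<Rightarrow> complex \<Rightarrow> complex \<Rightarrow> circle" where
  "circumcircle X Y Z = (THE k. {X, Y, Z} \<subseteq> sphere (center k) (radius k))"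

text \<open>Convex, concave and self-intersecting quadrilaterals are all admitted.\<close>

definition nondegenerate :: "complex quad \<Rightarrow> bool" where
  "nondegenerate Q \<longleftrightarrow>
     \<not> collinear {vD Q, vA Q, vB Q} \<and> \<not> collinear {vA Q, vB Q, vC Q} \<and>
     \<not> collinear {vB Q, vC Q, vD Q} \<and> \<not> collinear {vC Q, vD Q, vA Q}"

definition cyclic :: "complex quad \<Rightarrow> bool" where
  "cyclic Q \<longleftrightarrow> (\<exists>c R. set_quad Q \<subseteq> sphere c R)"


subsection \<open>The iterative process\<close>

definition triad :: "complex quad \<Rightarrow> nat \<Rightarrow> circle" where
  "triad Q i =
     (if i = 1 then circumcircle (vD Q) (vA Q) (vB Q)
      else if i = 2 then circumcircle (vA Q) (vB Q) (vC Q)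
      else if i = 3 then circumcircle (vB Q) (vC Q) (vD Q)
      else circumcircle (vC Q) (vD Q) (vA Q))"

definition next_gen :: "complex quad \<Rightarrow> complex quad" where
  "next_gen Q =
     Quad (center (triad Q 1)) (center (triad Q 2)) (center (triad Q 3)) (center (triad Q 4))"

text \<open>Reflection in the line through \<open>X\<close> with direction \<open>u\<close>.\<close>

definition line_reflection :: "complex \<Rightarrow> complex \<Rightarrow> complex \<Rightarrow> complex" where
  "line_reflection X u z = X + u / cnj u * cnj (z - X)"

text \<open>The image of the line \<open>XP\<close> under reflection in the bisector of the angle \<open>YXZ\<close>.\<close>

definition isogonal_line :: "complex \<Rightarrow> complex \<Rightarrow> complex \<Rightarrow> complex \<Rightarrow> complex set" where
  "isogonal_line X Y Z P = line_reflection X (sgn (Y - X) + sgn (Z - X)) ` (affine hull {X, P})"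

definition Iso :: "complex \<Rightarrow> complex \<Rightarrow> complex \<Rightarrow> complex \<Rightarrow> complex" where
  "Iso X Y Z P =
     (THE S. S \<in> isogonal_line X Y Z P \<and> S \<in> isogonal_line Y Z X P \<and> S \<in> isogonal_line Z X Y P)"

definition prev_gen :: "complex quad \<Rightarrow> complex quad" where
  "prev_gen Q =
     Quad (Iso (vD Q) (vA Q) (vB Q) (vC Q)) (Iso (vA Q) (vB Q) (vC Q) (vD Q))
          (Iso (vB Q) (vC Q) (vD Q) (vA Q)) (Iso (vC Q) (vD Q) (vA Q) (vB Q))"

text \<open>\<open>gen Q 1 = Q\<close>; generations \<open>0, -1, \<dots>\<close> come from the reverse process.\<close>

definition gen :: "complex quad \<Rightarrow> int \<Rightarrow> complex quad" where
  "gen Q n = (if n \<ge> 1 then (next_gen ^^ nat (n - 1)) Q else (prev_gen ^^ nat (1 - n)) Q)"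

text \<open>
  For a simple quadrilateral traversed counterclockwise \<open>ccw_angle\<close> is the interior angle at \<open>Y\<close>;
  for the other orientation it is \<open>2 * pi\<close> minus that angle, so all cotangents below change sign
  and the ratio does not change.
\<close>

definition ccw_angle :: "complex \<Rightarrow> complex \<Rightarrow> complex \<Rightarrow> real" where
  "ccw_angle X Y Z = Arg2pi ((X - Y) / (Z - Y))"

definition ratio :: "complex quad \<Rightarrow> real" where
  "ratio Q = (1/4) *
     (cot (ccw_angle (vD Q) (vA Q) (vB Q)) + cot (ccw_angle (vB Q) (vC Q) (vD Q))) *
     (cot (ccw_angle (vA Q) (vB Q) (vC Q)) + cot (ccw_angle (vC Q) (vD Q) (vA Q)))"


subsection \<open>Centers of spiral similarities\<close>

definition rotation :: "complex \<Rightarrow> real \<Rightarrow> complex \<Rightarrow> complex" where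
  "rotation w t z = w + cis t * (z - w)"

definition homothety :: "complex \<Rightarrow> real \<Rightarrow> complex \<Rightarrow> complex" where
  "homothety w k z = w + of_real k * (z - w)"

text \<open>
  \<open>q'\<close> is the image of \<open>q\<close> under a spiral similarity with center \<open>W\<close> and homothety ratio in \<open>K\<close>.
  The spiral similarities with center at infinity are the translations, the identity included.
\<close>

definition spiral_image :: "real set \<Rightarrow> complex option \<Rightarrow> complex quad \<Rightarrow> complex quad \<Rightarrow> bool" where
  "spiral_image K W q q' \<longleftrightarrow>
     (case W of
        Some w \<Rightarrow> (\<exists>k t. k \<in> K \<and> q' = map_quad (homothety w k \<circ> rotation w t) q)
      | None \<Rightarrow> (\<exists>v. q' = map_quad (\<lambda>z. z + v) q))"

text \<open>
  Every point is a center of the identity. If all generations of equal parity coincide (which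
  happens exactly when the vertices form an orthocentric system), the center is by convention the
  point at infinity; this is what the last conjunct expresses.
\<close>

definition common_center :: "real set \<Rightarrow> complex quad \<Rightarrow> complex option \<Rightarrow> bool" where
  "common_center K Q W \<longleftrightarrow>
     (\<forall>m n. m \<noteq> n \<and> even (m - n) \<longrightarrow> spiral_image K W (gen Q m) (gen Q n)) \<and>
     (W \<noteq> None \<longrightarrow> (\<exists>m n. even (m - n) \<and> gen Q m \<noteq> gen Q n))"

definition spiral_similarity_center :: "complex quad \<Rightarrow> complex option \<Rightarrow> bool" where
  "spiral_similarity_center Q W \<longleftrightarrow> common_center (- {0}) Q W"

definition point_limit :: "(nat \<Rightarrow> complex) \<Rightarrow> complex option \<Rightarrow> bool" where
  "point_limit s W \<longleftrightarrow>
     (case W of Some w \<Rightarrow> s \<longlonglongrightarrow> w | None \<Rightarrow> filterlim s at_infinity sequentially)"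

definition quads_converge :: "(nat \<Rightarrow> complex quad) \<Rightarrow> complex option \<Rightarrow> bool" where
  "quads_converge q W \<longleftrightarrow>
     point_limit (\<lambda>n. vA (q n)) W \<and> point_limit (\<lambda>n. vB (q n)) W \<and>
     point_limit (\<lambda>n. vC (q n)) W \<and> point_limit (\<lambda>n. vD (q n)) W"

definition least_period :: "(int \<Rightarrow> 'a) \<Rightarrow> int \<Rightarrow> bool" where
  "least_period f p \<longleftrightarrow>
     p > 0 \<and> (\<forall>n. f (n + p) = f n) \<and> (\<forall>j. 0 < j \<and> j < p \<longrightarrow> \<not> (\<forall>n. f (n + j) = f n))"

definition limit_or_rotation_center :: "complex quad \<Rightarrow> complex option \<Rightarrow> bool" where
  "limit_or_rotation_center Q W \<longleftrightarrow>
     (\<bar>ratio Q\<bar> < 1 \<longrightarrow> quads_converge (\<lambda>n. gen Q (int n)) W) \<and>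
     (\<bar>ratio Q\<bar> = 1 \<longrightarrow>
        (least_period (gen Q) 2 \<or> least_period (gen Q) 4) \<and> common_center {1} Q W) \<and>
     (\<bar>ratio Q\<bar> > 1 \<longrightarrow> quads_converge (\<lambda>n. gen Q (- int n)) W)"


subsection \<open>Circles of similitude\<close>

definition CS :: "circle \<Rightarrow> circle \<Rightarrow> complex option set" where
  "CS k k' =
     {Some P | P. dist P (center k) / dist P (center k') = radius k / radius k'} \<union>
     (if radius k = radius k' then {None} else {})"

definition common_point_CS :: "complex quad \<Rightarrow> complex option \<Rightarrow> bool" where
  "common_point_CS Q W \<longleftrightarrow> (\<forall>i\<in>{1..4}. \<forall>j\<in>{1..4}. i \<noteq> j \<longrightarrow> W \<in> CS (triad Q i) (triad Q j))"

definition common_point_CS_generations :: "complex quad \<Rightarrow> complex option \<Rightarrow> bool" where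
  "common_point_CS_generations Q W \<longleftrightarrow>
     (\<forall>i\<in>{1..4}. \<forall>j\<in>{1..4}. \<forall>k l. W \<in> CS (triad (gen Q k) i) (triad (gen Q l) j))"


subsection \<open>Isoptic property\<close>

text \<open>The undirected angle \<open>XYZ\<close>, in \<open>[0, pi]\<close>.\<close>

definition vangle :: "complex \<Rightarrow> complex \<Rightarrow> complex \<Rightarrow> real" where
  "vangle X Y Z = arccos (((X - Y) \<bullet> (Z - Y)) / (norm (X - Y) * norm (Z - Y)))"

definition outside :: "complex \<Rightarrow> circle \<Rightarrow> bool" where
  "outside P k \<longleftrightarrow> dist P (center k) > radius k"

definition inside :: "complex \<Rightarrow> circle \<Rightarrow> bool" where
  "inside P k \<longleftrightarrow> dist P (center k) < radius k"

definition tangent_angle :: "complex \<Rightarrow> circle \<Rightarrow> real" where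
  "tangent_angle P k =
     (THE a. \<exists>T T'. T \<noteq> T' \<and> {T, T'} \<subseteq> sphere (center k) (radius k) \<and>
        orthogonal (T - P) (T - center k) \<and> orthogonal (T' - P) (T' - center k) \<and>
        a = vangle T P T')"

definition chord_angle :: "complex \<Rightarrow> circle \<Rightarrow> real" where
  "chord_angle P k =
     (THE a. \<exists>T T'. T \<noteq> T' \<and> {T, T'} \<subseteq> sphere (center k) (radius k) \<and>
        P \<in> closed_segment T T' \<and> orthogonal (T' - T) (P - center k) \<and>
        a = vangle T (center k) T')"

text \<open>
  The two kinds of angle are not compared with each other: some quadrilaterals have a second point
  that sees one triad circle from inside and another from outside with numerically equal angles.
  At infinity every circle is seen at angle zero, so there the ratios of the angles are compared.
\<close>

definition isoptic :: "complex quad \<Rightarrow> complex option \<Rightarrow> bool" where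
  "isoptic Q W \<longleftrightarrow>
     (case W of
        Some P \<Rightarrow>
          (\<forall>i\<in>{1..4}. outside P (triad Q i)) \<and>
            (\<exists>a. \<forall>i\<in>{1..4}. tangent_angle P (triad Q i) = a) \<or>
          (\<forall>i\<in>{1..4}. inside P (triad Q i)) \<and>
            (\<exists>a. \<forall>i\<in>{1..4}. chord_angle P (triad Q i) = a)
      | None \<Rightarrow>
          (\<forall>i\<in>{1..4}. \<forall>j\<in>{1..4}.
             ((\<lambda>P. tangent_angle P (triad Q i) / tangent_angle P (triad Q j)) \<longlongrightarrow> 1) at_infinity))"


subsection \<open>Generalization of the circumcenter\<close>

text \<open>
  Directed angles are angles between lines, that is, they are taken modulo \<open>pi\<close>; a finite segment
  subtends the angle 0 at infinity.
\<close>

definition dangle :: "complex \<Rightarrow> complex \<Rightarrow> complex \<Rightarrow> real" where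
  "dangle X P Y = Arg ((Y - P) / (X - P))"

definition cong_pi :: "real \<Rightarrow> real \<Rightarrow> bool" where
  "cong_pi a b \<longleftrightarrow> (\<exists>k::int. a = b + of_int k * pi)"

definition subtended :: "complex \<Rightarrow> complex \<Rightarrow> complex option \<Rightarrow> real" where
  "subtended X Y W = (case W of Some P \<Rightarrow> dangle X P Y | None \<Rightarrow> 0)"

definition generalized_circumcenter :: "complex quad \<Rightarrow> complex option \<Rightarrow> bool" where
  "generalized_circumcenter Q W \<longleftrightarrow>
     W \<notin> Some ` set_quad Q \<and>
     (case Q of Quad A B C D \<Rightarrow>
        cong_pi (subtended A B W) (dangle A C B + dangle A D B) \<and>
        cong_pi (subtended B C W) (dangle B D C + dangle B A C) \<and>
        cong_pi (subtended C D W) (dangle C A D + dangle C B D) \<and>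
        cong_pi (subtended D A W) (dangle D B A + dangle D C A))"


subsection \<open>Isodynamic property\<close>

definition vertex_circles :: "complex quad \<Rightarrow> (complex \<times> circle) set" where
  "vertex_circles Q =
     (case Q of Quad A B C D \<Rightarrow>
        {(A, circumcircle B C D), (B, circumcircle C D A),
         (C, circumcircle D A B), (D, circumcircle A B C)})"

definition isodynamic :: "complex quad \<Rightarrow> complex option \<Rightarrow> bool" where
  "isodynamic Q W \<longleftrightarrow>
     (case W of
        Some P \<Rightarrow> (\<exists>c>0. \<forall>(V, k)\<in>vertex_circles Q. dist P V = c / radius k)
      | None \<Rightarrow>
          (\<forall>(V, k)\<in>vertex_circles Q. \<forall>(V', k')\<in>vertex_circles Q.
             ((\<lambda>P. dist P V / dist P V') \<longlongrightarrow> radius k' / radius k) at_infinity))"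


subsection \<open>Inversion\<close>

definition Inv :: "circle \<Rightarrow> complex option \<Rightarrow> complex option" where
  "Inv k X =
     (case X of
        None \<Rightarrow> Some (center k)
      | Some z \<Rightarrow>
          if z = center k then None
          else Some (center k + ((radius k)\<^sup>2 / (dist z (center k))\<^sup>2) *\<^sub>R (z - center k)))"

definition inverse_of_vertices :: "complex quad \<Rightarrow> complex option \<Rightarrow> bool" where
  "inverse_of_vertices Q W \<longleftrightarrow>
     W = Inv (triad (gen Q 2) 1) (Some (vA Q)) \<and> W = Inv (triad (gen Q 2) 2) (Some (vB Q)) \<and>
     W = Inv (triad (gen Q 2) 3) (Some (vC Q)) \<and> W = Inv (triad (gen Q 2) 4) (Some (vD Q))"

definition inverse_of_isogonal_conjugates :: "complex quad \<Rightarrow> complex option \<Rightarrow> bool" where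
  "inverse_of_isogonal_conjugates Q W \<longleftrightarrow>
     (case Q of Quad A B C D \<Rightarrow>
        W = Inv (circumcircle B C D) (Some (Iso B C D A)) \<and>
        W = Inv (circumcircle C D A) (Some (Iso C D A B)) \<and>
        W = Inv (circumcircle D A B) (Some (Iso D A B C)) \<and>
        W = Inv (circumcircle A B C) (Some (Iso A B C D)))"


subsection \<open>Pedal quadrilateral\<close>

definition foot :: "complex \<Rightarrow> complex \<Rightarrow> complex \<Rightarrow> complex" where
  "foot P X Y = (THE F. F \<in> affine hull {X, Y} \<and> orthogonal (P - F) (Y - X))"

definition pedal :: "complex quad \<Rightarrow> complex \<Rightarrow> complex quad" where
  "pedal Q P =
     Quad (foot P (vA Q) (vB Q)) (foot P (vB Q) (vC Q)) (foot P (vC Q) (vD Q)) (foot P (vD Q) (vA Q))"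

definition varignon :: "complex quad \<Rightarrow> complex quad" where
  "varignon Q =
     Quad (midpoint (vA Q) (vB Q)) (midpoint (vB Q) (vC Q))
          (midpoint (vC Q) (vD Q)) (midpoint (vD Q) (vA Q))"

definition nondeg_parallelogram :: "complex quad \<Rightarrow> bool" where
  "nondeg_parallelogram q \<longleftrightarrow> vB q - vA q = vC q - vD q \<and> \<not> collinear {vA q, vB q, vC q}"

definition quad_angles :: "complex quad \<Rightarrow> real set" where
  "quad_angles q =
     {vangle (vD q) (vA q) (vB q), vangle (vA q) (vB q) (vC q),
      vangle (vB q) (vC q) (vD q), vangle (vC q) (vD q) (vA q)}"

text \<open>
  For the point at infinity, the pedal quadrilateral is the limiting shape, in every direction
  \<open>e\<close>, of the pedal quadrilaterals of \<open>t * e\<close> as \<open>t\<close> tends to infinity, scaled by \<open>1 / t\<close>.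
\<close>

definition pedal_parallelogram :: "complex quad \<Rightarrow> complex option \<Rightarrow> bool" where
  "pedal_parallelogram Q W \<longleftrightarrow>
     (case W of
        Some P \<Rightarrow>
          nondeg_parallelogram (pedal Q P) \<and> quad_angles (pedal Q P) = quad_angles (varignon Q)
      | None \<Rightarrow>
          (\<forall>e. norm e = 1 \<longrightarrow>
            (\<exists>L. nondeg_parallelogram L \<and> quad_angles L = quad_angles (varignon Q) \<and>
               ((\<lambda>t::real. vA (pedal Q (t *\<^sub>R e)) /\<^sub>R t) \<longlongrightarrow> vA L) at_top \<and>
               ((\<lambda>t::real. vB (pedal Q (t *\<^sub>R e)) /\<^sub>R t) \<longlongrightarrow> vB L) at_top \<and>
               ((\<lambda>t::real. vC (pedal Q (t *\<^sub>R e)) /\<^sub>R t) \<longlongrightarrow> vC L) at_top \<and>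
               ((\<lambda>t::real. vD (pedal Q (t *\<^sub>R e)) /\<^sub>R t) \<longlongrightarrow> vD L) at_top)))"

text \<open>
  The Varignon parallelogram can be degenerate only if the diagonals are parallel, which forces
  self-intersection; then no point has a nondegenerate parallelogram as pedal quadrilateral.
\<close>

lemma simple_imp_varignon_nondegenerate:
  assumes nd: "nondegenerate Q"
    and AB_CD: "closed_segment (vA Q) (vB Q) \<inter> closed_segment (vC Q) (vD Q) = {}"
    and BC_DA: "closed_segment (vB Q) (vC Q) \<inter> closed_segment (vD Q) (vA Q) = {}"
  shows "nondeg_parallelogram (varignon Q)"
proof -
  obtain A B C D where Q: "Q = Quad A B C D" by (cases Q)
  have par: "midpoint B C - midpoint A B = midpoint C D - midpoint D A"
    by (simp add: midpoint_def algebra_simps)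
  have "\<not> collinear {midpoint A B, midpoint B C, midpoint C D}"
  proof
    assume "collinear {midpoint A B, midpoint B C, midpoint C D}"
    then have "collinear {0, midpoint A B - midpoint B C, midpoint C D - midpoint B C}"
      by (subst (asm) collinear_3) auto
    moreover have m: "midpoint A B - midpoint B C = (1/2) *\<^sub>R (A - C)"
      "midpoint C D - midpoint B C = (1/2) *\<^sub>R (D - B)"
      by (simp_all add: midpoint_def algebra_simps)
    moreover have "A \<noteq> C" "B \<noteq> D"
      using nd by (auto simp: nondegenerate_def Q insert_commute)
    ultimately obtain s where "(1/2) *\<^sub>R (D - B) = s *\<^sub>R ((1/2) *\<^sub>R (A - C))"
      by (auto simp: collinear_lemma)
    then have "(1/2) *\<^sub>R (D - B) = (1/2) *\<^sub>R (s *\<^sub>R (A - C))"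
      by (simp add: mult.commute)
    then have DB: "D - B = s *\<^sub>R (A - C)"
      by (metis scaleR_left_imp_eq zero_neq_one divide_eq_0_iff zero_neq_numeral)
    show False
    proof (cases "s \<ge> 0")
      case True
      define P where "P = (1 / (1 + s)) *\<^sub>R (D + s *\<^sub>R C)"
      have eq: "D + s *\<^sub>R C = B + s *\<^sub>R A"
        using DB by (simp add: algebra_simps)
      have s1: "1 - s / (1 + s) = 1 / (1 + s)" "1 - 1 / (1 + s) = s / (1 + s)"
        using True by (simp_all add: field_simps)
      have "P = (1 - 1 / (1 + s)) *\<^sub>R C + (1 / (1 + s)) *\<^sub>R D"
        unfolding s1 P_def by (simp add: algebra_simps)
      then have "P \<in> closed_segment C D"
        using True by (auto simp: in_segment intro!: exI[of _ "1 / (1 + s)"])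
      moreover have "P = (1 - 1 / (1 + s)) *\<^sub>R A + (1 / (1 + s)) *\<^sub>R B"
        unfolding s1 P_def eq by (simp add: algebra_simps)
      then have "P \<in> closed_segment A B"
        using True by (auto simp: in_segment intro!: exI[of _ "1 / (1 + s)"])
      ultimately show False using AB_CD by (auto simp: Q)
    next
      case False
      define u where "u = - s"
      have u: "u > 0" using False by (simp add: u_def)
      define P where "P = (1 / (1 + u)) *\<^sub>R (D + u *\<^sub>R A)"
      have eq: "D + u *\<^sub>R A = B + u *\<^sub>R C"
        using DB by (simp add: u_def algebra_simps)
      have s1: "1 - u / (1 + u) = 1 / (1 + u)"
        using u by (simp add: field_simps)
      have "P = (1 - u / (1 + u)) *\<^sub>R D + (u / (1 + u)) *\<^sub>R A"
        unfolding s1 P_def by (simp add: algebra_simps)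
      then have "P \<in> closed_segment D A"
        using u by (auto simp: in_segment intro!: exI[of _ "u / (1 + u)"])
      moreover have "P = (1 - u / (1 + u)) *\<^sub>R B + (u / (1 + u)) *\<^sub>R C"
        unfolding s1 P_def eq by (simp add: algebra_simps)
      then have "P \<in> closed_segment B C"
        using u by (auto simp: in_segment intro!: exI[of _ "u / (1 + u)"])
      ultimately show False using BC_DA by (auto simp: Q)
    qed
  qed
  with par show ?thesis
    by (simp add: nondeg_parallelogram_def varignon_def Q)
qed

end

theory Submission
  imports Defs
begin

text \<open>
  Give each vertex \<open>X\<close> of the quadrilateral the weight \<open>s\<^sub>X\<close>, twice the signed area of the triangle of
  the other three vertices, with alternating signs. Up to a factor these are the only real weights with
  \<open>\<Sum> s\<^sub>X = 0\<close> and \<open>\<Sum> s\<^sub>X X = 0\<close>. By Lagrange interpolation the four numbers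
  \<open>s\<^sub>X \<Prod> (X - Y)\<close>, the product over the other vertices \<open>Y\<close>, are the values at the vertices of one
  linear form \<open>a z + b\<close>, where \<open>a = \<Sum> s\<^sub>X X\<^sup>2\<close>. The point \<open>W\<close> is the zero of this form, and the point at
  infinity if \<open>a = 0\<close>. Besides \<open>a\<close> and \<open>b\<close> only the real number \<open>N = \<Sum> s\<^sub>X \<bar>X\<bar>\<^sup>2\<close> matters; it
  vanishes exactly for concyclic vertices.

  The process becomes transparent in these terms. Let \<open>O\<^sub>X\<close> and \<open>R\<^sub>X\<close> be the center and the radius of
  the circle through the vertices other than \<open>X\<close>, and let \<open>\<Pi>\<close> be the product of the four weights.
  Then \<open>N\<^sup>2 - \<bar>a\<bar>\<^sup>2 = - 4 \<Pi>\<close> (\<open>defect_slope_sarea\<close>), and the map \<open>X \<mapsto> O\<^sub>X\<close> is the restriction of a real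
  affine map with determinant \<open>r = - N\<^sup>2 / (4 \<Pi>)\<close> (\<open>center_affine\<close>, \<open>affine_det\<close>). It multiplies the
  weights by \<open>r\<close> and replaces \<open>(a, b, N)\<close> by \<open>(- r\<^sup>2 a, - r\<^sup>2 b, r\<^sup>2 N)\<close>, so \<open>W\<close> and \<open>\<bar>N\<bar> / \<bar>a\<bar>\<close> do not
  change (\<open>slope_centers\<close>, \<open>defect_centers\<close>, \<open>intercept_centers\<close>). Two steps compose to the homothety with
  center \<open>W\<close> and ratio \<open>r\<close>, or the identity if \<open>W\<close> is at infinity (\<open>second_centers\<close>). This number
  \<open>r\<close> is the one given by the cotangents (\<open>ratio_eq\<close>). All generations, backwards and forwards, are
  therefore known explicitly (\<open>gen_eq_explicit\<close>), which settles similarity centers, limits and periods.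

  The metric properties come from two formulas: \<open>\<bar>a O\<^sub>X + b\<bar> = \<bar>N\<bar> R\<^sub>X\<close> (\<open>radius_form\<close>) says that \<open>W\<close> has the
  same ratio of distance from the center to radius for all triad circles, hence the circles of similitude,
  the isoptic property and, with the homothety, the descriptions by inversion; \<open>2 \<bar>a X + b\<bar> R\<^sub>X\<close> is the same for all vertices
  (\<open>radius_vandermonde\<close>), hence the isodynamic property. Conversely, a point with one of these properties is \<open>W\<close> because
  \<open>\<Sum> s\<^sub>X \<bar>P - X\<bar>\<^sup>2 = N\<close> for every point \<open>P\<close>, and likewise for the centers: this fixes the common
  factor, and then the distances of \<open>P\<close> from three noncollinear points are known. The generalization of the circumcenter
  says that the numbers \<open>(X - P) / \<Prod> (X - Y)\<close> have real quotients; by interpolation they are then proportional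
  to the weights, so that \<open>X - P\<close> is proportional to \<open>a X + b\<close> (\<open>real_ratios_iff\<close>). The condition
  that the pedal quadrilateral is a parallelogram is a linear equation for \<open>P\<close>, and it
  reduces to \<open>a P + b = 0\<close> (\<open>parallelogram_iff\<close>).
\<close>

section \<open>Weights of the vertices and the linear form they define\<close>

definition sarea :: "complex \<Rightarrow> complex \<Rightarrow> complex \<Rightarrow> real" where
  "sarea X Y Z = Im (cnj (Y - X) * (Z - X))"

text \<open>
  The coefficients are barycentric weights: for points that are not collinear, they are up to a factor
  the only real coefficients of an affine dependence between the four points.
\<close>

definition wsum :: "(complex \<Rightarrow> complex) \<Rightarrow> complex \<Rightarrow> complex \<Rightarrow> complex \<Rightarrow> complex \<Rightarrow> complex" where
  "wsum f A B C D =
     of_real (sarea B C D) * f A - of_real (sarea C D A) * f B +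
     of_real (sarea D A B) * f C - of_real (sarea A B C) * f D"

text \<open>
  The form \<open>slope * z + intercept\<close> has the value \<open>s\<^sub>X \<Prod> (X - Y)\<close> at each vertex \<open>X\<close>; its zero is the
  point \<open>W\<close>.
\<close>

definition slope :: "complex \<Rightarrow> complex \<Rightarrow> complex \<Rightarrow> complex \<Rightarrow> complex" where
  "slope A B C D = wsum (\<lambda>z. z\<^sup>2) A B C D"

text \<open>
  The defect from concyclicity: the sum of the weighted powers of the vertices with respect to any circle.
\<close>

definition defect :: "complex \<Rightarrow> complex \<Rightarrow> complex \<Rightarrow> complex \<Rightarrow> real" where
  "defect A B C D = Re (wsum (\<lambda>z. z * cnj z) A B C D)"

definition intercept :: "complex \<Rightarrow> complex \<Rightarrow> complex \<Rightarrow> complex \<Rightarrow> complex" where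
  "intercept A B C D = of_real (sarea B C D) * (A - B) * (A - C) * (A - D) - slope A B C D * A"

lemma of_real_sarea:
  "complex_of_real (sarea X Y Z) = - \<i> / 2 * (cnj (Y - X) * (Z - X) - (Y - X) * cnj (Z - X))"
  by (simp add: sarea_def complex_eq_iff field_simps)

lemma sarea_rot: "sarea Y Z X = sarea X Y Z"
  by (simp add: sarea_def algebra_simps)

lemma of_real_defect: "complex_of_real (defect A B C D) = wsum (\<lambda>z. z * cnj z) A B C D"
  by (simp add: defect_def wsum_def complex_eq_iff)

lemma wsum_1: "wsum (\<lambda>z. 1) A B C D = 0"
  by (simp add: wsum_def of_real_sarea field_simps)

lemma wsum_id: "wsum (\<lambda>z. z) A B C D = 0"
  by (simp add: wsum_def of_real_sarea field_simps)

lemma wsum_cnj: "wsum cnj A B C D = 0"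
  by (simp add: wsum_def of_real_sarea field_simps)

lemma slope_rot: "slope B C D A = - slope A B C D"
  and defect_rot: "defect B C D A = - defect A B C D"
  by (simp_all add: slope_def defect_def wsum_def)

text \<open>
  A rotation of the vertices changes the sign of all weights, so what is at stake is that the form
  defined by means of the vertex \<open>A\<close> is also the one defined by means of \<open>B\<close>. This is the
  interpolation statement, and it needs both moment conditions \<open>\<Sum> s\<^sub>X = 0\<close> and \<open>\<Sum> s\<^sub>X X = 0\<close>.
\<close>

lemma intercept_rot: "intercept B C D A = - intercept A B C D"
proof -
  have 1: "of_real (sarea B C D) - of_real (sarea C D A) + of_real (sarea D A B) - of_real (sarea A B C) = (0::complex)"
    using wsum_1[of A B C D] by (simp add: wsum_def)
  have 2: "of_real (sarea B C D) * A - of_real (sarea C D A) * B + of_real (sarea D A B) * C - of_real (sarea A B C) * D = 0"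
    using wsum_id[of A B C D] by (simp add: wsum_def)
  show ?thesis
    using 1 2 unfolding intercept_def slope_def wsum_def by algebra
qed

text \<open>
  Moving \<open>D\<close> to the origin keeps the polynomials in the next identity small.
\<close>

lemma wsum_diff:
  "wsum (\<lambda>z. z\<^sup>2) A B C D = of_real (sarea D B C) * (A - D)\<^sup>2 - of_real (sarea D A C) * (B - D)\<^sup>2 + of_real (sarea D A B) * (C - D)\<^sup>2" (is ?g1)
  "wsum (\<lambda>z. z * cnj z) A B C D = of_real (sarea D B C) * ((A - D) * cnj (A - D)) - of_real (sarea D A C) * ((B - D) * cnj (B - D)) + of_real (sarea D A B) * ((C - D) * cnj (C - D))" (is ?g2)
proof -
  have r: "sarea D B C = sarea B C D" "sarea D A C = sarea C D A"
    using sarea_rot by metis+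
  have 1: "of_real (sarea B C D) - of_real (sarea C D A) + of_real (sarea D A B) - of_real (sarea A B C) = (0::complex)"
    using wsum_1[of A B C D] by (simp add: wsum_def)
  have 2: "of_real (sarea B C D) * A - of_real (sarea C D A) * B + of_real (sarea D A B) * C - of_real (sarea A B C) * D = 0"
    using wsum_id[of A B C D] by (simp add: wsum_def)
  have 3: "of_real (sarea B C D) * cnj A - of_real (sarea C D A) * cnj B + of_real (sarea D A B) * cnj C - of_real (sarea A B C) * cnj D = 0"
    using wsum_cnj[of A B C D] by (simp add: wsum_def)
  show ?g1 unfolding wsum_def r using 1 2 by algebra
  show ?g2 unfolding wsum_def r complex_cnj_diff using 1 2 3 by algebra
qed

text \<open>
  The following identity of degree eight with \<open>D\<close> at the origin, with conjugates as independent variables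
  \<open>u'\<close>, \<open>v'\<close>, \<open>w'\<close> and all areas multiplied by \<open>2 \<i>\<close>.
\<close>

lemma slope_defect_polynomial: fixes u v w :: complex and u' v' w' :: complex shows
  "((v' * w - v * w') * (u * u') - (u' * w - u * w') * (v * v') + (u' * v - u * v') * (w * w'))\<^sup>2 -
   ((v' * w - v * w') * u\<^sup>2 - (u' * w - u * w') * v\<^sup>2 + (u' * v - u * v') * w\<^sup>2) *
   ((v' * w - v * w') * u'\<^sup>2 - (u' * w - u * w') * v'\<^sup>2 + (u' * v - u * v') * w'\<^sup>2) =
   (v' * w - v * w') * (u' * w - u * w') * (u' * v - u * v') * ((v' * w - v * w') - (u' * w - u * w') + (u' * v - u * v'))"
  by (simp add: algebra_simps power2_eq_square)

text \<open>
  For nondegenerate quadrilaterals the areas do not vanish, so \<open>\<bar>a\<bar> \<noteq> \<bar>N\<bar>\<close>: the point \<open>W\<close> lies on no triad circle. The quotient of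
  \<open>N\<^sup>2\<close> by the left-hand side will be the similarity ratio.
\<close>

lemma defect_slope_sarea:
  "of_real ((defect A B C D)\<^sup>2) - slope A B C D * cnj (slope A B C D) =
     - 4 * of_real (sarea B C D * sarea C D A * sarea D A B * sarea A B C)"
proof -
  have r: "sarea D B C = sarea B C D" "sarea D A C = sarea C D A"
    using sarea_rot by metis+
  have 4: "sarea A B C = sarea D B C - sarea D A C + sarea D A B"
    using arg_cong[OF wsum_1[of A B C D], of Re] by (simp add: wsum_def r)
  define u v w where uvw: "u = A - D" "v = B - D" "w = C - D"
  define k1 k2 k3 where k: "k1 = cnj v * w - v * cnj w" "k2 = cnj u * w - u * cnj w" "k3 = cnj u * v - u * cnj v"
  have s: "complex_of_real (sarea D B C) = - \<i> / 2 * k1"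
     "complex_of_real (sarea D A C) = - \<i> / 2 * k2"
     "complex_of_real (sarea D A B) = - \<i> / 2 * k3"
    by (simp_all add: of_real_sarea k uvw)
  have kc: "cnj k1 = - k1" "cnj k2 = -k2" "cnj k3 = -k3" by (simp_all add: k)
  have N: "complex_of_real (defect A B C D) = - \<i> / 2 * (k1 * (u * cnj u) - k2 * (v * cnj v) + k3 * (w * cnj w))"
    by (simp add: of_real_defect wsum_diff s uvw[symmetric] algebra_simps)
  have a: "slope A B C D = - \<i> / 2 * (k1 * u\<^sup>2 - k2 * v\<^sup>2 + k3 * w\<^sup>2)"
    by (simp add: slope_def wsum_diff s uvw[symmetric] algebra_simps)
  have a': "cnj (slope A B C D) = - \<i> / 2 * (k1 * (cnj u)\<^sup>2 - k2 * (cnj v)\<^sup>2 + k3 * (cnj w)\<^sup>2)"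
    by (simp add: a kc algebra_simps)
  have p: "(k1 * (u * cnj u) - k2 * (v * cnj v) + k3 * (w * cnj w))\<^sup>2 -
      (k1 * u\<^sup>2 - k2 * v\<^sup>2 + k3 * w\<^sup>2) * (k1 * (cnj u)\<^sup>2 - k2 * (cnj v)\<^sup>2 + k3 * (cnj w)\<^sup>2)
      = k1 * k2 * k3 * (k1 - k2 + k3)"
    unfolding k by (rule slope_defect_polynomial)
  have h: "(- \<i> / 2 * x)\<^sup>2 = - x\<^sup>2 / 4" "(- \<i> / 2 * x) * (- \<i> / 2 * y) = - (x * y) / 4" for x y :: complex
    by (simp_all add: power2_eq_square complex_eq_iff field_simps)
  have "of_real ((defect A B C D)\<^sup>2) - slope A B C D * cnj (slope A B C D) = - (k1 * k2 * k3 * (k1 - k2 + k3)) / 4"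
    unfolding of_real_power N a' unfolding a h p[symmetric] by (simp add: field_simps)
  also have "\<dots> = - 4 * of_real (sarea B C D * sarea C D A * sarea D A B * sarea A B C)"
    unfolding r[symmetric] 4 of_real_mult of_real_add of_real_diff s by (simp add: field_simps)
  finally show ?thesis .
qed

definition ccenter :: "complex \<Rightarrow> complex \<Rightarrow> complex \<Rightarrow> complex" where
  "ccenter X Y Z = X - \<i> * (Y - X) * (Z - X) * cnj (Y - Z) / (2 * of_real (sarea X Y Z))"

text \<open>
  The symmetric constant in the relation between a vertex and the center of the circle through the other three.
\<close>

definition cubic :: "complex \<Rightarrow> complex \<Rightarrow> complex \<Rightarrow> complex \<Rightarrow> complex" where
  "cubic A B C D = wsum (\<lambda>z. z * z * cnj z) A B C D"

lemma cubic_rot: "cubic B C D A = - cubic A B C D"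
  by (simp add: cubic_def wsum_def)

text \<open>
  The relations between the circumcenters and the numbers \<open>a\<close>, \<open>b\<close>, \<open>N\<close>, freed from denominators. Conjugates
  are independent variables, and \<open>s1, \<dots>, s4\<close> are the areas multiplied by \<open>2 \<i>\<close>, which makes every statement an
  identity between polynomials with integer coefficients.
\<close>

lemma center_polynomials: fixes A B C D :: complex and A' B' C' D' :: complex
  assumes s: "s1 = (C'-B')*(D-B) - (C-B)*(D'-B')" "s2 = (D'-C')*(A-C) - (D-C)*(A'-C')"
   "s3 = (A'-D')*(B-D) - (A-D)*(B'-D')" "s4 = (B'-A')*(C-A) - (B-A)*(C'-A')"
   and a: "a = s1 * A\<^sup>2 - s2 * B\<^sup>2 + s3 * C\<^sup>2 - s4 * D\<^sup>2"
   and n: "n = s1 * (A*A') - s2 * (B*B') + s3 * (C*C') - s4 * (D*D')"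
   and b: "b = s1 * (A - B) * (A - C) * (A - D) - a * A"
   and m: "m = s1 * (A*A*A') - s2 * (B*B*B') + s3 * (C*C*C') - s4 * (D*D*D')"
   and o1: "o1 = s1 * B + (C-B)*(D-B)*(C'-D')" "o1' = s1 * B' - (C'-B')*(D'-B')*(C-D)"
   and o2: "o2 = s2 * C + (D-C)*(A-C)*(D'-A')"
   and o3: "o3 = s3 * D + (A-D)*(B-D)*(A'-B')"
 shows "a * o1 + s1 * b = - n * ((B-C)*(C-D)*(D-B))"
   and "n * (s1 * A + o1) + a * o1' = s1 * m"
   and "s2 * o1 - s1 * o2 = - n * (C - D)"
   and "s3 * o1 - s1 * o3 = - n * (B - D)"
  unfolding o1 o2 o3 n b a m unfolding s by algebra+

lemma
  assumes A: "sarea B C D \<noteq> 0"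
  shows center_form: "slope A B C D * ccenter B C D + intercept A B C D =
           \<i> * of_real (defect A B C D) / (2 * of_real (sarea B C D)) * ((B-C)*(C-D)*(D-B))" (is ?g1)
    and center_cubic: "of_real (defect A B C D) * (A + ccenter B C D) + slope A B C D * cnj (ccenter B C D) = cubic A B C D" (is ?g2)
    and center_diff: "sarea C D A \<noteq> 0 \<Longrightarrow> ccenter B C D - ccenter C D A =
           \<i> * of_real (defect A B C D) * (C - D) / (2 * of_real (sarea B C D * sarea C D A))" (is "_ \<Longrightarrow> ?g3")
    and center_diff_opposite: "sarea D A B \<noteq> 0 \<Longrightarrow> ccenter B C D - ccenter D A B =
           \<i> * of_real (defect A B C D) * (B - D) / (2 * of_real (sarea B C D * sarea D A B))" (is "_ \<Longrightarrow> ?g4")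
proof -
  define k where "k X Y Z = cnj (Y - X) * (Z - X) - (Y - X) * cnj (Z - X)" for X Y Z
  define s1 s2 s3 s4 where s: "s1 = k B C D" "s2 = k C D A" "s3 = k D A B" "s4 = k A B C"
  have k: "complex_of_real (sarea X Y Z) = - \<i> / 2 * k X Y Z" for X Y Z
    by (simp add: of_real_sarea k_def)
  have k2: "k X Y Z = 2 * \<i> * of_real (sarea X Y Z)" for X Y Z
    by (simp add: k)
  have kc: "cnj (k X Y Z) = - k X Y Z" for X Y Z by (simp add: k_def)
  define a where "a = s1 * A\<^sup>2 - s2 * B\<^sup>2 + s3 * C\<^sup>2 - s4 * D\<^sup>2"
  define n where "n = s1 * (A*cnj A) - s2 * (B*cnj B) + s3 * (C*cnj C) - s4 * (D*cnj D)"
  define b where "b = s1 * (A - B) * (A - C) * (A - D) - a * A"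
  define m where "m = s1 * (A*A*cnj A) - s2 * (B*B*cnj B) + s3 * (C*C*cnj C) - s4 * (D*D*cnj D)"
  have sl: "slope A B C D = - \<i> / 2 * a"
    by (simp add: slope_def wsum_def k a_def s algebra_simps)
  have N: "complex_of_real (defect A B C D) = - \<i> / 2 * n"
    by (simp add: of_real_defect wsum_def k n_def s algebra_simps)
  have ic: "intercept A B C D = - \<i> / 2 * b"
    by (simp add: intercept_def sl b_def k s(1) field_simps)
  have cu: "cubic A B C D = - \<i> / 2 * m"
    by (simp add: cubic_def wsum_def k m_def s algebra_simps)
  have cc: "ccenter X Y Z = (k X Y Z * X + (Y - X) * (Z - X) * (cnj Y - cnj Z)) / k X Y Z" if "sarea X Y Z \<noteq> 0" for X Y Z
    using that unfolding ccenter_def k2 by (simp add: field_simps)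
  have s1: "s1 \<noteq> 0" using A by (simp add: s k2)
  note P = center_polynomials[of s1 "cnj C" "cnj B" D B C "cnj D" s2 A "cnj A" s3 s4, OF _ _ _ _ a_def n_def b_def m_def refl refl refl refl]
  have s': "s1 = (cnj C-cnj B)*(D-B) - (C-B)*(cnj D-cnj B)" "s2 = (cnj D-cnj C)*(A-C) - (D-C)*(cnj A-cnj C)"
   "s3 = (cnj A-cnj D)*(B-D) - (A-D)*(cnj B-cnj D)" "s4 = (cnj B-cnj A)*(C-A) - (B-A)*(cnj C-cnj A)"
    by (simp_all add: s k_def)
  note P = P[OF s']
  show ?g1
  proof -
    define E where "E = (B-C)*(C-D)*(D-B)"
    have 1: "a * ccenter B C D + b = - n * E / s1"
      unfolding E_def P(1)[symmetric] cc[OF A] using s1 by (simp add: s field_simps)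
    have "slope A B C D * ccenter B C D + intercept A B C D = - \<i> / 2 * (a * ccenter B C D + b)"
      by (simp add: sl ic algebra_simps)
    also have "\<dots> = \<i> * (- \<i> / 2 * n) / (2 * (- \<i> / 2 * s1)) * E"
      unfolding 1 using s1 by (simp add: field_simps)
    finally show ?thesis unfolding N k s E_def .
  qed
  show ?g2
  proof -
    have 1: "cnj (ccenter B C D) = (s1 * cnj B - (cnj C - cnj B) * (cnj D - cnj B) * (C - D)) / s1"
      unfolding cc[OF A] using s1 by (simp add: kc s field_simps)
    have "n * (A + ccenter B C D) + a * cnj (ccenter B C D) = s1 * m / s1"
      unfolding P(2)[symmetric] 1 unfolding cc[OF A] using s1 by (simp add: s field_simps)
    then have "- \<i> / 2 * (n * (A + ccenter B C D) + a * cnj (ccenter B C D)) = - \<i> / 2 * m" using s1 by simp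
    then show ?thesis
      unfolding sl cu N by (simp only: algebra_simps)
  qed
  show ?g3 if B: "sarea C D A \<noteq> 0"
  proof -
    have s2: "s2 \<noteq> 0" using B by (simp add: s k2)
    have "ccenter B C D - ccenter C D A = - n * (C - D) / (s1 * s2)"
      unfolding P(3)[symmetric] cc[OF A] cc[OF B] using s1 s2 by (simp add: s field_simps)
    also have "\<dots> = \<i> * (- \<i> / 2 * n) * (C - D) / (2 * (- \<i> / 2 * s1 * (- \<i> / 2 * s2)))"
      using s1 s2 by (simp add: field_simps)
    finally show ?thesis unfolding N of_real_mult k s by (simp add: mult_ac)
  qed
  show ?g4 if B: "sarea D A B \<noteq> 0"
  proof -
    have s3: "s3 \<noteq> 0" using B by (simp add: s k2)
    have "ccenter B C D - ccenter D A B = - n * (B - D) / (s1 * s3)"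
      unfolding P(4)[symmetric] cc[OF A] cc[OF B] using s1 s3 by (simp add: s field_simps)
    also have "\<dots> = \<i> * (- \<i> / 2 * n) * (B - D) / (2 * (- \<i> / 2 * s1 * (- \<i> / 2 * s3)))"
      using s1 s3 by (simp add: field_simps)
    finally show ?thesis unfolding N of_real_mult k s by (simp add: mult_ac)
  qed
qed

section \<open>The step to the circumcenters as an affine map\<close>

lemma sarea_affine:
  fixes f :: "complex \<Rightarrow> complex" and c p q :: complex
  assumes "\<And>z. f z = c + p * z + q * cnj z"
  shows "sarea (f X) (f Y) (f Z) = ((cmod p)\<^sup>2 - (cmod q)\<^sup>2) * sarea X Y Z"
proof -
  have "complex_of_real (sarea (f X) (f Y) (f Z)) = (p * cnj p - q * cnj q) * of_real (sarea X Y Z)"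
    unfolding of_real_sarea assms by (simp add: field_simps)
  also have "\<dots> = of_real (((cmod p)\<^sup>2 - (cmod q)\<^sup>2) * sarea X Y Z)"
    by (simp add: complex_norm_square del: of_real_power)
  finally show ?thesis by (simp only: of_real_eq_iff)
qed

text \<open>
  The translation part \<open>c\<close> drops out because the weights annihilate the constants and the functions \<open>z\<close>
  and \<open>cnj z\<close>.
\<close>

lemma slope_defect_affine:
  fixes f :: "complex \<Rightarrow> complex" and c p q :: complex
  assumes f: "\<And>z. f z = c + p * z + q * cnj z"
  defines "d \<equiv> (cmod p)\<^sup>2 - (cmod q)\<^sup>2"
  shows "slope (f A) (f B) (f C) (f D) =
           d * (p\<^sup>2 * slope A B C D + 2 * p * q * defect A B C D + q\<^sup>2 * cnj (slope A B C D))"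
    and "defect (f A) (f B) (f C) (f D) =
           d * (((cmod p)\<^sup>2 + (cmod q)\<^sup>2) * defect A B C D + 2 * Re (p * cnj q * slope A B C D))"
proof -
  define s1 s2 s3 s4 where s: "s1 = complex_of_real (sarea B C D)" "s2 = complex_of_real (sarea C D A)"
    "s3 = complex_of_real (sarea D A B)" "s4 = complex_of_real (sarea A B C)"
  have 1: "s1 - s2 + s3 - s4 = (0::complex)"
    using wsum_1[of A B C D] by (simp add: wsum_def s)
  have 2: "s1 * A - s2 * B + s3 * C - s4 * D = 0"
    using wsum_id[of A B C D] by (simp add: wsum_def s)
  have 3: "s1 * cnj A - s2 * cnj B + s3 * cnj C - s4 * cnj D = 0"
    using wsum_cnj[of A B C D] by (simp add: wsum_def s)
  have sa: "sarea (f X) (f Y) (f Z) = d * sarea X Y Z" for X Y Z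
    unfolding d_def by (rule sarea_affine[OF f])
  have w: "wsum g (f A) (f B) (f C) (f D) = d * (s1 * g (f A) - s2 * g (f B) + s3 * g (f C) - s4 * g (f D))" for g
    by (simp add: wsum_def sa s algebra_simps)
  have sl: "slope A B C D = s1 * A\<^sup>2 - s2 * B\<^sup>2 + s3 * C\<^sup>2 - s4 * D\<^sup>2" by (simp add: slope_def wsum_def s)
  have sc: "cnj (slope A B C D) = s1 * (cnj A)\<^sup>2 - s2 * (cnj B)\<^sup>2 + s3 * (cnj C)\<^sup>2 - s4 * (cnj D)\<^sup>2"
    by (simp add: slope_def wsum_def s)
  have df: "complex_of_real (defect A B C D) = s1 * (A * cnj A) - s2 * (B * cnj B) + s3 * (C * cnj C) - s4 * (D * cnj D)"
    by (simp add: of_real_defect wsum_def s)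
  have "s1 * (f A)\<^sup>2 - s2 * (f B)\<^sup>2 + s3 * (f C)\<^sup>2 - s4 * (f D)\<^sup>2 =
     p\<^sup>2 * slope A B C D + 2 * p * q * defect A B C D + q\<^sup>2 * cnj (slope A B C D)"
  proof -
    have "s1 * (c + p * A + q * A')\<^sup>2 - s2 * (c + p * B + q * B')\<^sup>2 + s3 * (c + p * C + q * C')\<^sup>2 - s4 * (c + p * D + q * D')\<^sup>2
      = p\<^sup>2 * (s1 * A\<^sup>2 - s2 * B\<^sup>2 + s3 * C\<^sup>2 - s4 * D\<^sup>2)
      + 2 * p * q * (s1 * (A * A') - s2 * (B * B') + s3 * (C * C') - s4 * (D * D'))
      + q\<^sup>2 * (s1 * A'\<^sup>2 - s2 * B'\<^sup>2 + s3 * C'\<^sup>2 - s4 * D'\<^sup>2)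
      + c\<^sup>2 * (s1 - s2 + s3 - s4) + 2 * c * p * (s1 * A - s2 * B + s3 * C - s4 * D)
      + 2 * c * q * (s1 * A' - s2 * B' + s3 * C' - s4 * D')" for A' B' C' D' :: complex
      by algebra
    then show ?thesis unfolding sc unfolding sl df f by (simp add: 1 2 3)
  qed
  then show "slope (f A) (f B) (f C) (f D) =
           d * (p\<^sup>2 * slope A B C D + 2 * p * q * defect A B C D + q\<^sup>2 * cnj (slope A B C D))"
    by (simp add: slope_def w)
  have "s1 * (f A * cnj (f A)) - s2 * (f B * cnj (f B)) + s3 * (f C * cnj (f C)) - s4 * (f D * cnj (f D)) =
     (p * cnj p + q * cnj q) * defect A B C D + (p * cnj q * slope A B C D + cnj p * q * cnj (slope A B C D))"
  proof -
    have "s1 * ((c + p * A + q * A') * (c' + p' * A' + q' * A)) - s2 * ((c + p * B + q * B') * (c' + p' * B' + q' * B))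
        + s3 * ((c + p * C + q * C') * (c' + p' * C' + q' * C)) - s4 * ((c + p * D + q * D') * (c' + p' * D' + q' * D))
      = (p * p' + q * q') * (s1 * (A * A') - s2 * (B * B') + s3 * (C * C') - s4 * (D * D'))
      + (p * q' * (s1 * A\<^sup>2 - s2 * B\<^sup>2 + s3 * C\<^sup>2 - s4 * D\<^sup>2)
      + p' * q * (s1 * A'\<^sup>2 - s2 * B'\<^sup>2 + s3 * C'\<^sup>2 - s4 * D'\<^sup>2))
      + c * c' * (s1 - s2 + s3 - s4) + (p * c' + c * q') * (s1 * A - s2 * B + s3 * C - s4 * D)
      + (q * c' + c * p') * (s1 * A' - s2 * B' + s3 * C' - s4 * D')" for A' B' C' D' c' p' q' :: complex
      by algebra
    then show ?thesis unfolding sc unfolding sl df f complex_cnj_add complex_cnj_mult complex_cnj_cnj by (simp add: 1 2 3)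
  qed
  also have "p * cnj q * slope A B C D + cnj p * q * cnj (slope A B C D) = of_real (2 * Re (p * cnj q * slope A B C D))"
    using complex_add_cnj[of "p * cnj q * slope A B C D"] by (simp add: mult_ac)
  also have "(p * cnj p + q * cnj q) = of_real ((cmod p)\<^sup>2 + (cmod q)\<^sup>2)"
    by (simp add: complex_norm_square del: of_real_power)
  finally have "complex_of_real (defect (f A) (f B) (f C) (f D)) =
           of_real (d * (((cmod p)\<^sup>2 + (cmod q)\<^sup>2) * defect A B C D + 2 * Re (p * cnj q * slope A B C D)))"
    by (simp add: of_real_defect w)
  then show "defect (f A) (f B) (f C) (f D) =
           d * (((cmod p)\<^sup>2 + (cmod q)\<^sup>2) * defect A B C D + 2 * Re (p * cnj q * slope A B C D))"
    by (simp only: of_real_eq_iff)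
qed

lemma ccenter_similarity:
  assumes "k \<noteq> 0"
  shows "ccenter (c + k * X) (c + k * Y) (c + k * Z) = c + k * ccenter X Y Z"
proof -
  have s: "sarea (c + k * X) (c + k * Y) (c + k * Z) = (cmod k)\<^sup>2 * sarea X Y Z"
    using sarea_affine[of "\<lambda>z. c + k * z" c k 0 X Y Z] by simp
  have "k * cnj k \<noteq> 0" using assms by simp
  have d: "c + k * Y - (c + k * X) = k * (Y - X)" "c + k * Z - (c + k * X) = k * (Z - X)"
    "c + k * Y - (c + k * Z) = k * (Y - Z)" by (simp_all add: algebra_simps)
  have 1: "\<i> * (k * U) * (k * V) * (cnj k * T) / (2 * (k * cnj k * S)) = k * (\<i> * U * V * T / (2 * S))" for U V T S
    using assms by (simp add: field_simps)
  have 2: "c + k * X - k * V = c + k * (X - V)" for V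
    by (simp add: algebra_simps)
  show ?thesis
    unfolding ccenter_def s d of_real_mult complex_norm_square complex_cnj_mult 1 2 ..
qed

lemma slope_intercept_similarity:
  fixes k c :: complex
  defines "f \<equiv> \<lambda>z. c + k * z"
  shows "slope (f A) (f B) (f C) (f D) = of_real ((cmod k)\<^sup>2) * k\<^sup>2 * slope A B C D"
    and "defect (f A) (f B) (f C) (f D) = (cmod k) ^ 4 * defect A B C D"
    and "intercept (f A) (f B) (f C) (f D) = of_real ((cmod k)\<^sup>2) * k\<^sup>2 * (k * intercept A B C D - c * slope A B C D)"
proof -
  have f: "f z = c + k * z + 0 * cnj z" for z by (simp add: f_def)
  show sl: "slope (f A) (f B) (f C) (f D) = of_real ((cmod k)\<^sup>2) * k\<^sup>2 * slope A B C D"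
    using slope_defect_affine(1)[of f, OF f, of A B C D] by simp
  show "defect (f A) (f B) (f C) (f D) = (cmod k) ^ 4 * defect A B C D"
    using slope_defect_affine(2)[of f, OF f, of A B C D] by simp
  have s: "sarea (f B) (f C) (f D) = (cmod k)\<^sup>2 * sarea B C D"
    using sarea_affine[of f, OF f] by simp
  have d: "f A - f X = k * (A - X)" for X by (simp add: f_def algebra_simps)
  show "intercept (f A) (f B) (f C) (f D) = of_real ((cmod k)\<^sup>2) * k\<^sup>2 * (k * intercept A B C D - c * slope A B C D)"
    unfolding intercept_def s sl d of_real_mult unfolding f_def by algebra
qed

text \<open>
  The factor of the homothety between a generation and the next one of equal parity.
\<close>

definition step_ratio :: "complex \<Rightarrow> complex \<Rightarrow> complex \<Rightarrow> complex \<Rightarrow> real" where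
  "step_ratio A B C D =
     - (defect A B C D)\<^sup>2 / (4 * (sarea B C D * sarea C D A * sarea D A B * sarea A B C))"

lemma step_ratio_rot: "step_ratio B C D A = step_ratio A B C D"
  by (simp add: step_ratio_def defect_rot[where A=A] mult_ac)

text \<open>
  The algebraic form of a nondegenerate quadrilateral whose vertices are not concyclic.
\<close>

locale noncyclic4 =
  fixes A B C D :: complex
  assumes sarea_nonzero: "sarea B C D \<noteq> 0" "sarea C D A \<noteq> 0" "sarea D A B \<noteq> 0" "sarea A B C \<noteq> 0"
    and defect_nonzero: "defect A B C D \<noteq> 0"
begin

abbreviation "a \<equiv> slope A B C D"
abbreviation "b \<equiv> intercept A B C D"
abbreviation "N \<equiv> defect A B C D"
abbreviation "r \<equiv> step_ratio A B C D"

lemma rotated: "noncyclic4 B C D A"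
  using sarea_nonzero defect_nonzero by unfold_locales (simp_all add: defect_rot[where A=A])

lemma r_nonzero: "r \<noteq> 0"
  using sarea_nonzero defect_nonzero by (simp add: step_ratio_def)

lemma r_slope: "r * (N\<^sup>2 - (cmod a)\<^sup>2) = N\<^sup>2"
proof -
  have "complex_of_real (N\<^sup>2 - (cmod a)\<^sup>2) = of_real (- 4 * (sarea B C D * sarea C D A * sarea D A B * sarea A B C))"
    using defect_slope_sarea[of A B C D] by (simp add: complex_norm_square del: of_real_power)
  then have "N\<^sup>2 - (cmod a)\<^sup>2 = - 4 * (sarea B C D * sarea C D A * sarea D A B * sarea A B C)"
    by (simp only: of_real_eq_iff)
  then show ?thesis using sarea_nonzero by (simp add: step_ratio_def)
qed

lemma r_eq_1: "r = 1 \<longleftrightarrow> a = 0"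
  using r_slope r_nonzero defect_nonzero by (cases "r = 1") (auto simp: algebra_simps)

lemma r_slope_complex: "of_real r * (of_real N * of_real N - a * cnj a) = complex_of_real N * of_real N"
  unfolding complex_norm_square[symmetric] of_real_mult[symmetric] of_real_diff[symmetric] of_real_eq_iff
  using r_slope by (simp add: power2_eq_square)

definition shift :: complex where
  "shift = of_real r / of_real N * (cubic A B C D - a / of_real N * cnj (cubic A B C D))"

lemma shift_rot: "noncyclic4.shift B C D A = shift"
proof -
  interpret R: noncyclic4 B C D A by (rule rotated)
  show ?thesis by (simp add: R.shift_def shift_def slope_rot[where A=A] cubic_rot[where A=A] defect_rot[where A=A] step_ratio_rot[where A=A] algebra_simps)
qed

text \<open>
  For a given vertex \<open>A\<close>, \<open>center_cubic\<close> is a real linear equation for the center. Its conjugate is a second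
  one, and eliminating the conjugate of the center leaves a formula that has the same coefficients for all
  four vertices.
\<close>

lemma center_affine: "ccenter B C D = shift - r * A + r * (a / N) * cnj A"
proof -
  define o' where "o' = ccenter B C D"
  define M where "M = cubic A B C D"
  define n where "n = complex_of_real N"
  have n: "n \<noteq> 0" "cnj n = n" using defect_nonzero by (simp_all add: n_def)
  have 1: "n * (A + o') + a * cnj o' = M"
    using center_cubic[OF sarea_nonzero(1)] by (simp add: o'_def M_def n_def)
  have 2: "n * (cnj A + cnj o') + cnj a * o' = cnj M"
    using arg_cong[OF 1, of cnj] n by simp
  have 3: "r * (n * n - a * cnj a) = n * n"
    using r_slope_complex by (simp add: n_def)
  have "n * n * o' = r * (n * n - a * cnj a) * o'" unfolding 3 ..
  also have "\<dots> = r * (n * M - a * cnj M) - n * n * r * A + n * r * a * cnj A"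
    unfolding 1[symmetric] complex_cnj_add complex_cnj_mult complex_cnj_cnj n by algebra
  finally have "o' = (r * (n * M - a * cnj M) - n * n * r * A + n * r * a * cnj A) / (n * n)"
    using n by (simp add: field_simps)
  then show ?thesis using n
    unfolding o'_def shift_def M_def[symmetric] n_def[symmetric] by (simp add: field_simps)
qed

lemma centers_affine:
  "ccenter C D A = shift - r * B + r * (a / N) * cnj B"
  "ccenter D A B = shift - r * C + r * (a / N) * cnj C"
  "ccenter A B C = shift - r * D + r * (a / N) * cnj D"
proof -
  interpret R: noncyclic4 B C D A by (rule rotated)
  interpret R2: noncyclic4 C D A B by (rule R.rotated)
  interpret R3: noncyclic4 D A B C by (rule R2.rotated)
  show "ccenter C D A = shift - r * B + r * (a / N) * cnj B"
    using R.center_affine unfolding shift_rot by (simp add: slope_rot[where A=A] defect_rot[where A=A] step_ratio_rot[where A=A])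
  show "ccenter D A B = shift - r * C + r * (a / N) * cnj C"
    using R2.center_affine unfolding R.shift_rot shift_rot by (simp add: slope_rot[where A=A] defect_rot[where A=A] step_ratio_rot[where A=A] slope_rot[where A=B] defect_rot[where A=B] step_ratio_rot[where A=B])
  show "ccenter A B C = shift - r * D + r * (a / N) * cnj D"
    using R3.center_affine unfolding R2.shift_rot R.shift_rot shift_rot by (simp add: slope_rot[where A=A] defect_rot[where A=A] step_ratio_rot[where A=A] slope_rot[where A=B] defect_rot[where A=B] step_ratio_rot[where A=B] slope_rot[where A=C] defect_rot[where A=C] step_ratio_rot[where A=C])
qed

text \<open>
  The determinant of the affine map \<open>A \<mapsto> O1\<close>.
\<close>

lemma affine_det: "(cmod (- complex_of_real r))\<^sup>2 - (cmod (r * (a / N)))\<^sup>2 = r"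
proof -
  have "r * r * (N\<^sup>2 - (cmod a)\<^sup>2) = r * N\<^sup>2" using r_slope by (simp add: mult.assoc)
  then show ?thesis using defect_nonzero
    by (simp add: norm_mult norm_divide power_mult_distrib power_divide field_simps power2_eq_square)
qed

abbreviation "O1 \<equiv> ccenter B C D"
abbreviation "O2 \<equiv> ccenter C D A"
abbreviation "O3 \<equiv> ccenter D A B"
abbreviation "O4 \<equiv> ccenter A B C"

lemma sarea_centers:
  "sarea O2 O3 O4 = r * sarea B C D" "sarea O3 O4 O1 = r * sarea C D A"
  "sarea O4 O1 O2 = r * sarea D A B" "sarea O1 O2 O3 = r * sarea A B C"
  unfolding center_affine centers_affine
  using sarea_affine[of "\<lambda>z. shift - r * z + r * (a / N) * cnj z" shift "- complex_of_real r" "r * (a / N)"]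
  unfolding affine_det by simp_all

text \<open>
  An affine map with linear part \<open>- r z + (r a / N) cnj z\<close> mixes \<open>a\<close>, \<open>N\<close> and \<open>cnj a\<close>; the special value of the
  second coefficient makes the result proportional to the original pair.
\<close>

lemma slope_centers: "slope O1 O2 O3 O4 = - r\<^sup>2 * a"
  and defect_centers: "defect O1 O2 O3 O4 = r\<^sup>2 * N"
proof -
  note 3 = r_slope_complex
  have f: "shift - r * z + r * (a / N) * cnj z = shift + (- complex_of_real r) * z + r * (a / N) * cnj z" for z :: complex by simp
  have "slope O1 O2 O3 O4 = r * ((- r)\<^sup>2 * a + 2 * (- r) * (r * (a / N)) * N + (r * (a / N))\<^sup>2 * cnj a)"
    using slope_defect_affine(1)[of "\<lambda>z. shift - r * z + r * (a / N) * cnj z", OF f, of A B C D]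
    unfolding center_affine centers_affine affine_det by simp
  also have "\<dots> = - r * r * (a / (of_real N * of_real N)) * (of_real r * (of_real N * of_real N - a * cnj a))"
    using defect_nonzero by (simp add: field_simps power2_eq_square)
  also have "\<dots> = - r\<^sup>2 * a" unfolding 3 using defect_nonzero by (simp add: power2_eq_square)
  finally show "slope O1 O2 O3 O4 = - r\<^sup>2 * a" .
  have "defect O1 O2 O3 O4 = r * (((cmod (- complex_of_real r))\<^sup>2 + (cmod (r * (a / N)))\<^sup>2) * N + 2 * Re ((- complex_of_real r) * cnj (r * (a / N)) * a))"
    using slope_defect_affine(2)[of "\<lambda>z. shift - r * z + r * (a / N) * cnj z", OF f, of A B C D]
    unfolding center_affine centers_affine affine_det by simp
  also have "Re ((- complex_of_real r) * cnj (r * (a / N)) * a) = - r * r / N * (cmod a)\<^sup>2"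
  proof -
    have "(- complex_of_real r) * cnj (r * (a / N)) * a = of_real (- r * r / N) * (a * cnj a)"
      by simp
    also have "\<dots> = of_real (- r * r / N * (cmod a)\<^sup>2)"
      by (simp add: complex_norm_square del: of_real_power)
    finally show ?thesis by (simp only: Re_complex_of_real)
  qed
  also have "r * (((cmod (- complex_of_real r))\<^sup>2 + (cmod (r * (a / N)))\<^sup>2) * N + 2 * (- r * r / N * (cmod a)\<^sup>2)) = r * r / N * (r * (N\<^sup>2 - (cmod a)\<^sup>2))"
    using defect_nonzero by (simp add: norm_mult norm_divide power_mult_distrib power_divide field_simps power2_eq_square)
  also have "\<dots> = r\<^sup>2 * N" unfolding r_slope using defect_nonzero by (simp add: power2_eq_square)
  finally show "defect O1 O2 O3 O4 = r\<^sup>2 * N" .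
qed

lemma noncyclic4_centers: "noncyclic4 O1 O2 O3 O4"
  using sarea_nonzero r_nonzero defect_nonzero by unfold_locales (simp_all add: sarea_centers defect_centers)

lemma step_ratio_centers: "step_ratio O1 O2 O3 O4 = r"
proof -
  have "step_ratio O1 O2 O3 O4 = - N\<^sup>2 / (4 * (sarea B C D * sarea C D A * sarea D A B * sarea A B C))"
    unfolding step_ratio_def defect_centers sarea_centers using r_nonzero
    by (simp add: field_simps power2_eq_square)
  then show ?thesis by (simp add: step_ratio_def)
qed

lemma weight_product: "of_real (sarea B C D) * ((A - B) * (A - C) * (A - D)) = a * A + b"
  by (simp add: intercept_def)

text \<open>
  The differences of centers are explicit (\<open>center_diff\<close>), so the product that defines the form of the new
  quadrilateral at \<open>O1\<close> can be compared with the value \<open>a * O1 + b\<close> of the old form.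
\<close>

lemma intercept_centers: "intercept O1 O2 O3 O4 = - r\<^sup>2 * b"
proof -
  define s1 s2 s3 s4 where s: "s1 = complex_of_real (sarea B C D)" "s2 = complex_of_real (sarea C D A)"
    "s3 = complex_of_real (sarea D A B)" "s4 = complex_of_real (sarea A B C)"
  have s0: "s1 \<noteq> 0" "s2 \<noteq> 0" "s3 \<noteq> 0" "s4 \<noteq> 0" using sarea_nonzero by (simp_all add: s)
  interpret O: noncyclic4 O1 O2 O3 O4 by (rule noncyclic4_centers)
  have d: "O1 - O2 = \<i> * N * (C - D) / (2 * (s1 * s2))" "O1 - O3 = \<i> * N * (B - D) / (2 * (s1 * s3))"
    using center_diff center_diff_opposite sarea_nonzero by (simp_all add: s)
  have d41: "O4 - O1 = \<i> * (- N) * (B - C) / (2 * (s4 * s1))"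
    using center_diff[of A B C D] sarea_nonzero defect_rot[where A=D] by (simp add: s)
  have "O1 - O4 = - (O4 - O1)" by simp
  also have "\<dots> = \<i> * N * (B - C) / (2 * (s4 * s1))" unfolding d41 by simp
  finally have d4: "O1 - O4 = \<i> * N * (B - C) / (2 * (s4 * s1))" .
  define E where "E = (B-C)*(C-D)*(D-B)"
  have "slope O1 O2 O3 O4 * O1 + intercept O1 O2 O3 O4 = of_real (r * sarea B C D) * ((O1 - O2) * (O1 - O3) * (O1 - O4))"
    using O.weight_product by (simp add: sarea_centers)
  also have "\<dots> = \<i> * r * N * (N\<^sup>2 / (s1 * s2 * s3 * s4)) / (8 * s1) * E"
    unfolding d d4 E_def using s0 by (simp add: s[symmetric] field_simps power2_eq_square)
  also have "N\<^sup>2 / (s1 * s2 * s3 * s4) = - 4 * r"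
    using s0 unfolding step_ratio_def by (simp add: s field_simps)
  also have "\<i> * r * N * (- 4 * r) / (8 * s1) * E = - r\<^sup>2 * (\<i> * N / (2 * s1) * E)"
    using s0 by (simp add: field_simps power2_eq_square)
  also have "\<i> * N / (2 * s1) * E = a * O1 + b"
    using center_form[OF sarea_nonzero(1)] by (simp add: s E_def)
  finally show ?thesis unfolding slope_centers by (simp add: algebra_simps)
qed

text \<open>
  If \<open>a = 0\<close>, then \<open>w = 0\<close> and \<open>r = 1\<close>, so that the map \<open>h\<close> below is the identity and the formulas for the
  generations hold in this case too.
\<close>

definition w :: complex where "w = - b / a"

definition W :: "complex option" where "W = (if a = 0 then None else Some w)"

abbreviation h :: "complex \<Rightarrow> complex" where "h z \<equiv> w + r * (z - w)"

text \<open>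
  The affine maps of two consecutive steps have opposite coefficients of \<open>cnj z\<close>, and the conjugates cancel in the
  composition: it is \<open>z \<mapsto> \<delta> + r z\<close>. Since two steps multiply \<open>a\<close> and \<open>b\<close> by the same number \<open>r\<^sup>4\<close>, this
  similarity fixes \<open>W\<close>, which determines \<open>\<delta>\<close>. For \<open>a = 0\<close> that argument is void, but then a step is a point
  reflection of the quadrilateral.
\<close>

lemma second_centers:
  "ccenter O2 O3 O4 = h A" "ccenter O3 O4 O1 = h B" "ccenter O4 O1 O2 = h C" "ccenter O1 O2 O3 = h D"
proof -
  interpret O: noncyclic4 O1 O2 O3 O4 by (rule noncyclic4_centers)
  define S where "S = O.shift"
  define \<delta> where "\<delta> = S - r * shift - r * (a / N) * cnj shift"
  have N: "complex_of_real N \<noteq> 0" using defect_nonzero by simp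
  have q: "slope O1 O2 O3 O4 / defect O1 O2 O3 O4 = - (a / N)"
    unfolding slope_centers defect_centers using r_nonzero N by (simp add: field_simps)
  have X: "S - r * (shift - r * X + r * (a / N) * cnj X) +
       r * (- (a / N)) * cnj (shift - r * X + r * (a / N) * cnj X) = \<delta> + r * X" (is "?L = _") for X :: complex
  proof -
    have "?L = \<delta> + (r * (r * (of_real N * of_real N - a * cnj a))) / (of_real N * of_real N) * X"
      using N unfolding \<delta>_def by (simp add: field_simps)
    then show ?thesis unfolding r_slope_complex using N by simp
  qed
  have c: "ccenter O2 O3 O4 = \<delta> + r * A" "ccenter O3 O4 O1 = \<delta> + r * B" "ccenter O4 O1 O2 = \<delta> + r * C" "ccenter O1 O2 O3 = \<delta> + r * D"
    unfolding O.center_affine O.centers_affine q step_ratio_centers S_def[symmetric] unfolding center_affine centers_affine by (rule X)+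
  have "\<delta> = (1 - r) * w"
  proof (cases "a = 0")
    case True
    then have r1: "r = 1" by (simp add: r_eq_1)
    have "ccenter O2 O3 O4 = ccenter (shift + (- 1) * B) (shift + (- 1) * C) (shift + (- 1) * D)"
      unfolding centers_affine r1 True by simp
    also have "\<dots> = shift - O1" using ccenter_similarity[of "-1"] by simp
    also have "\<dots> = A" unfolding center_affine r1 True by simp
    finally show ?thesis using c(1) r1 by simp
  next
    case False
    have "intercept (\<delta> + r * A) (\<delta> + r * B) (\<delta> + r * C) (\<delta> + r * D) = (- r\<^sup>2) * ((- r\<^sup>2) * b)"
      using O.intercept_centers unfolding c step_ratio_centers intercept_centers by simp
    then have "r ^ 4 * (r * b - \<delta> * a) = r ^ 4 * b"
      unfolding slope_intercept_similarity by (simp add: power2_eq_square power4_eq_xxxx)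
    then have "r * b - \<delta> * a = b" using r_nonzero by simp
    then show ?thesis using False by (simp add: w_def field_simps)
  qed
  then have "\<delta> + r * X = h X" for X :: complex by (simp add: algebra_simps)
  then show "ccenter O2 O3 O4 = h A" "ccenter O3 O4 O1 = h B" "ccenter O4 O1 O2 = h C" "ccenter O1 O2 O3 = h D"
    using c by simp_all
qed

text \<open>
  For finite \<open>W\<close>: the distance from \<open>W\<close> to the center is \<open>\<bar>N\<bar> / \<bar>a\<bar>\<close> times the radius, for every triad circle.
\<close>

lemma radius_form: "cmod (a * O1 + b) = \<bar>N\<bar> * dist O1 B"
proof -
  have "cmod (a * O1 + b) = \<bar>N\<bar> * (cmod (B - C) * cmod (C - D) * cmod (D - B) / (2 * \<bar>sarea B C D\<bar>))"
    unfolding center_form[OF sarea_nonzero(1)] by (simp add: norm_mult norm_divide)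
  also have "cmod (B - C) * cmod (C - D) * cmod (D - B) / (2 * \<bar>sarea B C D\<bar>) = dist O1 B"
    unfolding ccenter_def dist_norm by (simp add: norm_mult norm_divide norm_minus_commute flip: complex_cnj_diff)
  finally show ?thesis .
qed

definition vandermonde :: real where
  "vandermonde = cmod (A - B) * cmod (A - C) * cmod (A - D) * cmod (B - C) * cmod (B - D) * cmod (C - D)"

text \<open>
  The area of the triangle occurs in \<open>a * A + b\<close> and in the denominator of the circumradius; all six distances
  between vertices remain.
\<close>

lemma radius_vandermonde: "2 * cmod (a * A + b) * dist O1 B = vandermonde"
proof -
  have "dist O1 B = cmod (B - C) * cmod (C - D) * cmod (D - B) / (2 * \<bar>sarea B C D\<bar>)"
    unfolding ccenter_def dist_norm by (simp add: norm_mult norm_divide norm_minus_commute flip: complex_cnj_diff)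
  moreover have "cmod (a * A + b) = \<bar>sarea B C D\<bar> * (cmod (A - B) * cmod (A - C) * cmod (A - D))"
    unfolding weight_product[symmetric] by (simp add: norm_mult)
  ultimately show ?thesis using sarea_nonzero by (simp add: vandermonde_def norm_minus_commute mult_ac)
qed

end

section \<open>Circumcircles and concyclicity\<close>

lemma ccenter_diffs:
  assumes "sarea X Y Z \<noteq> 0"
  defines "U \<equiv> Y - X" and "V \<equiv> Z - X"
  defines "\<kappa> \<equiv> 2 * \<i> * of_real (sarea X Y Z)"
  shows "\<kappa> \<noteq> 0" "\<kappa> = cnj U * V - U * cnj V"
    "ccenter X Y Z - X = U * V * cnj (U - V) / \<kappa>"
    "ccenter X Y Z - Y = U * cnj V * (U - V) / \<kappa>"
    "ccenter X Y Z - Z = cnj U * V * (U - V) / \<kappa>"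
proof -
  show k: "\<kappa> \<noteq> 0" using assms(1) by (simp add: \<kappa>_def)
  show k2: "\<kappa> = cnj U * V - U * cnj V"
    by (simp add: \<kappa>_def of_real_sarea U_def V_def)
  have UV: "Y - Z = U - V" by (simp add: U_def V_def)
  have "ccenter X Y Z - X = - (\<i> * (U * V * cnj (U - V))) / (2 * of_real (sarea X Y Z))"
    unfolding ccenter_def UV U_def[symmetric] V_def[symmetric] by (simp add: mult.assoc)
  also have "\<dots> = U * V * cnj (U - V) / \<kappa>"
  proof -
    have "- (\<i> * x) / (2 * s) = x / (2 * \<i> * s)" if "s \<noteq> 0" for x s :: complex
      using that by (simp add: field_simps)
    then show ?thesis using assms(1) unfolding \<kappa>_def by simp
  qed
  finally show 1: "ccenter X Y Z - X = U * V * cnj (U - V) / \<kappa>" .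
  have "ccenter X Y Z - Y = U * V * cnj (U - V) / \<kappa> - U" unfolding 1[symmetric] by (simp add: U_def)
  also have "\<dots> = (U * V * cnj (U - V) - U * \<kappa>) / \<kappa>" using k by (simp add: diff_divide_distrib)
  also have "U * V * cnj (U - V) - U * \<kappa> = U * cnj V * (U - V)"
    unfolding k2 by (simp add: algebra_simps)
  finally show "ccenter X Y Z - Y = U * cnj V * (U - V) / \<kappa>" .
  have "ccenter X Y Z - Z = U * V * cnj (U - V) / \<kappa> - V" unfolding 1[symmetric] by (simp add: V_def)
  also have "\<dots> = (U * V * cnj (U - V) - V * \<kappa>) / \<kappa>" using k by (simp add: diff_divide_distrib)
  also have "U * V * cnj (U - V) - V * \<kappa> = cnj U * V * (U - V)"
    unfolding k2 by (simp add: algebra_simps)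
  finally show "ccenter X Y Z - Z = cnj U * V * (U - V) / \<kappa>" .
qed

lemma dist_ccenter:
  assumes "sarea X Y Z \<noteq> 0"
  shows "dist (ccenter X Y Z) Y = dist (ccenter X Y Z) X" "dist (ccenter X Y Z) Z = dist (ccenter X Y Z) X"
  unfolding dist_norm ccenter_diffs(3-)[OF assms] by (simp_all add: norm_mult norm_divide flip: complex_cnj_diff)

lemma equidistant_eq_ccenter:
  assumes s: "sarea X Y Z \<noteq> 0" and "dist c X = R" "dist c Y = R" "dist c Z = R"
  shows "c = ccenter X Y Z"
proof -
  define e U V where d: "e = c - X" "U = Y - X" "V = Z - X"
  have n: "(x - y) * cnj (x - y) = x * cnj x \<longleftrightarrow> x * cnj y + cnj x * y = y * cnj y" for x y
    by (simp add: algebra_simps) (metis add.commute add_left_cancel)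
  have "cmod (e - U) = cmod e" "cmod (e - V) = cmod e"
    using assms by (simp_all add: d dist_norm)
  then have "(e - U) * cnj (e - U) = e * cnj e" "(e - V) * cnj (e - V) = e * cnj e"
    by (simp_all only: complex_norm_square[symmetric])
  then have "e * cnj U + cnj e * U = U * cnj U" "e * cnj V + cnj e * V = V * cnj V"
    by (simp_all only: n)
  then have "e * (cnj U * V - U * cnj V) = U * V * (cnj U - cnj V)"
    by algebra
  moreover have "2 * \<i> * of_real (sarea X Y Z) = cnj U * V - U * cnj V"
    using ccenter_diffs(2)[OF s] by (simp add: d)
  ultimately have "e = ccenter X Y Z - X"
    unfolding ccenter_diffs(3)[OF s] d(2,3)[symmetric] using ccenter_diffs(1)[OF s]
    by (simp add: eq_divide_eq)
  then show ?thesis by (simp add: d)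
qed

lemma circumcircle_eq:
  assumes "sarea X Y Z \<noteq> 0"
  shows "circumcircle X Y Z = Circle (ccenter X Y Z) (dist (ccenter X Y Z) X)"
  unfolding circumcircle_def
proof (rule the_equality)
  show "{X, Y, Z} \<subseteq> sphere (center (Circle (ccenter X Y Z) (dist (ccenter X Y Z) X))) (radius (Circle (ccenter X Y Z) (dist (ccenter X Y Z) X)))"
    using dist_ccenter[OF assms] by simp
next
  fix k assume k: "{X, Y, Z} \<subseteq> sphere (center k) (radius k)"
  then have "center k = ccenter X Y Z"
    by (intro equidistant_eq_ccenter[OF assms, of _ "radius k"]) auto
  moreover from this k have "radius k = dist (ccenter X Y Z) X" by auto
  ultimately show "k = Circle (ccenter X Y Z) (dist (ccenter X Y Z) X)" by (cases k) auto
qed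

lemma radius_pos:
  assumes "sarea X Y Z \<noteq> 0"
  shows "dist (ccenter X Y Z) X > 0"
proof -
  have "X \<noteq> Y" "X \<noteq> Z" "Y \<noteq> Z" using assms by (auto simp: sarea_def algebra_simps)
  then show ?thesis
    unfolding dist_norm ccenter_diffs(3)[OF assms] using ccenter_diffs(1)[OF assms]
    by (simp flip: complex_cnj_diff)
qed

lemma collinear_sarea: "collinear {X, Y, Z} \<longleftrightarrow> sarea X Y Z = 0"
proof -
  have "collinear {X, Y, Z} \<longleftrightarrow> collinear {Y, X, Z}" by (simp add: insert_commute)
  also have "\<dots> \<longleftrightarrow> collinear {0, Y - X, Z - X}" by (subst collinear_3[of Y]) auto
  also have "\<dots> \<longleftrightarrow> (Z - X) / (Y - X) \<in> \<real>" by (rule collinear_iff_Reals)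
  also have "\<dots> \<longleftrightarrow> Im ((Z - X) / (Y - X)) = 0" by (simp add: complex_is_Real_iff)
  also have "\<dots> \<longleftrightarrow> sarea X Y Z = 0"
  proof (cases "X = Y")
    case False
    then show ?thesis by (simp add: complex_div_cnj[of "Z - X"] sarea_def mult.commute)
  qed (simp add: sarea_def)
  finally show ?thesis .
qed

lemma wsum_dist_square:
  "wsum (\<lambda>X. of_real ((dist P X)\<^sup>2)) A B C D = defect A B C D"
proof -
  define s1 s2 s3 s4 where s: "s1 = complex_of_real (sarea B C D)" "s2 = complex_of_real (sarea C D A)"
    "s3 = complex_of_real (sarea D A B)" "s4 = complex_of_real (sarea A B C)"
  have 1: "s1 - s2 + s3 - s4 = (0::complex)"
    using wsum_1[of A B C D] by (simp add: wsum_def s)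
  have 2: "s1 * A - s2 * B + s3 * C - s4 * D = 0"
    using wsum_id[of A B C D] by (simp add: wsum_def s)
  have 3: "s1 * cnj A - s2 * cnj B + s3 * cnj C - s4 * cnj D = 0"
    using wsum_cnj[of A B C D] by (simp add: wsum_def s)
  have "s1 * ((p - A) * (p' - A')) - s2 * ((p - B) * (p' - B')) + s3 * ((p - C) * (p' - C')) - s4 * ((p - D) * (p' - D'))
     = s1 * (A * A') - s2 * (B * B') + s3 * (C * C') - s4 * (D * D') + p * p' * (s1 - s2 + s3 - s4)
       - p' * (s1 * A - s2 * B + s3 * C - s4 * D) - p * (s1 * A' - s2 * B' + s3 * C' - s4 * D')" for p p' A' B' C' D'
    by algebra
  then show ?thesis
    unfolding of_real_defect wsum_def dist_norm complex_norm_square s[symmetric] complex_cnj_diff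
    by (simp add: 1 2 3)
qed

lemma wsum_dist_square_real:
  "sarea B C D * (dist P A)\<^sup>2 - sarea C D A * (dist P B)\<^sup>2 + sarea D A B * (dist P C)\<^sup>2 - sarea A B C * (dist P D)\<^sup>2
    = defect A B C D"
  using arg_cong[OF wsum_dist_square[of P A B C D], of Re] by (simp add: wsum_def del: of_real_power)

lemma weights_sum: "sarea B C D - sarea C D A + sarea D A B - sarea A B C = 0"
  using arg_cong[OF wsum_1[of A B C D], of Re] by (simp add: wsum_def)

text \<open>
  The weighted sum of the squared distances from any point is \<open>N\<close>. Taken from the center of a circle through all
  vertices it is \<open>0\<close>; taken from the circumcenter of \<open>B\<close>, \<open>C\<close>, \<open>D\<close> it is the weighted power of \<open>A\<close>.
\<close>

lemma noncyclic4_iff: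
  "noncyclic4 A B C D \<longleftrightarrow> nondegenerate (Quad A B C D) \<and> \<not> cyclic (Quad A B C D)"
proof -
  have "nondegenerate (Quad A B C D) \<longleftrightarrow> sarea B C D \<noteq> 0 \<and> sarea C D A \<noteq> 0 \<and> sarea D A B \<noteq> 0 \<and> sarea A B C \<noteq> 0"
    by (auto simp: nondegenerate_def collinear_sarea)
  moreover have "cyclic (Quad A B C D) \<longleftrightarrow> defect A B C D = 0" if s: "sarea B C D \<noteq> 0"
  proof
    assume "cyclic (Quad A B C D)"
    then obtain c R where "{A, B, C, D} \<subseteq> sphere c R" by (auto simp: cyclic_def)
    then have "dist c A = R" "dist c B = R" "dist c C = R" "dist c D = R" by auto
    then have "defect A B C D = (sarea B C D - sarea C D A + sarea D A B - sarea A B C) * R\<^sup>2"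
      using wsum_dist_square_real[of B C D c A] by (simp add: algebra_simps)
    then show "defect A B C D = 0" by (simp add: weights_sum)
  next
    assume 0: "defect A B C D = 0"
    define c where "c = ccenter B C D"
    note d = dist_ccenter[OF s, folded c_def]
    have "sarea B C D * (dist c A)\<^sup>2 = sarea B C D * (dist c B)\<^sup>2"
      using wsum_dist_square_real[of B C D c A] weights_sum[of B C D A] unfolding 0 d by algebra
    then have "dist c A = dist c B" using s by simp
    then show "cyclic (Quad A B C D)"
      using d unfolding cyclic_def by (intro exI[of _ c] exI[of _ "dist c B"]) auto
  qed
  ultimately show ?thesis unfolding noncyclic4_def by blast
qed

section \<open>Isogonal conjugation\<close>

text \<open>
  The zero vector is perpendicular to every vector here, as \<open>t\<close> may vanish.
\<close>

definition perp :: "complex \<Rightarrow> complex \<Rightarrow> bool" where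
  "perp u v \<longleftrightarrow> (\<exists>t::real. u = \<i> * of_real t * v)"

lemma perp_minus: "perp (x - y) v \<Longrightarrow> perp (y - x) v" "perp u (x - y) \<Longrightarrow> perp u (y - x)"
  unfolding perp_def by (metis minus_diff_eq mult_minus_left mult_minus_right of_real_minus)+

lemma ccenter_rotate:
  assumes "sarea X Y Z \<noteq> 0"
  shows "ccenter Y Z X = ccenter X Y Z"
  using dist_ccenter[OF assms] assms
  by (intro equidistant_eq_ccenter[symmetric, of _ _ _ _ "dist (ccenter X Y Z) X"]) (simp_all add: sarea_rot)

text \<open>
  The square of the direction of the bisector of two unit vectors is their product.
\<close>

lemma sgn_sum_square:
  assumes "sarea X Y Z \<noteq> 0"
  defines "u \<equiv> sgn (Y - X) + sgn (Z - X)"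
  shows "u / cnj u = sgn (Y - X) * sgn (Z - X)"
proof -
  define p q where pq: "p = sgn (Y - X)" "q = sgn (Z - X)"
  have ne: "Y \<noteq> X" "Z \<noteq> X" using assms by (auto simp: sarea_def)
  have p1: "p * cnj p = 1" and q1: "q * cnj q = 1"
    using ne by (simp_all add: pq complex_norm_square[symmetric] norm_sgn)
  have "p + q \<noteq> 0"
  proof
    assume "p + q = 0"
    then have "q = - p" by (simp add: eq_neg_iff_add_eq_0 add.commute)
    have "Y - X = of_real (cmod (Y - X)) * p" "Z - X = of_real (cmod (Z - X)) * q"
      using ne by (simp_all add: pq sgn_eq)
    then have "cnj (Y - X) * (Z - X) = of_real (cmod (Y - X) * cmod (Z - X)) * (cnj p * q)"
      by (metis (no_types, lifting) complex_cnj_complex_of_real complex_cnj_mult mult.assoc mult.left_commute of_real_mult)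
    also have "cnj p * q = - 1" using p1 \<open>q = - p\<close> by (simp add: mult.commute)
    finally have "sarea X Y Z = 0" by (simp add: sarea_def)
    with assms show False by simp
  qed
  moreover have "p * q * cnj (p + q) = p + q"
    using p1 q1 by (simp add: algebra_simps)
  moreover have "cnj x \<noteq> 0" if "x \<noteq> 0" for x
    using that by simp
  ultimately have "p * q = (p + q) / cnj (p + q)"
    by (intro nonzero_eq_divide_eq[THEN iffD2])
  then show ?thesis
    unfolding u_def pq[symmetric] by (rule sym)
qed

text \<open>
  The bisector drops out: up to positive factors, reflection in it sends \<open>P - X\<close> to \<open>(Y - X) * (Z - X) * cnj (P - X)\<close>.
\<close>

lemma isogonal_line_iff:
  assumes s: "sarea X Y Z \<noteq> 0" and P: "P \<noteq> X"
  shows "S \<in> isogonal_line X Y Z P \<longleftrightarrow> Im ((S - X) * (P - X) * cnj ((Y - X) * (Z - X))) = 0"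
proof -
  define p q where pq: "p = sgn (Y - X)" "q = sgn (Z - X)"
  define m where "m = cmod (Y - X) * cmod (Z - X)"
  have ne: "Y \<noteq> X" "Z \<noteq> X" using assms by (auto simp: sarea_def)
  have p1: "p * cnj p = 1" and q1: "q * cnj q = 1"
    using ne by (simp_all add: pq complex_norm_square[symmetric] norm_sgn)
  have m: "m > 0" using ne by (simp add: m_def)
  have YZ: "(Y - X) * (Z - X) = of_real m * (p * q)"
    using ne by (simp add: pq sgn_eq m_def)
  have "S \<in> isogonal_line X Y Z P \<longleftrightarrow> (\<exists>t::real. S = X + p * q * cnj (t *\<^sub>R (P - X)))"
    unfolding isogonal_line_def line_reflection_def
    unfolding sgn_sum_square[OF s] affine_hull_2_alt
    unfolding pq[symmetric] by (auto simp: image_iff)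
  also have "\<dots> \<longleftrightarrow> (S - X) * (P - X) * cnj (p * q) \<in> \<real>"
  proof
    assume "\<exists>t::real. S = X + p * q * cnj (t *\<^sub>R (P - X))"
    then obtain t :: real where "S = X + p * q * cnj (t *\<^sub>R (P - X))" ..
    then have "(S - X) * (P - X) * cnj (p * q) = (p * cnj p) * (q * cnj q) * (of_real t * ((P - X) * cnj (P - X)))"
      by (simp add: scaleR_conv_of_real mult_ac del: complex_cnj_diff)
    then show "(S - X) * (P - X) * cnj (p * q) \<in> \<real>"
      by (simp add: p1 q1 complex_norm_square[symmetric] del: of_real_power complex_cnj_diff)
  next
    assume "(S - X) * (P - X) * cnj (p * q) \<in> \<real>"
    then obtain t where t: "(S - X) * (P - X) * cnj (p * q) = of_real t" by (auto elim: Reals_cases)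
    have "p * q * (of_real t * cnj (P - X)) = (p * cnj p) * (q * cnj q) * ((S - X) * ((P - X) * cnj (P - X)))"
      unfolding t[symmetric] by (simp add: mult_ac del: complex_cnj_diff)
    also have "\<dots> = (S - X) * of_real ((cmod (P - X))\<^sup>2)" by (simp only: p1 q1 complex_norm_square mult_1)
    finally have "S = X + p * q * cnj ((t / (cmod (P - X))\<^sup>2) *\<^sub>R (P - X))"
      using P by (simp add: scaleR_conv_of_real field_simps)
    then show "\<exists>t::real. S = X + p * q * cnj (t *\<^sub>R (P - X))" ..
  qed
  also have "\<dots> \<longleftrightarrow> Im (of_real m * ((S - X) * (P - X) * cnj (p * q))) = 0"
  proof -
    have "Im (of_real m * z) = m * Im z" for z by simp
    then show ?thesis using m by (simp only: complex_is_Real_iff) simp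
  qed
  also have "of_real m * ((S - X) * (P - X) * cnj (p * q)) = (S - X) * (P - X) * cnj ((Y - X) * (Z - X))"
    unfolding YZ by simp
  finally show ?thesis .
qed

text \<open>
  If two points lay on all three lines, the lines at \<open>X\<close> and \<open>Y\<close> would coincide with \<open>XY\<close>, and reflecting back would
  put \<open>P\<close> on the line \<open>XZ\<close>.
\<close>

lemma Iso_eqI:
  assumes s: "sarea X Y Z \<noteq> 0" "sarea X Z P \<noteq> 0" and P: "P \<noteq> X" "P \<noteq> Y" "P \<noteq> Z"
    and S: "Im ((S - X) * (P - X) * cnj ((Y - X) * (Z - X))) = 0"
      "Im ((S - Y) * (P - Y) * cnj ((Z - Y) * (X - Y))) = 0"
      "Im ((S - Z) * (P - Z) * cnj ((X - Z) * (Y - Z))) = 0"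
  shows "Iso X Y Z P = S"
proof -
  have s2: "sarea Y Z X \<noteq> 0" "sarea Z X Y \<noteq> 0" using s(1) by (simp_all add: sarea_rot)
  note l = isogonal_line_iff[OF s(1) P(1)] isogonal_line_iff[OF s2(1) P(2)] isogonal_line_iff[OF s2(2) P(3)]
  show ?thesis unfolding Iso_def l
  proof (rule the_equality)
    fix S' assume S': "Im ((S' - X) * (P - X) * cnj ((Y - X) * (Z - X))) = 0 \<and>
      Im ((S' - Y) * (P - Y) * cnj ((Z - Y) * (X - Y))) = 0 \<and>
      Im ((S' - Z) * (P - Z) * cnj ((X - Z) * (Y - Z))) = 0"
    define K where "K = (P - X) * cnj ((Y - X) * (Z - X))"
    define L where "L = (P - Y) * cnj ((Z - Y) * (X - Y))"
    have ne: "Y \<noteq> X" "Z \<noteq> X" "Y \<noteq> Z" using s by (auto simp: sarea_def algebra_simps)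
    show "S' = S"
    proof (rule ccontr)
      assume "S' \<noteq> S"
      define d where "d = S' - S"
      have d: "d \<noteq> 0" using \<open>S' \<noteq> S\<close> by (simp add: d_def)
      have KL: "K \<noteq> 0" "L \<noteq> 0" using P ne by (simp_all add: K_def L_def)
      have i: "Im ((S - X) * K) = 0" "Im ((S' - X) * K) = 0" "Im ((S - Y) * L) = 0" "Im ((S' - Y) * L) = 0"
        using S S' by (simp_all add: K_def L_def mult.assoc)
      have "Im (d * K) = Im ((S' - X) * K) - Im ((S - X) * K)" "Im (d * L) = Im ((S' - Y) * L) - Im ((S - Y) * L)"
        unfolding d_def by (simp_all add: algebra_simps)
      then have R: "d * K \<in> \<real>" "d * L \<in> \<real>" "(S - X) * K \<in> \<real>" "(S - Y) * L \<in> \<real>"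
        using i by (simp_all add: complex_is_Real_iff)
      then have "(S - X) / d \<in> \<real>" "(S - Y) / d \<in> \<real>"
        using Reals_divide[OF R(3,1)] Reals_divide[OF R(4,2)] KL by simp_all
      then have "(S - X) / d - (S - Y) / d \<in> \<real>" by (rule Reals_diff)
      then have "(Y - X) / d \<in> \<real>" by (simp add: diff_divide_distrib)
      from Reals_mult[OF this R(1)] have "Im ((Y - X) * K) = 0"
        using d by (simp add: complex_is_Real_iff)
      moreover have "(Y - X) * K = ((Y - X) * cnj (Y - X)) * (cnj (Z - X) * (P - X))"
        by (simp add: K_def mult_ac del: complex_cnj_diff)
      ultimately have "Im (of_real ((cmod (Y - X))\<^sup>2) * (cnj (Z - X) * (P - X))) = 0"
        by (simp only: complex_norm_square)
      then have "sarea X Z P = 0" using ne by (simp add: sarea_def del: of_real_power)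
      with s show False by simp
    qed
  qed (use S in simp)
qed

text \<open>
  The line from a circumcenter to a vertex \<open>A\<close> of the triangle \<open>CDA\<close> is isogonal to the perpendicular to \<open>CD\<close>
  with respect to the perpendiculars to the other two sides. The perpendiculars are the lines between circumcenters.
\<close>

lemma isogonal_center:
  assumes s: "sarea C D A \<noteq> 0"
    and "perp (P - ccenter C D A) (C - D)" "perp (Y - ccenter C D A) (D - A)" "perp (Z - ccenter C D A) (A - C)"
  shows "Im ((A - ccenter C D A) * (P - ccenter C D A) * cnj ((Y - ccenter C D A) * (Z - ccenter C D A))) = 0"
proof -
  obtain x y z :: real where t: "P - ccenter C D A = \<i> * x * (C - D)" "Y - ccenter C D A = \<i> * y * (D - A)"
    "Z - ccenter C D A = \<i> * z * (A - C)" using assms by (auto simp: perp_def)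
  define S where "S = sarea C D A"
  have "A - ccenter C D A = - (cnj (D - C) * (A - C) * (D - A) / (2 * \<i> * of_real S))"
    unfolding S_def using ccenter_diffs(5)[OF s] by (metis diff_diff_eq2 diff_add_cancel minus_diff_eq add_diff_cancel_left')
  moreover have "cnj (C - D) = - cnj (D - C)" by simp
  ultimately have "A - ccenter C D A = cnj (C - D) * (A - C) * (D - A) / (2 * \<i> * of_real S)"
    by (simp del: complex_cnj_diff)
  then have "(A - ccenter C D A) * (P - ccenter C D A) * cnj ((Y - ccenter C D A) * (Z - ccenter C D A)) =
     cnj (C - D) * (A - C) * (D - A) / (2 * \<i> * of_real S) * (\<i> * x * (C - D)) * cnj ((\<i> * y * (D - A)) * (\<i> * z * (A - C)))"
    by (simp only: t)
  also have "\<dots> = of_real (- x * y * z / (2 * S)) * (((C - D) * cnj (C - D)) * ((D - A) * cnj (D - A)) * ((A - C) * cnj (A - C)))"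
    using s by (simp add: S_def divide_simps mult_ac del: complex_cnj_diff)
  also have "\<dots> = of_real (- x * y * z / (2 * S) * ((cmod (C - D))\<^sup>2 * (cmod (D - A))\<^sup>2 * (cmod (A - C))\<^sup>2))"
    by (simp only: complex_norm_square of_real_mult)
  finally show ?thesis by (simp only: Im_complex_of_real)
qed

context noncyclic4
begin

lemma perp_centers:
  "perp (O1 - O2) (C - D)" "perp (O1 - O3) (D - B)" "perp (O1 - O4) (B - C)"
  "perp (O2 - O3) (D - A)" "perp (O2 - O4) (A - C)" "perp (O3 - O4) (A - B)"
proof -
  have p: "perp u v" if "u = \<i> * of_real n * v / (2 * of_real m)" for u v :: complex and n m :: real
    unfolding perp_def using that by (intro exI[of _ "n / (2 * m)"]) simp
  show "perp (O1 - O2) (C - D)" "perp (O2 - O3) (D - A)" "perp (O3 - O4) (A - B)"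
    by (rule p[OF center_diff]; use sarea_nonzero in simp)+
  show "perp (O1 - O4) (B - C)"
    by (rule perp_minus(1)[OF p[OF center_diff]]; use sarea_nonzero in simp)
  show "perp (O1 - O3) (D - B)" "perp (O2 - O4) (A - C)"
    by (rule perp_minus(2)[OF p[OF center_diff_opposite]]; use sarea_nonzero in simp)+
qed

lemma distinct_vertices: "A \<noteq> B" "A \<noteq> C" "A \<noteq> D" "B \<noteq> C" "B \<noteq> D" "C \<noteq> D"
  using sarea_nonzero by (auto simp: sarea_def)

lemma Iso_centers: "Iso O2 O3 O4 O1 = A"
proof -
  interpret O: noncyclic4 O1 O2 O3 O4 by (rule noncyclic4_centers)
  have o3: "O3 = ccenter B D A" using sarea_nonzero by (metis ccenter_rotate sarea_rot)
  have o4: "O4 = ccenter B C A" using sarea_nonzero by (metis ccenter_rotate sarea_rot)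
  have s: "sarea B D A \<noteq> 0" "sarea B C A \<noteq> 0" using sarea_nonzero by (metis sarea_rot)+
  note P = perp_centers
  note P' = P[THEN perp_minus(1)] P[THEN perp_minus(2)] P[THEN perp_minus(2), THEN perp_minus(1)]
  \<comment> \<open>each circumcenter is written with \<open>A\<close> last, as \<open>isogonal_center\<close> expects it\<close>
  show ?thesis
  proof (rule Iso_eqI)
    show "Im ((A - O2) * (O1 - O2) * cnj ((O3 - O2) * (O4 - O2))) = 0"
      by (rule isogonal_center) (use sarea_nonzero P P' in auto)
    show "Im ((A - O3) * (O1 - O3) * cnj ((O4 - O3) * (O2 - O3))) = 0"
      using isogonal_center[of B D A O1 O2 O4, folded o3] s P P' by (simp add: mult.commute)
    show "Im ((A - O4) * (O1 - O4) * cnj ((O2 - O4) * (O3 - O4))) = 0"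
      using isogonal_center[of B C A O1 O2 O3, folded o4] s P P' by (simp add: mult.commute)
    show "sarea O2 O4 O1 \<noteq> 0" using O.sarea_nonzero by (metis sarea_rot)
  qed (use O.sarea_nonzero O.distinct_vertices in auto)
qed

lemma triads:
  "triad (Quad A B C D) 1 = Circle O3 (dist O3 D)" "triad (Quad A B C D) 2 = Circle O4 (dist O4 A)"
  "triad (Quad A B C D) 3 = Circle O1 (dist O1 B)" "triad (Quad A B C D) 4 = Circle O2 (dist O2 C)"
  using sarea_nonzero by (simp_all add: triad_def circumcircle_eq)

lemma next_gen: "next_gen (Quad A B C D) = Quad O3 O4 O1 O2"
  unfolding next_gen_def triads by simp

lemma noncyclic4_next: "noncyclic4 O3 O4 O1 O2"
  by (rule noncyclic4.rotated[OF noncyclic4.rotated[OF noncyclic4_centers]])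

lemma slope_next: "slope O3 O4 O1 O2 = - r\<^sup>2 * a"
  and intercept_next: "intercept O3 O4 O1 O2 = - r\<^sup>2 * b"
  and defect_next: "defect O3 O4 O1 O2 = r\<^sup>2 * N"
proof -
  have "slope O3 O4 O1 O2 = slope O1 O2 O3 O4"
    by (simp only: slope_rot[of O2 O3 O4 O1] slope_rot[of O3 O4 O1 O2] minus_minus)
  then show "slope O3 O4 O1 O2 = - r\<^sup>2 * a" by (simp only: slope_centers)
  have "intercept O3 O4 O1 O2 = intercept O1 O2 O3 O4"
    by (simp only: intercept_rot[of O2 O3 O4 O1] intercept_rot[of O3 O4 O1 O2] minus_minus)
  then show "intercept O3 O4 O1 O2 = - r\<^sup>2 * b" by (simp only: intercept_centers)
  have "defect O3 O4 O1 O2 = defect O1 O2 O3 O4"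
    by (simp only: defect_rot[of O2 O3 O4 O1] defect_rot[of O3 O4 O1 O2] minus_minus)
  then show "defect O3 O4 O1 O2 = r\<^sup>2 * N" by (simp only: defect_centers)
qed

end

section \<open>All generations\<close>

lemma noncyclic4_similarity:
  assumes "noncyclic4 A B C D" "k \<noteq> 0"
  shows "noncyclic4 (c + k * A) (c + k * B) (c + k * C) (c + k * D)"
  using assms sarea_affine[of "\<lambda>z. c + k * z" c k 0] slope_intercept_similarity(2)[of c k A B C D]
  by (simp add: noncyclic4_def)

definition noncyclic_quad :: "complex quad \<Rightarrow> bool" where
  "noncyclic_quad Q \<longleftrightarrow> noncyclic4 (vA Q) (vB Q) (vC Q) (vD Q)"

lemma noncyclic_quad_map: "noncyclic_quad Q \<Longrightarrow> k \<noteq> 0 \<Longrightarrow> noncyclic_quad (map_quad (\<lambda>z. c + k * z) Q)"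
  using noncyclic4_similarity by (cases Q) (simp add: noncyclic_quad_def)

lemma noncyclic_quad_next: "noncyclic_quad Q \<Longrightarrow> noncyclic_quad (next_gen Q)"
  using noncyclic4.noncyclic4_next noncyclic4.next_gen by (cases Q) (simp add: noncyclic_quad_def)

lemma next_gen_map:
  assumes "noncyclic_quad Q" "k \<noteq> 0"
  shows "next_gen (map_quad (\<lambda>z. c + k * z) Q) = map_quad (\<lambda>z. c + k * z) (next_gen Q)"
proof (cases Q)
  case (Quad A B C D)
  then have "noncyclic4 A B C D" using assms by (simp add: noncyclic_quad_def)
  then show ?thesis
    using noncyclic4.next_gen[OF noncyclic4_similarity[OF _ assms(2)]] noncyclic4.next_gen assms(2)
    by (simp add: Quad ccenter_similarity)
qed

lemma prev_next:
  assumes "noncyclic_quad Q"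
  shows "prev_gen (next_gen Q) = Q"
proof (cases Q)
  case (Quad A B C D)
  then interpret noncyclic4 A B C D using assms by (simp add: noncyclic_quad_def)
  interpret B: noncyclic4 B C D A by (rule rotated)
  interpret C: noncyclic4 C D A B by (rule B.rotated)
  interpret D: noncyclic4 D A B C by (rule C.rotated)
  show ?thesis
    using Iso_centers B.Iso_centers C.Iso_centers D.Iso_centers by (simp add: Quad next_gen prev_gen_def)
qed

context noncyclic4
begin

abbreviation "Q \<equiv> Quad A B C D"
abbreviation "Q2 \<equiv> Quad O3 O4 O1 O2"

text \<open>
  The power of the homothety \<open>h\<close> with a possibly negative exponent. For \<open>a = 0\<close> it is the identity, since then \<open>r = 1\<close>.
\<close>

definition iterate :: "int \<Rightarrow> complex \<Rightarrow> complex" where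
  "iterate k z = w + of_real (r powi k) * (z - w)"

lemma iterate_0: "iterate 0 z = z"
  and iterate_add: "iterate (k + j) z = iterate k (iterate j z)"
  using r_nonzero by (simp_all add: iterate_def power_int_add)

lemma iterate_1: "iterate 1 z = h z" by (simp add: iterate_def)

lemma iterate_affine: "iterate k = (\<lambda>z. (w - of_real (r powi k) * w) + of_real (r powi k) * z)"
  by (auto simp: iterate_def algebra_simps)

lemma noncyclic_quad_Q: "noncyclic_quad Q" by (simp add: noncyclic_quad_def noncyclic4_axioms)

lemma next_Q2: "next_gen Q2 = map_quad (iterate 1) Q"
  using noncyclic4.next_gen[OF noncyclic4_next] by (simp add: second_centers iterate_1)

definition gen_explicit :: "int \<Rightarrow> complex quad" where
  "gen_explicit n = (if odd n then map_quad (iterate ((n - 1) div 2)) Q else map_quad (iterate ((n - 2) div 2)) Q2)"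

lemma next_gen_explicit: "next_gen (gen_explicit n) = gen_explicit (n + 1)"
proof (cases "odd n")
  case True
  then obtain k where n: "n = 2 * k + 1" by (elim oddE)
  have "next_gen (map_quad (iterate k) Q) = map_quad (iterate k) Q2"
    unfolding iterate_affine using next_gen_map[OF noncyclic_quad_Q] r_nonzero by (simp add: next_gen)
  then show ?thesis by (simp add: gen_explicit_def n)
next
  case False
  then obtain k where n': "n = 2 * k" by (metis evenE)
  define j where "j = k - 1"
  have n: "n = 2 * j + 2" by (simp add: n' j_def)
  have g: "noncyclic_quad Q2" using noncyclic_quad_next[OF noncyclic_quad_Q] by (simp add: next_gen)
  have "next_gen (map_quad (iterate j) Q2) = map_quad (iterate j) (next_gen Q2)"
    unfolding iterate_affine by (rule next_gen_map[OF g]) (use r_nonzero in simp)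
  also have "\<dots> = map_quad (iterate (j + 1)) Q" by (simp add: next_Q2 iterate_add)
  finally show ?thesis by (simp add: gen_explicit_def n add.commute)
qed

lemma noncyclic_quad_gen_explicit: "noncyclic_quad (gen_explicit n)"
proof -
  have "noncyclic_quad (map_quad (iterate k) q)" if "noncyclic_quad q" for k q
    unfolding iterate_affine by (rule noncyclic_quad_map[OF that]) (use r_nonzero in simp)
  moreover have "noncyclic_quad Q2" using noncyclic_quad_next[OF noncyclic_quad_Q] by (simp add: next_gen)
  ultimately show ?thesis using noncyclic_quad_Q by (simp add: gen_explicit_def del: quad.map)
qed

lemma prev_gen_explicit: "prev_gen (gen_explicit n) = gen_explicit (n - 1)"
  using prev_next[OF noncyclic_quad_gen_explicit[of "n - 1"]] by (simp add: next_gen_explicit)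

lemma gen_eq_explicit: "gen Q n = gen_explicit n"
proof -
  have "gen_explicit 1 = Q" by (simp add: gen_explicit_def iterate_0)
  have 1: "(next_gen ^^ m) Q = gen_explicit (1 + int m)" for m
    by (induction m) (simp_all add: \<open>gen_explicit 1 = Q\<close> next_gen_explicit add_ac)
  have 2: "(prev_gen ^^ m) Q = gen_explicit (1 - int m)" for m
    by (induction m) (simp_all add: \<open>gen_explicit 1 = Q\<close> prev_gen_explicit diff_diff_eq add_ac)
  show ?thesis by (simp add: gen_def 1 2)
qed

lemma gen_odd: "gen Q (2 * k + 1) = map_quad (iterate k) Q"
  and gen_even: "gen Q (2 * k + 2) = map_quad (iterate k) Q2"
  by (simp_all add: gen_eq_explicit gen_explicit_def)

lemma slope_mult_w: "a \<noteq> 0 \<Longrightarrow> a * w = - b"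
  by (simp add: w_def)

lemma circle_form:
  assumes "i \<in> {1..4::nat}"
  shows "cmod (a * center (triad Q i) + b) = \<bar>N\<bar> * radius (triad Q i)" "radius (triad Q i) > 0"
proof -
  interpret B: noncyclic4 B C D A by (rule rotated)
  interpret C: noncyclic4 C D A B by (rule B.rotated)
  interpret D: noncyclic4 D A B C by (rule C.rotated)
  note rots = slope_rot[of B C D A] slope_rot[of C D A B] slope_rot[of D A B C]
    intercept_rot[of B C D A] intercept_rot[of C D A B] intercept_rot[of D A B C]
    defect_rot[of B C D A] defect_rot[of C D A B] defect_rot[of D A B C]
  have m: "cmod (- (a * X) - b) = cmod (a * X + b)" for X
    using norm_minus_cancel[of "a * X + b"] by simp
  from assms have "i = 1 \<or> i = 2 \<or> i = 3 \<or> i = 4" by auto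
  then show "cmod (a * center (triad Q i) + b) = \<bar>N\<bar> * radius (triad Q i)"
    using radius_form B.radius_form C.radius_form D.radius_form
    unfolding rots by (elim disjE; simp only: triads circle.sel) (simp_all add: m)
  show "radius (triad Q i) > 0"
    using radius_pos sarea_nonzero \<open>i = 1 \<or> i = 2 \<or> i = 3 \<or> i = 4\<close> by (elim disjE; simp only: triads circle.sel)
qed

text \<open>
  Every generation has the same \<open>W\<close> and the same \<open>\<bar>N\<bar> / \<bar>a\<bar>\<close>, in a form that does not exclude \<open>a = 0\<close>.
\<close>

lemma gen_invariants:
  "\<exists>t::real. t \<noteq> 0 \<and> (case gen Q n of Quad A' B' C' D' \<Rightarrow> noncyclic4 A' B' C' D' \<and>
     slope A' B' C' D' = of_real t * a \<and> intercept A' B' C' D' = of_real t * b \<and> \<bar>defect A' B' C' D'\<bar> = \<bar>t\<bar> * \<bar>N\<bar>)"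
proof -
  have main: "\<exists>t::real. t \<noteq> 0 \<and> (case map_quad (iterate k) (Quad A' B' C' D') of Quad A' B' C' D' \<Rightarrow> noncyclic4 A' B' C' D' \<and>
     slope A' B' C' D' = of_real t * a \<and> intercept A' B' C' D' = of_real t * b \<and> \<bar>defect A' B' C' D'\<bar> = \<bar>t\<bar> * \<bar>N\<bar>)"
    if n4: "noncyclic4 A' B' C' D'" and s: "slope A' B' C' D' = of_real t * a" "intercept A' B' C' D' = of_real t * b" "\<bar>defect A' B' C' D'\<bar> = \<bar>t\<bar> * \<bar>N\<bar>" "t \<noteq> 0"
    for A' B' C' D' k t
  proof -
    define \<rho> where "\<rho> = r powi k"
    have \<rho>: "\<rho> \<noteq> 0" using r_nonzero by (simp add: \<rho>_def)
    have b: "of_real \<rho> * b - (w - of_real \<rho> * w) * a = b"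
    proof (cases "a = 0")
      case True
      then have "\<rho> = 1" using r_eq_1 by (simp add: \<rho>_def)
      then show ?thesis by simp
    next
      case False
      then show ?thesis using slope_mult_w by (simp add: algebra_simps)
    qed
    have b': "of_real \<rho> * (of_real t * b) - (w - of_real \<rho> * w) * (of_real t * a) = of_real t * b"
      using arg_cong[OF b, of "\<lambda>x. of_real t * x"] by (simp add: algebra_simps)
    show ?thesis
      unfolding iterate_affine \<rho>_def[symmetric] quad.map quad.case slope_intercept_similarity s b'
      using noncyclic4_similarity[OF n4, of "of_real \<rho>" "w - of_real \<rho> * w"] \<rho> \<open>t \<noteq> 0\<close> s(3)
      by (intro exI[of _ "\<rho> ^ 4 * t"]) (simp add: abs_mult power2_eq_square power4_eq_xxxx)
  qed
  have 1: "\<bar>r\<^sup>2 * N\<bar> = \<bar>- r\<^sup>2\<bar> * \<bar>N\<bar>" "slope O3 O4 O1 O2 = of_real (- r\<^sup>2) * a" "intercept O3 O4 O1 O2 = of_real (- r\<^sup>2) * b"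
    using slope_next intercept_next by (simp_all add: abs_mult)
  show ?thesis
  proof (cases "odd n")
    case True
    show ?thesis unfolding gen_eq_explicit gen_explicit_def using True main[OF noncyclic4_axioms, of 1] by simp
  next
    case False
    have "- r\<^sup>2 \<noteq> 0" using r_nonzero by simp
    then show ?thesis unfolding gen_eq_explicit gen_explicit_def using False main[OF noncyclic4_next 1(2,3) _, of "(n - 2) div 2"] 1(1) defect_next by simp
  qed
qed

lemma gen_circle_form:
  assumes "i \<in> {1..4::nat}"
  shows "cmod (a * center (triad (gen Q n) i) + b) = \<bar>N\<bar> * radius (triad (gen Q n) i)" "radius (triad (gen Q n) i) > 0"
proof -
  obtain A' B' C' D' where g: "gen Q n = Quad A' B' C' D'" by (cases "gen Q n")
  obtain t :: real where t: "t \<noteq> 0" "noncyclic4 A' B' C' D'"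
     "slope A' B' C' D' = of_real t * a" "intercept A' B' C' D' = of_real t * b" "\<bar>defect A' B' C' D'\<bar> = \<bar>t\<bar> * \<bar>N\<bar>"
    using gen_invariants[of n] by (auto simp: g)
  interpret n: noncyclic4 A' B' C' D' by (rule t)
  show "radius (triad (gen Q n) i) > 0" using n.circle_form[OF assms] by (simp add: g)
  have "cmod (of_real t * (a * center (triad (gen Q n) i) + b)) = \<bar>t\<bar> * \<bar>N\<bar> * radius (triad (gen Q n) i)"
    using n.circle_form(1)[OF assms] by (simp add: g t algebra_simps)
  then show "cmod (a * center (triad (gen Q n) i) + b) = \<bar>N\<bar> * radius (triad (gen Q n) i)"
    using t(1) by (simp add: norm_mult)
qed

end

section \<open>Angles at which a circle is seen\<close>

lemma inner_complex_cnj: "x \<bullet> y = Re (cnj x * y)" for x y :: complex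
  by (simp add: inner_complex_def)

lemma unit_complex_eq:
  assumes "cmod z = 1" "cmod z' = 1" "Re z' = Re z" "z' \<noteq> z"
  shows "z' = cnj z"
proof -
  have "(Im z')\<^sup>2 = (Im z)\<^sup>2"
    using assms(1-3) cmod_power2[of z] cmod_power2[of z'] by simp
  then have "Im z' = - Im z" using assms(3,4) by (auto simp: power2_eq_iff complex_eq_iff)
  then show ?thesis using assms(3) by (simp add: complex_eq_iff)
qed

text \<open>
  Tangents and chords from \<open>P\<close> are treated in coordinates with the center \<open>c\<close> as origin and the real axis through
  \<open>P = c + d * e\<close>; the points of the circle are \<open>c + R * (e * z)\<close> with \<open>\<bar>z\<bar> = 1\<close>.
\<close>

lemma polar_about:
  assumes "dist T c = R" "R > 0" "cmod e = 1"
  obtains z where "T = c + R * (e * z)" "cmod z = 1"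
proof
  have e: "e \<noteq> 0" using assms by auto
  show "T = c + R * (e * ((T - c) / (R * e)))" using assms e by simp
  show "cmod ((T - c) / (R * e)) = 1" using assms by (simp add: norm_divide norm_mult dist_norm)
qed

lemma vangle_tangents:
  assumes e: "cmod e = 1" and z: "cmod z = 1" "Re z = R / d" and R: "0 < R" "R < d"
  shows "vangle (c + R * (e * z)) (c + d * e) (c + R * (e * cnj z)) = 2 * arcsin (R / d)"
proof -
  have d: "d > 0" using R by simp
  have ee: "e * cnj e = 1" using e by (simp add: complex_norm_square[symmetric])
  have im: "(Im z)\<^sup>2 = 1 - (R / d)\<^sup>2" using z cmod_power2[of z] by (simp add: power_divide)
  define U V where "U = c + R * (e * z) - (c + d * e)" and "V = c + R * (e * cnj z) - (c + d * e)"
  have U: "U = e * (R * z - d)" and V: "V = e * (R * cnj z - d)"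
    unfolding U_def V_def by (simp_all add: algebra_simps)
  have "cnj U * V = (e * cnj e) * (R * cnj z - d)\<^sup>2" unfolding U V by (simp add: power2_eq_square mult_ac)
  then have "U \<bullet> V = Re ((R * cnj z - d)\<^sup>2)" by (simp add: inner_complex_cnj ee)
  also have "\<dots> = (R * Re z - d)\<^sup>2 - R\<^sup>2 * (Im z)\<^sup>2" by (simp add: power2_eq_square)
  also have "\<dots> = (d\<^sup>2 - R\<^sup>2) * (1 - 2 * (R / d)\<^sup>2)" unfolding im z(2) using d by (simp add: field_simps power2_eq_square)
  finally have uv: "U \<bullet> V = (d\<^sup>2 - R\<^sup>2) * (1 - 2 * (R / d)\<^sup>2)" .
  have "(cmod (R * z - d))\<^sup>2 = (R * Re z - d)\<^sup>2 + R\<^sup>2 * (Im z)\<^sup>2" by (simp add: cmod_power2 power_mult_distrib)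
  also have "\<dots> = d\<^sup>2 - R\<^sup>2" unfolding im z(2) using d by (simp add: field_simps power2_eq_square)
  finally have nU: "(cmod U)\<^sup>2 = d\<^sup>2 - R\<^sup>2" unfolding U norm_mult e by simp
  have "cmod (R * cnj z - d) = cmod (cnj (R * z - d))" by simp
  also have "\<dots> = cmod (R * z - d)" by (rule complex_mod_cnj)
  finally have "cmod V = cmod U" unfolding U V norm_mult by simp
  then have n: "cmod U * cmod V = d\<^sup>2 - R\<^sup>2" using nU by (simp add: power2_eq_square)
  have pos: "d\<^sup>2 - R\<^sup>2 > 0" using R by (simp add: power_strict_mono)
  have q: "0 < R / d" "R / d < 1" using R d by simp_all
  have "vangle (c + R * (e * z)) (c + d * e) (c + R * (e * cnj z)) = arccos (1 - 2 * (R / d)\<^sup>2)"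
    unfolding vangle_def U_def[symmetric] V_def[symmetric] uv n using pos by simp
  also have "1 - 2 * (R / d)\<^sup>2 = cos (2 * arcsin (R / d))"
    using q by (simp add: cos_double_sin)
  also have "arccos (cos (2 * arcsin (R / d))) = 2 * arcsin (R / d)"
    using q arcsin_nonneg[of "R / d"] arcsin_bounded[of "R / d"] by (intro arccos_cos) auto
  finally show ?thesis .
qed

lemma real_circle_point:
  assumes "0 \<le> c" "c < 1"
  defines "z \<equiv> Complex c (sqrt (1 - c\<^sup>2))"
  shows "cmod z = 1" "Re z = c" "cnj z \<noteq> z"
proof -
  have c2: "c\<^sup>2 < 1" using assms(1,2) by (simp add: power_less_one_iff abs_square_less_1)
  then show "cmod z = 1" by (simp add: z_def complex_norm)
  show "Re z = c" by (simp add: z_def)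
  show "cnj z \<noteq> z" using c2 by (simp add: z_def complex_eq_iff)
qed

lemma tangent_angle_eq:
  assumes "outside P k" "radius k > 0"
  shows "tangent_angle P k = 2 * arcsin (radius k / dist P (center k))"
proof -
  define c R d where d: "c = center k" "R = radius k" "d = dist P (center k)"
  define e where "e = (P - c) / d"
  have R: "0 < R" "R < d" using assms by (simp_all add: d outside_def)
  have e: "cmod e = 1" using R by (auto simp: e_def d dist_norm norm_divide)
  have P: "P = c + d * e" using R by (simp add: e_def)
  have ee: "e * cnj e = 1" using e by (simp add: complex_norm_square[symmetric])
  have orth: "orthogonal (c + R * (e * z) - P) (c + R * (e * z) - c) \<longleftrightarrow> Re z = R / d" if "cmod z = 1" for z
  proof -
    have "cnj (c + R * (e * z) - P) * (c + R * (e * z) - c) = (e * cnj e) * (R * (R * (z * cnj z) - d * z))"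
      unfolding P by (simp add: algebra_simps)
    also have "\<dots> = R * (R - d * z)" unfolding ee using that by (simp add: complex_norm_square[symmetric])
    finally have "orthogonal (c + R * (e * z) - P) (c + R * (e * z) - c) \<longleftrightarrow> Re (R * (R - d * z)) = 0"
      unfolding orthogonal_def inner_complex_cnj by (simp only:)
    also have "\<dots> \<longleftrightarrow> Re z = R / d" using R by (auto simp: field_simps)
    finally show ?thesis .
  qed
  show ?thesis
    unfolding tangent_angle_def d(3)[symmetric] unfolding d(1,2)[symmetric]
  proof (rule the_equality)
    define z where "z = Complex (R / d) (sqrt (1 - (R / d)\<^sup>2))"
    have z: "cmod z = 1" "Re z = R / d" "cnj z \<noteq> z" unfolding z_def using R by (intro real_circle_point; simp)+
    have ne: "c + R * (e * z) \<noteq> c + R * (e * cnj z)" using z(3) e R by auto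
    have s: "c + R * (e * z) \<in> sphere c R" "c + R * (e * cnj z) \<in> sphere c R"
      using z e R by (simp_all add: dist_norm norm_mult)
    show "\<exists>T T'. T \<noteq> T' \<and> {T, T'} \<subseteq> sphere c R \<and> orthogonal (T - P) (T - c) \<and>
        orthogonal (T' - P) (T' - c) \<and> 2 * arcsin (R / d) = vangle T P T'"
      using ne s orth[of z] orth[of "cnj z"] z vangle_tangents[OF e z(1,2) R, of c]
      by (intro exI[of _ "c + R * (e * z)"] exI[of _ "c + R * (e * cnj z)"]) (simp add: P[symmetric])
  next
    fix a assume "\<exists>T T'. T \<noteq> T' \<and> {T, T'} \<subseteq> sphere c R \<and> orthogonal (T - P) (T - c) \<and>
        orthogonal (T' - P) (T' - c) \<and> a = vangle T P T'"
    then obtain T T' where T: "T \<noteq> T'" "dist T c = R" "dist T' c = R" "orthogonal (T - P) (T - c)"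
        "orthogonal (T' - P) (T' - c)" and a: "a = vangle T P T'" by (auto simp: dist_commute)
    obtain z where z: "T = c + R * (e * z)" "cmod z = 1" using polar_about[OF T(2) R(1) e] .
    obtain z' where z': "T' = c + R * (e * z')" "cmod z' = 1" using polar_about[OF T(3) R(1) e] .
    have "Re z = R / d" "Re z' = R / d" using T orth z z' by simp_all
    moreover have "z' \<noteq> z" using T(1) z z' by auto
    ultimately have "z' = cnj z" using unit_complex_eq[OF z(2) z'(2)] by simp
    then show "a = 2 * arcsin (R / d)"
      unfolding a z z' using vangle_tangents[OF e z(2) \<open>Re z = R / d\<close> R, of c] by (simp add: P[symmetric])
  qed
qed

lemma chord_angle_eq:
  assumes "inside P k"
  shows "chord_angle P k = 2 * arccos (dist P (center k) / radius k)"
proof -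
  define c R d where d: "c = center k" "R = radius k" "d = dist P (center k)"
  \<comment> \<open>any direction serves if \<open>P\<close> is the center\<close>
  define e where "e = (if P = c then 1 else (P - c) / d)"
  have R: "d < R" "0 \<le> d" using assms by (simp_all add: d inside_def)
  then have R0: "R > 0" by simp
  have e: "cmod e = 1" using R by (simp add: e_def d dist_norm norm_divide)
  have P: "P = c + d * e" using R by (simp add: e_def) (simp add: d)
  have ee: "e * cnj e = 1" using e by (simp add: complex_norm_square[symmetric])
  have va: "vangle (c + R * (e * z)) c (c + R * (e * z')) = arccos (Re (cnj z * z'))"
    if "cmod z = 1" "cmod z' = 1" for z z'
  proof -
    have "cnj (R * (e * z)) * (R * (e * z')) = (e * cnj e) * of_real (R * R) * (cnj z * z')" by (simp add: mult_ac)
    then have "(R * (e * z)) \<bullet> (R * (e * z')) = Re (of_real (R * R) * (cnj z * z'))"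
      by (simp only: inner_complex_cnj ee mult_1)
    also have "\<dots> = R * R * Re (cnj z * z')"
      by (simp only: Re_complex_of_real Im_complex_of_real times_complex.sel mult_zero_left diff_zero)
    finally have "(R * (e * z)) \<bullet> (R * (e * z')) = R * R * Re (cnj z * z')" .
    then show ?thesis unfolding vangle_def using that e R0 by (simp add: norm_mult)
  qed
  have q: "0 \<le> d / R" "d / R \<le> 1" "d / R < 1" using R R0 by simp_all
  have sq: "(d / R)\<^sup>2 \<le> 1" using q by (simp add: power_le_one)
  have dbl: "arccos (2 * (d / R)\<^sup>2 - 1) = 2 * arccos (d / R)"
  proof -
    have "2 * (d / R)\<^sup>2 - 1 = cos (2 * arccos (d / R))" using q by (simp add: cos_double_cos)
    moreover have "2 * arccos (d / R) \<le> pi" using arccos_le_pi2[of "d / R"] q by simp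
    moreover have "0 \<le> arccos (d / R)" using q by (intro arccos_lbound) auto
    ultimately show ?thesis by (simp add: arccos_cos)
  qed
  have va2: "vangle (c + R * (e * z)) c (c + R * (e * cnj z)) = 2 * arccos (d / R)"
    if z: "cmod z = 1" "Re z = d / R" for z
  proof -
    have "Re (cnj z * cnj z) = (Re z)\<^sup>2 - (Im z)\<^sup>2" by (simp add: power2_eq_square)
    also have "\<dots> = 2 * (d / R)\<^sup>2 - 1" using z cmod_power2[of z] by simp
    finally show ?thesis using va[of z "cnj z"] z dbl by simp
  qed
  show ?thesis
    unfolding chord_angle_def d(3)[symmetric] unfolding d(1,2)[symmetric]
  proof (rule the_equality)
    define z where "z = Complex (d / R) (sqrt (1 - (d / R)\<^sup>2))"
    have z: "cmod z = 1" "Re z = d / R" "cnj z \<noteq> z" unfolding z_def using q by (intro real_circle_point; simp)+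
    have ne: "c + R * (e * z) \<noteq> c + R * (e * cnj z)" using z(3) e R0 by auto
    have s: "c + R * (e * z) \<in> sphere c R" "c + R * (e * cnj z) \<in> sphere c R"
      using z e R0 by (simp_all add: dist_norm norm_mult)
    have zz: "z + cnj z = of_real (2 * (d / R))" using complex_add_cnj[of z] z by simp
    have "(1 - 1/2) *\<^sub>R (c + R * (e * z)) + (1/2) *\<^sub>R (c + R * (e * cnj z)) = c + (R / 2) * e * (z + cnj z)"
      by (simp add: scaleR_conv_of_real field_simps)
    also have "\<dots> = P" unfolding P zz using R0 by simp
    finally have seg: "P \<in> closed_segment (c + R * (e * z)) (c + R * (e * cnj z))"
      unfolding closed_segment_def by (auto intro!: exI[of _ "1/2"])
    have "cnj (c + R * (e * cnj z) - (c + R * (e * z))) * (P - c) = (e * cnj e) * of_real (R * d) * (z - cnj z)"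
      unfolding P by (simp add: algebra_simps)
    then have "orthogonal (c + R * (e * cnj z) - (c + R * (e * z))) (P - c)"
      unfolding orthogonal_def inner_complex_cnj ee by simp
    then show "\<exists>T T'. T \<noteq> T' \<and> {T, T'} \<subseteq> sphere c R \<and> P \<in> closed_segment T T' \<and>
        orthogonal (T' - T) (P - c) \<and> 2 * arccos (d / R) = vangle T c T'"
      using ne s seg va2[OF z(1,2)]
      by (intro exI[of _ "c + R * (e * z)"] exI[of _ "c + R * (e * cnj z)"]) simp
  next
    fix a assume "\<exists>T T'. T \<noteq> T' \<and> {T, T'} \<subseteq> sphere c R \<and> P \<in> closed_segment T T' \<and>
        orthogonal (T' - T) (P - c) \<and> a = vangle T c T'"
    then obtain T T' where T: "T \<noteq> T'" "dist T c = R" "dist T' c = R" "P \<in> closed_segment T T'"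
        "orthogonal (T' - T) (P - c)" and a: "a = vangle T c T'" by (auto simp: dist_commute)
    obtain z where z: "T = c + R * (e * z)" "cmod z = 1" using polar_about[OF T(2) R0 e] .
    obtain z' where z': "T' = c + R * (e * z')" "cmod z' = 1" using polar_about[OF T(3) R0 e] .
    have zne: "z' \<noteq> z" using T(1) z z' by auto
    obtain u where u: "0 \<le> u" "u \<le> 1" "P = (1 - u) *\<^sub>R T + u *\<^sub>R T'"
      using T(4) by (auto simp: closed_segment_def)
    have "d * e = (R * ((1 - u) * z + u * z')) * e"
      using u(3) unfolding P z z' by (simp add: scaleR_conv_of_real algebra_simps)
    then have du: "of_real d = R * ((1 - u) * z + u * z')" using e by auto
    \<comment> \<open>for \<open>P = c\<close> the chord is any diameter, and orthogonality gives no information\<close>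
    show "a = 2 * arccos (d / R)"
    proof (cases "d = 0")
      case True
      then have 0: "(1 - u) * z + u * z' = 0" using du R0 by simp
      then have "(1 - u) * z = - (u * z')" by (simp add: eq_neg_iff_add_eq_0)
      then have "cmod ((1 - u) * z) = cmod (u * z')" by simp
      then have "\<bar>1 - u\<bar> * cmod z = \<bar>u\<bar> * cmod z'" by (simp only: norm_mult norm_of_real)
      then have u2: "u = 1 / 2" using z z' u(1,2) by simp
      have "z + z' = 2 * (of_real (1 - 1 / 2) * z + of_real (1 / 2) * z')" by (simp add: field_simps)
      also have "\<dots> = 0" using 0 unfolding u2 by simp
      finally have "z' = - z" by (simp add: eq_neg_iff_add_eq_0 add.commute)
      then have "Re (cnj z * z') = - (cmod z)\<^sup>2"
        unfolding cmod_power2 by (simp add: power2_eq_square)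
      then show ?thesis unfolding a z z' using va[OF z(2) z'(2)] z True by simp
    next
      case False
      have "cnj (T' - T) * (P - c) = (e * cnj e) * of_real (R * d) * (cnj z' - cnj z)"
        unfolding P z z' by (simp add: algebra_simps)
      then have "R * d * (Re z' - Re z) = 0"
        using T(5) unfolding orthogonal_def inner_complex_cnj ee by simp
      then have re: "Re z' = Re z" using False R0 by simp
      then have zc: "z' = cnj z" using unit_complex_eq[OF z(2) z'(2)] zne by simp
      have "d = R * ((1 - u) * Re z + u * Re z')" using arg_cong[OF du, of Re] by simp
      then have "Re z = d / R" using re R0 by (simp add: field_simps)
      then show ?thesis unfolding a z z' zc using va2[OF z(2)] by simp
    qed
  qed
qed

lemma filterlim_dist_at_top: "filterlim (\<lambda>P::complex. dist P V) at_top at_infinity"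
proof (rule filterlim_at_top_mono)
  show "filterlim (\<lambda>P::complex. - norm V + norm P) at_top at_infinity"
    by (rule filterlim_tendsto_add_at_top[OF tendsto_const filterlim_norm_at_top])
  show "eventually (\<lambda>P. - norm V + norm P \<le> dist P V) at_infinity"
    by (rule always_eventually) (simp add: dist_norm norm_triangle_ineq2)
qed

lemma dist_ratio_tendsto:
  fixes V V' :: complex
  shows "((\<lambda>P. dist P V / dist P V') \<longlongrightarrow> 1) at_infinity"
proof -
  have ev: "eventually (\<lambda>P::complex. dist P V' > 0) at_infinity"
    by (rule filterlim_dist_at_top[unfolded filterlim_at_top_dense, rule_format])
  have "((\<lambda>P. dist V V' / dist P V') \<longlongrightarrow> 0) at_infinity"
    by (rule tendsto_divide_0[OF tendsto_const filterlim_at_top_imp_at_infinity[OF filterlim_dist_at_top]])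
  then have "((\<lambda>P. dist P V / dist P V' - 1) \<longlongrightarrow> 0) at_infinity"
  proof (rule Lim_null_comparison[rotated])
    show "eventually (\<lambda>P. norm (dist P V / dist P V' - 1) \<le> dist V V' / dist P V') at_infinity"
      using ev
    proof eventually_elim
      case (elim P)
      have "dist P V / dist P V' - 1 = (dist P V - dist P V') / dist P V'" using elim by (simp add: field_simps)
      moreover have "\<bar>dist P V - dist P V'\<bar> \<le> dist V V'"
        using dist_triangle[of P V V'] dist_triangle[of P V' V] by (simp add: dist_commute)
      ultimately show ?case using elim by (simp add: divide_right_mono)
    qed
  qed
  then show ?thesis by (simp add: LIM_zero_iff)
qed

lemma tangent_angle_ratio_tendsto:
  assumes "radius k > 0" "radius k' > 0"
  shows "((\<lambda>P. tangent_angle P k / tangent_angle P k') \<longlongrightarrow> radius k / radius k') at_infinity"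
proof -
  have "((\<lambda>x::real. arcsin x / x) \<longlongrightarrow> 1) (at 0)"
    using DERIV_arcsin[of 0] by (simp add: DERIV_def)
  moreover have "filterlim (\<lambda>P. radius k / dist P (center k)) (at 0) at_infinity" if "radius k > 0" for k
  proof (rule filterlim_atI)
    show "((\<lambda>P. radius k / dist P (center k)) \<longlongrightarrow> 0) at_infinity"
      by (rule tendsto_divide_0[OF tendsto_const filterlim_at_top_imp_at_infinity[OF filterlim_dist_at_top]])
    have "eventually (\<lambda>P::complex. dist P (center k) > 0) at_infinity"
      by (rule filterlim_dist_at_top[unfolded filterlim_at_top_dense, rule_format])
    then show "eventually (\<lambda>P. radius k / dist P (center k) \<noteq> 0) at_infinity"
      by eventually_elim (use that in auto)
  qed
  ultimately have l: "((\<lambda>P. arcsin (radius k / dist P (center k)) / (radius k / dist P (center k))) \<longlongrightarrow> 1) at_infinity"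
    if "radius k > 0" for k
    using that filterlim_compose by blast
  have "((\<lambda>P. (arcsin (radius k / dist P (center k)) / (radius k / dist P (center k))) /
         (arcsin (radius k' / dist P (center k')) / (radius k' / dist P (center k'))) *
         (radius k / radius k') * (dist P (center k') / dist P (center k))) \<longlongrightarrow> 1 / 1 * (radius k / radius k') * 1) at_infinity"
    by (intro tendsto_intros l dist_ratio_tendsto assms) simp
  moreover have "eventually (\<lambda>P. (arcsin (radius k / dist P (center k)) / (radius k / dist P (center k))) /
         (arcsin (radius k' / dist P (center k')) / (radius k' / dist P (center k'))) *
         (radius k / radius k') * (dist P (center k') / dist P (center k)) = tangent_angle P k / tangent_angle P k') at_infinity"
  proof -
    have o: "eventually (\<lambda>P. outside P k) at_infinity" for k
      using filterlim_dist_at_top[of "center k"] by (simp add: filterlim_at_top_dense outside_def)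
    show ?thesis using o[of k] o[of k']
    proof eventually_elim
      case (elim P)
      then have "dist P (center k) > 0" "dist P (center k') > 0" using assms by (auto simp: outside_def)
      then show ?case using tangent_angle_eq[OF elim(1) assms(1)] tangent_angle_eq[OF elim(2) assms(2)] assms
        by (simp add: field_simps)
    qed
  qed
  ultimately show ?thesis by (simp add: filterlim_cong)
qed

section \<open>Circles of similitude, isodynamic property, inversion, isoptic property\<close>

lemma dist_eq_three_points:
  assumes s: "sarea X Y Z \<noteq> 0" and d: "dist p X = dist q X" "dist p Y = dist q Y" "dist p Z = dist q Z"
  shows "p = q"
proof -
  define e U V where euv: "e = p - q" "U = Y - X" "V = Z - X"
  have "(p - v) * cnj (p - v) = (q - v) * cnj (q - v)" if "dist p v = dist q v" for v
    using that by (simp only: complex_norm_square[symmetric] dist_norm)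
  from this[OF d(1)] this[OF d(2)] this[OF d(3)]
  have "e * (cnj U * V - U * cnj V) = 0"
    unfolding euv complex_cnj_diff by algebra
  then show ?thesis using ccenter_diffs(1,2)[OF s] by (simp add: euv)
qed

context noncyclic4
begin

lemma slope_ne_defect: "(cmod a)\<^sup>2 \<noteq> N\<^sup>2"
  using r_slope defect_nonzero by auto

lemma dist_w:
  assumes "a \<noteq> 0"
  shows "cmod (a * z + b) = cmod a * dist w z"
proof -
  have "a * z + b = a * (z - w)" using slope_mult_w[OF assms] by (simp add: algebra_simps)
  then show ?thesis by (simp add: norm_mult dist_norm norm_minus_commute)
qed

lemma dist_w_center:
  assumes "a \<noteq> 0" "i \<in> {1..4::nat}"
  shows "dist w (center (triad (gen Q n) i)) = \<bar>N\<bar> / cmod a * radius (triad (gen Q n) i)"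
  using gen_circle_form(1)[OF assms(2), of n] dist_w[OF assms(1), of "center (triad (gen Q n) i)"] assms(1)
  by (simp add: field_simps)

lemma radius_slope_0:
  assumes "a = 0" "i \<in> {1..4::nat}"
  shows "radius (triad (gen Q n) i) = cmod b / \<bar>N\<bar>"
  using gen_circle_form(1)[OF assms(2), of n] assms(1) defect_nonzero by (simp add: field_simps)

lemma gen_1: "gen Q 1 = Q" by (simp add: gen_def)

lemma gen_2: "gen Q 2 = Q2" by (simp add: gen_def next_gen)

lemma center_triads:
  "center (triad Q 1) = O3" "center (triad Q 2) = O4" "center (triad Q 3) = O1" "center (triad Q 4) = O2"
  unfolding triads by simp_all

text \<open>
  The new weights are \<open>r\<close> times the old ones and the new defect is \<open>r\<^sup>2 * N\<close>; one factor \<open>r\<close> is cancelled.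
\<close>

lemma dist_centers_sum:
  "sarea B C D * (dist p O1)\<^sup>2 - sarea C D A * (dist p O2)\<^sup>2 + sarea D A B * (dist p O3)\<^sup>2 - sarea A B C * (dist p O4)\<^sup>2
    = r * N"
proof -
  have "r * (sarea B C D * (dist p O1)\<^sup>2 - sarea C D A * (dist p O2)\<^sup>2 + sarea D A B * (dist p O3)\<^sup>2 - sarea A B C * (dist p O4)\<^sup>2)
    = r * (r * N)"
    using wsum_dist_square_real[of O2 O3 O4 p O1] by (simp add: sarea_centers defect_centers algebra_simps power2_eq_square)
  then show ?thesis using r_nonzero by simp
qed

text \<open>
  Summation with the weights turns the hypothesis into \<open>c * T = r * N\<close>, where \<open>T\<close> is the weighted sum of the squared radii.
  As \<open>r * N \<noteq> 0\<close>, the factor \<open>c\<close> is determined. If \<open>a = 0\<close>, the radii are equal and \<open>T = 0\<close>, which is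
  impossible; otherwise \<open>w\<close> has the property with the same \<open>c\<close>, hence the same distances from the centers.
\<close>

lemma equal_visibility_imp:
  assumes "\<And>i. i \<in> {1..4::nat} \<Longrightarrow> (dist p (center (triad Q i)))\<^sup>2 = c * (radius (triad Q i))\<^sup>2"
  shows "a \<noteq> 0" "p = w"
proof -
  define R where "R i = radius (triad Q i)" for i
  define T where "T = sarea B C D * (R 3)\<^sup>2 - sarea C D A * (R 4)\<^sup>2 + sarea D A B * (R 1)\<^sup>2 - sarea A B C * (R 2)\<^sup>2"
  have T: "c' * T = r * N" if "\<And>i. i \<in> {1..4::nat} \<Longrightarrow> (dist p' (center (triad Q i)))\<^sup>2 = c' * (R i)\<^sup>2" for p' c'
    using that[of 1] that[of 2] that[of 3] that[of 4] dist_centers_sum[of p'] unfolding T_def center_triads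
    by (simp add: algebra_simps)
  have cT: "c * T = r * N" using T[of p c] assms unfolding R_def by blast
  show a: "a \<noteq> 0"
  proof
    assume "a = 0"
    then have R: "R i = cmod b / \<bar>N\<bar>" if "i \<in> {1..4}" for i
      using radius_slope_0[OF _ that, of 1] unfolding gen_1 R_def by simp
    have "T = (sarea B C D - sarea C D A + sarea D A B - sarea A B C) * (cmod b / \<bar>N\<bar>)\<^sup>2"
      unfolding T_def by (simp add: R algebra_simps)
    then have "T = 0" by (simp add: weights_sum)
    then show False using cT r_nonzero defect_nonzero by simp
  qed
  have w: "(dist w (center (triad Q i)))\<^sup>2 = (\<bar>N\<bar> / cmod a)\<^sup>2 * (R i)\<^sup>2" if "i \<in> {1..4}" for i
    using dist_w_center[OF a that, of 1] unfolding gen_1 R_def by (simp add: power_mult_distrib power_divide)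
  have "(\<bar>N\<bar> / cmod a)\<^sup>2 * T = r * N" using T w by blast
  with cT have "(c - (\<bar>N\<bar> / cmod a)\<^sup>2) * T = 0" "T \<noteq> 0" using r_nonzero defect_nonzero by (auto simp: algebra_simps)
  then have c: "c = (\<bar>N\<bar> / cmod a)\<^sup>2" by simp
  have d: "dist p (center (triad Q i)) = dist w (center (triad Q i))" if "i \<in> {1..4}" for i
    by (rule power2_eq_imp_eq) (use assms[OF that] w[OF that] c in \<open>simp_all add: R_def\<close>)
  interpret O: noncyclic4 O1 O2 O3 O4 by (rule noncyclic4_centers)
  show "p = w"
    using d[of 1] d[of 3] d[of 4] O.sarea_nonzero(1) d[of 2] unfolding center_triads
    by (intro dist_eq_three_points[of O2 O3 O4]) simp_all
qed

text \<open>
  A finite \<open>w\<close> would be equidistant from all four centers, which are not concyclic.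
\<close>

lemma equal_radii_imp:
  assumes "\<And>i j. i \<in> {1..4::nat} \<Longrightarrow> j \<in> {1..4} \<Longrightarrow> radius (triad Q i) = radius (triad Q j)"
  shows "a = 0"
proof (rule ccontr)
  assume a: "a \<noteq> 0"
  have d: "dist w (center (triad Q i)) = \<bar>N\<bar> / cmod a * radius (triad Q 1)" if "i \<in> {1..4}" for i
    using dist_w_center[OF a that, of 1] assms[OF that, of 1] unfolding gen_1 by simp
  have "r * N = (sarea B C D - sarea C D A + sarea D A B - sarea A B C) * (\<bar>N\<bar> / cmod a * radius (triad Q 1))\<^sup>2"
    using dist_centers_sum[of w] d[of 1] d[of 2] d[of 3] d[of 4] unfolding center_triads
    by (simp add: algebra_simps)
  then show False using weights_sum[of B C D A] r_nonzero defect_nonzero by simp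
qed

lemma CS_generations: "common_point_CS_generations Q W"
proof -
  have "W \<in> CS (triad (gen Q k) i) (triad (gen Q l) j)" if "i \<in> {1..4}" "j \<in> {1..4}" for i j k l
  proof (cases "a = 0")
    case True
    then show ?thesis using radius_slope_0[OF True] that by (simp add: W_def CS_def)
  next
    case False
    then show ?thesis using dist_w_center[OF False] that defect_nonzero by (simp add: W_def CS_def)
  qed
  then show ?thesis by (simp add: common_point_CS_generations_def)
qed

lemma CS_iff: "common_point_CS Q P \<longleftrightarrow> P = W"
proof
  assume "P = W"
  then show "common_point_CS Q P"
    using CS_generations gen_1 unfolding common_point_CS_def common_point_CS_generations_def by metis
next
  assume cs: "common_point_CS Q P"
  have R: "radius (triad Q i) > 0" if "i \<in> {1..4}" for i using circle_form(2)[OF that] .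
  show "P = W"
  proof (cases P)
    case None
    have "radius (triad Q i) = radius (triad Q j)" if "i \<in> {1..4}" "j \<in> {1..4}" for i j
    proof (cases "i = j")
      case False
      then have "None \<in> CS (triad Q i) (triad Q j)"
        using cs that unfolding common_point_CS_def None by blast
      then show ?thesis by (auto simp: CS_def split: if_splits)
    qed simp
    then have "a = 0" by (rule equal_radii_imp)
    then show ?thesis by (simp add: W_def None)
  next
    case (Some p)
    have q: "dist p (center (triad Q i)) / dist p (center (triad Q j)) = radius (triad Q i) / radius (triad Q j)"
      if "i \<in> {1..4}" "j \<in> {1..4}" "i \<noteq> j" for i j
    proof -
      have "Some p \<in> CS (triad Q i) (triad Q j)"
        using cs that unfolding common_point_CS_def Some by blast
      then show ?thesis by (auto simp: CS_def split: if_splits)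
    qed
    define c where "c = dist p (center (triad Q 1)) / radius (triad Q 1)"
    have "dist p (center (triad Q i)) = c * radius (triad Q i)" if i: "i \<in> {1..4}" for i
    proof (cases "i = 1")
      case True
      then show ?thesis using R[of 1] by (simp add: c_def)
    next
      case False
      have "dist p (center (triad Q 1)) \<noteq> 0"
        using q[OF i, of 1] False R[OF i] R[of 1] by auto
      then show ?thesis using q[OF i, of 1] False R[OF i] R[of 1] by (simp add: c_def field_simps)
    qed
    then have "(dist p (center (triad Q i)))\<^sup>2 = c\<^sup>2 * (radius (triad Q i))\<^sup>2" if "i \<in> {1..4}" for i
      using that by (simp add: power_mult_distrib)
    from equal_visibility_imp[OF this] show ?thesis by (simp add: W_def Some)
  qed
qed

lemma CS_generations_iff: "common_point_CS_generations Q P \<longleftrightarrow> P = W"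
proof
  assume "common_point_CS_generations Q P"
  then have "common_point_CS Q P"
    using gen_1 unfolding common_point_CS_def common_point_CS_generations_def by metis
  then show "P = W" by (simp add: CS_iff)
qed (use CS_generations in simp)

lemma circumcircles:
  "circumcircle B C D = Circle O1 (dist O1 B)" "circumcircle C D A = Circle O2 (dist O2 C)"
  "circumcircle D A B = Circle O3 (dist O3 D)" "circumcircle A B C = Circle O4 (dist O4 A)"
  using sarea_nonzero by (simp_all add: circumcircle_eq)

lemma radius_vandermonde_all:
  "2 * cmod (a * A + b) * dist O1 B = vandermonde" "2 * cmod (a * B + b) * dist O2 C = vandermonde"
  "2 * cmod (a * C + b) * dist O3 D = vandermonde" "2 * cmod (a * D + b) * dist O4 A = vandermonde"
proof -
  interpret B: noncyclic4 B C D A by (rule rotated)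
  interpret C: noncyclic4 C D A B by (rule B.rotated)
  interpret D: noncyclic4 D A B C by (rule C.rotated)
  note rots = slope_rot[of B C D A] slope_rot[of C D A B] slope_rot[of D A B C]
    intercept_rot[of B C D A] intercept_rot[of C D A B] intercept_rot[of D A B C]
  have m: "cmod (- (a * X) - b) = cmod (a * X + b)" for X
    using norm_minus_cancel[of "a * X + b"] by simp
  have v: "B.vandermonde = vandermonde" "C.vandermonde = vandermonde" "D.vandermonde = vandermonde"
    unfolding vandermonde_def B.vandermonde_def C.vandermonde_def D.vandermonde_def by (simp_all add: norm_minus_commute mult_ac)
  show "2 * cmod (a * A + b) * dist O1 B = vandermonde" "2 * cmod (a * B + b) * dist O2 C = vandermonde"
    "2 * cmod (a * C + b) * dist O3 D = vandermonde" "2 * cmod (a * D + b) * dist O4 A = vandermonde"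
    using radius_vandermonde B.radius_vandermonde C.radius_vandermonde D.radius_vandermonde unfolding rots v by (simp_all add: m)
qed

lemma vandermonde_pos: "vandermonde > 0"
  using distinct_vertices by (simp add: vandermonde_def)

lemma radii_pos: "dist O1 B > 0" "dist O2 C > 0" "dist O3 D > 0" "dist O4 A > 0"
  using sarea_nonzero radius_pos by auto

lemma radii_equal_iff: "(\<forall>i\<in>{1..4::nat}. \<forall>j\<in>{1..4::nat}. radius (triad Q i) = radius (triad Q j)) \<longleftrightarrow> a = 0"
proof
  assume "\<forall>i\<in>{1..4::nat}. \<forall>j\<in>{1..4::nat}. radius (triad Q i) = radius (triad Q j)"
  then show "a = 0" by (intro equal_radii_imp) blast
next
  assume a: "a = 0"
  show "\<forall>i\<in>{1..4::nat}. \<forall>j\<in>{1..4::nat}. radius (triad Q i) = radius (triad Q j)"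
    using radius_slope_0[OF a, of _ 1] unfolding gen_1 by simp
qed

text \<open>
  For a finite point the property reads \<open>dist p X = k * \<bar>a * X + b\<bar>\<close> at all vertices. Summing the squares with
  the weights gives \<open>(k * \<bar>a\<bar>)\<^sup>2 * N = N\<close>, or \<open>N = 0\<close> if \<open>a = 0\<close>; so \<open>p\<close> has the distances of \<open>w\<close>.
  At infinity all distances have quotient \<open>1\<close> in the limit, and the property reads that the radii are equal.
\<close>

lemma isodynamic_iff: "isodynamic Q P \<longleftrightarrow> P = W"
proof (cases P)
  case None
  have "((\<lambda>P. dist P V / dist P V') \<longlongrightarrow> l) at_infinity \<longleftrightarrow> l = 1" for V V' :: complex and l
    using tendsto_unique[OF trivial_limit_at_infinity _ dist_ratio_tendsto] dist_ratio_tendsto by blast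
  then have "isodynamic Q P \<longleftrightarrow> (\<forall>(V, k)\<in>vertex_circles Q. \<forall>(V', k')\<in>vertex_circles Q. radius k' / radius k = 1)"
    by (simp add: isodynamic_def None)
  also have "\<dots> \<longleftrightarrow> dist O1 B = dist O2 C \<and> dist O1 B = dist O3 D \<and> dist O1 B = dist O4 A"
    using radii_pos unfolding vertex_circles_def by (auto simp: circumcircles)
  also have "\<dots> \<longleftrightarrow> (\<forall>i\<in>{1,2,3,4::nat}. \<forall>j\<in>{1,2,3,4::nat}. radius (triad Q i) = radius (triad Q j))"
    unfolding ball_simps triads circle.sel by auto
  also have "{1,2,3,4::nat} = {1..4}" by auto
  finally show ?thesis unfolding radii_equal_iff by (simp add: None W_def)
next
  case (Some p)
  have v: "1 / dist O1 B = 2 / vandermonde * cmod (a * A + b)" "1 / dist O2 C = 2 / vandermonde * cmod (a * B + b)"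
    "1 / dist O3 D = 2 / vandermonde * cmod (a * C + b)" "1 / dist O4 A = 2 / vandermonde * cmod (a * D + b)"
    using radius_vandermonde_all radii_pos vandermonde_pos by (simp_all add: field_simps)
  have "isodynamic Q P \<longleftrightarrow> (\<exists>c>0. dist p A = c * (1 / dist O1 B) \<and> dist p B = c * (1 / dist O2 C) \<and> dist p C = c * (1 / dist O3 D) \<and> dist p D = c * (1 / dist O4 A))"
    unfolding isodynamic_def Some vertex_circles_def by (simp add: circumcircles)
  also have "\<dots> \<longleftrightarrow> (\<exists>k>0. \<forall>X\<in>{A,B,C,D}. dist p X = k * cmod (a * X + b))"
  proof
    assume "\<exists>c>0. dist p A = c * (1 / dist O1 B) \<and> dist p B = c * (1 / dist O2 C) \<and> dist p C = c * (1 / dist O3 D) \<and> dist p D = c * (1 / dist O4 A)"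
    then obtain c where "c > 0" "dist p A = c * (1 / dist O1 B)" "dist p B = c * (1 / dist O2 C)" "dist p C = c * (1 / dist O3 D)" "dist p D = c * (1 / dist O4 A)" by blast
    then show "\<exists>k>0. \<forall>X\<in>{A,B,C,D}. dist p X = k * cmod (a * X + b)"
      unfolding v using vandermonde_pos by (intro exI[of _ "c * (2 / vandermonde)"]) auto
  next
    assume "\<exists>k>0. \<forall>X\<in>{A,B,C,D}. dist p X = k * cmod (a * X + b)"
    then obtain k where "k > 0" "\<forall>X\<in>{A,B,C,D}. dist p X = k * cmod (a * X + b)" by blast
    then show "\<exists>c>0. dist p A = c * (1 / dist O1 B) \<and> dist p B = c * (1 / dist O2 C) \<and> dist p C = c * (1 / dist O3 D) \<and> dist p D = c * (1 / dist O4 A)"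
      unfolding v using vandermonde_pos by (intro exI[of _ "k * (vandermonde / 2)"]) auto
  qed
  also have "\<dots> \<longleftrightarrow> a \<noteq> 0 \<and> p = w"
  proof
    assume "\<exists>k>0. \<forall>X\<in>{A,B,C,D}. dist p X = k * cmod (a * X + b)"
    then obtain k where k: "k > 0" "\<And>X. X \<in> {A,B,C,D} \<Longrightarrow> dist p X = k * cmod (a * X + b)" by blast
    have a: "a \<noteq> 0"
    proof
      assume "a = 0"
      then have "N = (sarea B C D - sarea C D A + sarea D A B - sarea A B C) * (k * cmod b)\<^sup>2"
        using wsum_dist_square_real[of B C D p A] k(2) by (simp add: algebra_simps)
      then show False using defect_nonzero by (simp add: weights_sum)
    qed
    have d: "dist p X = (k * cmod a) * dist w X" if "X \<in> {A,B,C,D}" for X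
      using k(2)[OF that] dist_w[OF a, of X] by simp
    have "(k * cmod a)\<^sup>2 * N = N"
      using wsum_dist_square_real[of B C D p A] d unfolding wsum_dist_square_real[of B C D w A, symmetric]
      by (simp add: algebra_simps power_mult_distrib)
    then have "k * cmod a = 1" using defect_nonzero k(1) a by (simp add: power2_eq_1_iff) (smt (verit) mult_nonneg_nonneg norm_ge_zero)
    then have "p = w" using d sarea_nonzero by (intro dist_eq_three_points[of B C D]) simp_all
    with a show "a \<noteq> 0 \<and> p = w" by simp
  next
    assume "a \<noteq> 0 \<and> p = w"
    then show "\<exists>k>0. \<forall>X\<in>{A,B,C,D}. dist p X = k * cmod (a * X + b)"
      using dist_w by (intro exI[of _ "1 / cmod a"]) auto
  qed
  finally show ?thesis by (auto simp: W_def Some)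
qed

text \<open>
  The center, \<open>X\<close> and \<open>w\<close> are collinear because \<open>h\<close> is a homothety with center \<open>w\<close>, and the radius is known up to sign from
  the distance of the center to \<open>w\<close>. The relation between \<open>r\<close>, \<open>a\<close> and \<open>N\<close> does the rest. With \<open>r = 1\<close> the point \<open>X\<close>
  is the center itself, and its inverse is the point at infinity.
\<close>

lemma Inv_eq_W:
  assumes c: "center k = h X" and R: "cmod (a * center k + b) = \<bar>N\<bar> * radius k" "radius k > 0"
  shows "Inv k (Some X) = W"
proof (cases "a = 0")
  case True
  then show ?thesis using r_eq_1 c by (simp add: Inv_def W_def)
next
  case False
  then have r1: "r \<noteq> 1" using r_eq_1 by simp
  define u where "u = X - w"
  have o: "center k - w = r * u" "X - center k = (1 - r) * u" by (simp_all add: c u_def algebra_simps)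
  have Ru: "cmod a * \<bar>r\<bar> * cmod u = \<bar>N\<bar> * radius k"
    using R(1) dist_w[OF False, of "center k"] o(1) by (simp add: dist_norm norm_minus_commute[of w] norm_mult)
  then have u: "u \<noteq> 0" using R(2) defect_nonzero by auto
  have "(cmod a)\<^sup>2 * r\<^sup>2 * (cmod u)\<^sup>2 = N\<^sup>2 * (radius k)\<^sup>2"
    using arg_cong[OF Ru, of "\<lambda>x. x\<^sup>2"] by (simp add: power_mult_distrib)
  moreover have ra: "r * (cmod a)\<^sup>2 = N\<^sup>2 * (r - 1)" using r_slope by (simp add: algebra_simps)
  ultimately have "N\<^sup>2 * (radius k)\<^sup>2 = N\<^sup>2 * (r * (r - 1) * (cmod u)\<^sup>2)"
    by algebra
  then have R2: "(radius k)\<^sup>2 = r * (r - 1) * (cmod u)\<^sup>2" using defect_nonzero by simp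
  have d: "(dist X (center k))\<^sup>2 = (1 - r)\<^sup>2 * (cmod u)\<^sup>2"
  proof -
    have "cmod (1 - complex_of_real r) = \<bar>1 - r\<bar>" by (metis norm_of_real of_real_1 of_real_diff)
    then show ?thesis unfolding dist_norm o(2) norm_mult power_mult_distrib by simp
  qed
  have "(radius k)\<^sup>2 / (dist X (center k))\<^sup>2 = - (r / (1 - r))"
  proof -
    define s where "s = 1 - r"
    have "s \<noteq> 0" "r - 1 = - s" using r1 by (simp_all add: s_def)
    then show ?thesis unfolding R2 d s_def[symmetric] using u by (simp add: power2_eq_square)
  qed
  then have "((radius k)\<^sup>2 / (dist X (center k))\<^sup>2) *\<^sub>R (X - center k) = - (r / (1 - r)) *\<^sub>R (of_real (1 - r) * u)"
    unfolding o(2) by simp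
  also have "\<dots> = of_real (- (r / (1 - r)) * (1 - r)) * u"
    by (simp only: scaleR_conv_of_real of_real_mult mult.assoc)
  also have "- (r / (1 - r)) * (1 - r) = - r" using r1 by simp
  finally have "((radius k)\<^sup>2 / (dist X (center k))\<^sup>2) *\<^sub>R (X - center k) = - (r * u)" by simp
  then have "center k + ((radius k)\<^sup>2 / (dist X (center k))\<^sup>2) *\<^sub>R (X - center k) = w"
    using o(1) by (simp add: algebra_simps)
  moreover have "X \<noteq> center k" using o(2) u r1 by auto
  ultimately show ?thesis using False by (simp add: Inv_def W_def)
qed

lemma centers_Q2:
  "center (triad Q2 1) = h A" "center (triad Q2 2) = h B" "center (triad Q2 3) = h C" "center (triad Q2 4) = h D"
  using next_Q2 by (simp_all add: next_gen_def iterate_1)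

lemma inverse_of_vertices_iff: "inverse_of_vertices Q P \<longleftrightarrow> P = W"
proof -
  have "Inv (triad (gen Q 2) i) (Some X) = W" if "center (triad Q2 i) = h X" "i \<in> {1..4}" for i X
    using that gen_circle_form[OF that(2), of 2] by (intro Inv_eq_W) (simp_all only: gen_2)
  then have "Inv (triad (gen Q 2) 1) (Some A) = W" "Inv (triad (gen Q 2) 2) (Some B) = W"
    "Inv (triad (gen Q 2) 3) (Some C) = W" "Inv (triad (gen Q 2) 4) (Some D) = W"
    using centers_Q2 by simp_all
  then show ?thesis unfolding inverse_of_vertices_def by auto
qed

text \<open>
  The isogonal conjugates are the vertices of the preceding generation, so this is the property of
  \<open>inverse_of_vertices_iff\<close> one generation earlier.
\<close>

lemma inverse_of_isogonal_conjugates_iff: "inverse_of_isogonal_conjugates Q P \<longleftrightarrow> P = W"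
proof -
  have "prev_gen Q = map_quad (iterate (- 1)) Q2"
    using gen_even[of "- 1"] by (simp add: gen_def)
  then have I: "Iso D A B C = iterate (-1) O3" "Iso A B C D = iterate (-1) O4" "Iso B C D A = iterate (-1) O1" "Iso C D A B = iterate (-1) O2"
    by (simp_all add: prev_gen_def)
  have h: "h (iterate (-1) X) = X" for X
    using iterate_add[of 1 "-1" X] by (simp add: iterate_0 iterate_1)
  have "Inv (triad Q i) (Some (iterate (-1) (center (triad Q i)))) = W" if "i \<in> {1..4}" for i
    using circle_form[OF that] by (intro Inv_eq_W) (simp_all only: h)
  from this[of 1] this[of 2] this[of 3] this[of 4] show ?thesis
    unfolding inverse_of_isogonal_conjugates_def quad.case I circumcircles triads by auto
qed

text \<open>
  Both angles are injective functions of the quotient of distance and radius, so a finite isoptic point satisfies the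
  hypothesis of \<open>equal_visibility_imp\<close>. In the other direction the common quotient \<open>\<bar>N\<bar> / \<bar>a\<bar>\<close> is not \<open>1\<close>, so \<open>w\<close> is
  outside all circles or inside all.
\<close>

lemma isoptic_iff: "isoptic Q P \<longleftrightarrow> P = W"
proof (cases P)
  case None
  have "((\<lambda>P. tangent_angle P (triad Q i) / tangent_angle P (triad Q j)) \<longlongrightarrow> 1) at_infinity \<longleftrightarrow>
      radius (triad Q i) = radius (triad Q j)" if "i \<in> {1..4}" "j \<in> {1..4}" for i j
  proof -
    have l: "((\<lambda>P. tangent_angle P (triad Q i) / tangent_angle P (triad Q j)) \<longlongrightarrow> radius (triad Q i) / radius (triad Q j)) at_infinity"
      by (intro tangent_angle_ratio_tendsto circle_form that)
    have "radius (triad Q j) > 0" by (intro circle_form that)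
    then have q: "radius (triad Q i) / radius (triad Q j) = 1 \<longleftrightarrow> radius (triad Q i) = radius (triad Q j)" by auto
    show ?thesis
    proof
      assume "((\<lambda>P. tangent_angle P (triad Q i) / tangent_angle P (triad Q j)) \<longlongrightarrow> 1) at_infinity"
      from tendsto_unique[OF trivial_limit_at_infinity this l] q
      show "radius (triad Q i) = radius (triad Q j)" by simp
    next
      assume "radius (triad Q i) = radius (triad Q j)"
      with q have "radius (triad Q i) / radius (triad Q j) = 1" by simp
      with l show "((\<lambda>P. tangent_angle P (triad Q i) / tangent_angle P (triad Q j)) \<longlongrightarrow> 1) at_infinity"
        by (simp only:)
    qed
  qed
  then have "isoptic Q P \<longleftrightarrow> (\<forall>i\<in>{1..4::nat}. \<forall>j\<in>{1..4::nat}. radius (triad Q i) = radius (triad Q j))"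
    by (simp add: isoptic_def None)
  then show ?thesis unfolding radii_equal_iff by (simp add: None W_def)
next
  case (Some p)
  have R: "radius (triad Q i) > 0" if "i \<in> {1..4}" for i using circle_form(2)[OF that] .
  show ?thesis
  proof
    assume "isoptic Q P"
    then consider (out) \<alpha> where "\<forall>i\<in>{1..4}. outside p (triad Q i)" "\<forall>i\<in>{1..4}. tangent_angle p (triad Q i) = \<alpha>"
      | (ins) \<alpha> where "\<forall>i\<in>{1..4}. inside p (triad Q i)" "\<forall>i\<in>{1..4}. chord_angle p (triad Q i) = \<alpha>"
      unfolding isoptic_def Some by auto
    then have "\<exists>c. \<forall>i\<in>{1..4}. (dist p (center (triad Q i)))\<^sup>2 = c * (radius (triad Q i))\<^sup>2"
    proof cases
      case out
      have "(dist p (center (triad Q i)))\<^sup>2 = (1 / sin (\<alpha> / 2))\<^sup>2 * (radius (triad Q i))\<^sup>2" if i: "i \<in> {1..4}" for i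
      proof -
        define x where "x = radius (triad Q i) / dist p (center (triad Q i))"
        have o: "outside p (triad Q i)" using out i by blast
        then have d: "dist p (center (triad Q i)) > radius (triad Q i)" by (simp add: outside_def)
        then have dp: "dist p (center (triad Q i)) > 0" using R[OF i] by linarith
        have x: "0 < x" "x < 1" using R[OF i] d dp by (simp_all only: x_def divide_pos_pos divide_less_eq_1_pos)
        have "\<alpha> = 2 * arcsin x" using tangent_angle_eq[OF o R[OF i]] out i by (simp add: x_def)
        then have "sin (\<alpha> / 2) = x" using x by simp
        then show ?thesis using R[OF i] dp by (simp add: x_def power_divide)
      qed
      then show ?thesis by blast
    next
      case ins
      have "(dist p (center (triad Q i)))\<^sup>2 = (cos (\<alpha> / 2))\<^sup>2 * (radius (triad Q i))\<^sup>2" if i: "i \<in> {1..4}" for i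
      proof -
        define x where "x = dist p (center (triad Q i)) / radius (triad Q i)"
        have o: "inside p (triad Q i)" using ins i by blast
        then have d: "dist p (center (triad Q i)) < radius (triad Q i)" by (simp add: inside_def)
        then have x: "0 \<le> x" "x < 1" using R[OF i] by (simp_all add: x_def)
        have "\<alpha> = 2 * arccos x" using chord_angle_eq[OF o] ins i by (simp add: x_def)
        then have "cos (\<alpha> / 2) = x" using x by simp
        then show ?thesis using R[OF i] by (simp add: x_def power_divide)
      qed
      then show ?thesis by blast
    qed
    then obtain c where "\<And>i. i \<in> {1..4} \<Longrightarrow> (dist p (center (triad Q i)))\<^sup>2 = c * (radius (triad Q i))\<^sup>2" by blast
    from equal_visibility_imp[OF this] show "P = W" by (simp add: W_def Some)
  next
    assume "P = W"
    then have a: "a \<noteq> 0" and p: "p = w" by (auto simp: Some W_def split: if_splits)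
    define l where "l = \<bar>N\<bar> / cmod a"
    have l: "l > 0" "l \<noteq> 1"
      using a defect_nonzero slope_ne_defect by (auto simp: l_def)
    have d: "dist p (center (triad Q i)) = l * radius (triad Q i)" if "i \<in> {1..4}" for i
      using dist_w_center[OF a that, of 1] unfolding gen_1 p l_def .
    show "isoptic Q P"
    proof (cases "l > 1")
      case True
      have o: "outside p (triad Q i)" if "i \<in> {1..4}" for i
        using d[OF that] R[OF that] True by (simp add: outside_def)
      have "tangent_angle p (triad Q i) = 2 * arcsin (1 / l)" if i: "i \<in> {1..4}" for i
        using tangent_angle_eq[OF o[OF i] R[OF i]] d[OF i] R[OF i] by simp
      then show ?thesis using o by (auto simp: isoptic_def Some)
    next
      case False
      then have "l < 1" using l by simp
      have o: "inside p (triad Q i)" if "i \<in> {1..4}" for i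
        using d[OF that] R[OF that] \<open>l < 1\<close> by (simp add: inside_def)
      have "chord_angle p (triad Q i) = 2 * arccos l" if i: "i \<in> {1..4}" for i
        using chord_angle_eq[OF o[OF i]] d[OF i] R[OF i] by simp
      then show ?thesis using o by (auto simp: isoptic_def Some)
    qed
  qed
qed

end

section \<open>The generalization of the circumcenter\<close>

text \<open>
  Angles modulo \<open>pi\<close> are arguments up to a real factor.
\<close>

lemma cong_pi_Arg_iff:
  assumes "x \<noteq> 0" "y \<noteq> 0" "z \<noteq> 0"
  shows "cong_pi (Arg x) (Arg y + Arg z) \<longleftrightarrow> x / (y * z) \<in> \<real>"
proof -
  have p: "u = of_real (cmod u) * cis (Arg u)" for u
    using rcis_cmod_Arg[of u] by (simp add: rcis_def)
  define m where "m = cmod x / (cmod y * cmod z)"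
  have m: "m > 0" using assms by (simp add: m_def)
  have "x / (y * z) = (of_real (cmod x) * cis (Arg x)) / ((of_real (cmod y) * cis (Arg y)) * (of_real (cmod z) * cis (Arg z)))"
    using p[of x] p[of y] p[of z] by simp
  also have "\<dots> = of_real m * (cis (Arg x) / (cis (Arg y) * cis (Arg z)))"
    by (simp add: m_def)
  also have "\<dots> = of_real m * cis (Arg x - (Arg y + Arg z))"
    by (simp add: cis_divide cis_mult)
  finally have "x / (y * z) \<in> \<real> \<longleftrightarrow> sin (Arg x - (Arg y + Arg z)) = 0"
    using m by (simp add: complex_is_Real_iff)
  also have "\<dots> \<longleftrightarrow> cong_pi (Arg x) (Arg y + Arg z)"
    unfolding sin_zero_iff_int2 cong_pi_def by (simp add: diff_eq_eq add.commute)
  finally show ?thesis by simp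
qed

text \<open>
  Dividing by \<open>t1\<close> gives real weights with vanishing moments; the cross product with \<open>C - D\<close> eliminates the weights
  of \<open>C\<close> and \<open>D\<close>.
\<close>

lemma real_weights_proportional:
  assumes t: "t1 + t2 + t3 + t4 = 0" "t1 * A + t2 * B + t3 * C + t4 * D = 0"
    and real: "t2 / t1 \<in> \<real>" "t3 / t2 \<in> \<real>" "t4 / t3 \<in> \<real>"
    and nz: "t1 \<noteq> 0" "t2 \<noteq> 0" "t3 \<noteq> 0"
  shows "t1 * sarea C D A + t2 * sarea B C D = 0"
proof -
  obtain x where x: "t2 / t1 = of_real x" using real(1) by (auto elim: Reals_cases)
  have "t3 / t2 * (t2 / t1) \<in> \<real>" using real by (intro Reals_mult)
  then have "t3 / t1 \<in> \<real>" using nz by simp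
  moreover then have "t4 / t3 * (t3 / t1) \<in> \<real>" using real by (intro Reals_mult)
  then have "t4 / t1 \<in> \<real>" using nz by simp
  ultimately obtain y z where yz: "t3 / t1 = of_real y" "t4 / t1 = of_real z" by (auto elim!: Reals_cases)
  have tt: "t2 = of_real x * t1" "t3 = of_real y * t1" "t4 = of_real z * t1"
    using x yz nz by (simp_all add: field_simps)
  have "t1 * (1 + of_real x + of_real y + of_real z) = 0" "t1 * (A + of_real x * B + of_real y * C + of_real z * D) = 0"
    using t unfolding tt by (simp_all add: algebra_simps)
  then have e: "1 + of_real x + of_real y + of_real z = (0::complex)" "A + of_real x * B + of_real y * C + of_real z * D = 0"
    using nz by simp_all
  have "1 + x + y + z = 0" using arg_cong[OF e(1), of Re] by simp
  moreover have "Re A + x * Re B + y * Re C + z * Re D = 0" "Im A + x * Im B + y * Im C + z * Im D = 0"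
    using arg_cong[OF e(2), of Re] arg_cong[OF e(2), of Im] by simp_all
  ultimately have "sarea C D A + x * sarea B C D = 0"
    unfolding sarea_def by simp algebra
  then have "of_real (sarea C D A + x * sarea B C D) * t1 = 0" by simp
  then show ?thesis unfolding tt by (simp add: algebra_simps)
qed

text \<open>
  The divided difference of third order annihilates polynomials of degree at most two.
\<close>

lemma partial_fractions:
  fixes A B C D :: complex
  assumes "A \<noteq> B" "A \<noteq> C" "A \<noteq> D" "B \<noteq> C" "B \<noteq> D" "C \<noteq> D"
  shows "(u * A + v) / ((A - B) * (A - C) * (A - D)) + (u * B + v) / ((B - C) * (B - D) * (B - A)) +
      (u * C + v) / ((C - D) * (C - A) * (C - B)) + (u * D + v) / ((D - A) * (D - B) * (D - C)) = 0"
    and "(u * A + v) / ((A - B) * (A - C) * (A - D)) * A + (u * B + v) / ((B - C) * (B - D) * (B - A)) * B +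
      (u * C + v) / ((C - D) * (C - A) * (C - B)) * C + (u * D + v) / ((D - A) * (D - B) * (D - C)) * D = 0"
proof -
  define p where "p = (A - B) * (A - C) * (A - D) * (B - C) * (B - D) * (C - D)"
  have p: "p \<noteq> 0" using assms by (simp add: p_def)
  have q: "x / ((A - B) * (A - C) * (A - D)) = x * ((B - C) * (B - D) * (C - D)) / p"
    "x / ((B - C) * (B - D) * (B - A)) = - x * ((A - C) * (A - D) * (C - D)) / p"
    "x / ((C - D) * (C - A) * (C - B)) = x * ((A - B) * (A - D) * (B - D)) / p"
    "x / ((D - A) * (D - B) * (D - C)) = - x * ((A - B) * (A - C) * (B - C)) / p" for x
    by (rule frac_eq_eq[THEN iffD2]; (rule p | use assms in simp; fail | unfold p_def, algebra))+
  show "(u * A + v) / ((A - B) * (A - C) * (A - D)) + (u * B + v) / ((B - C) * (B - D) * (B - A)) +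
      (u * C + v) / ((C - D) * (C - A) * (C - B)) + (u * D + v) / ((D - A) * (D - B) * (D - C)) = 0"
    unfolding q add_divide_distrib[symmetric] by (simp add: p) algebra
  show "(u * A + v) / ((A - B) * (A - C) * (A - D)) * A + (u * B + v) / ((B - C) * (B - D) * (B - A)) * B +
      (u * C + v) / ((C - D) * (C - A) * (C - B)) * C + (u * D + v) / ((D - A) * (D - B) * (D - C)) * D = 0"
    unfolding q times_divide_eq_left add_divide_distrib[symmetric] by (simp add: p) algebra
qed

context noncyclic4
begin

lemma weight_products:
  "a * A + b = of_real (sarea B C D) * ((A - B) * (A - C) * (A - D))"
  "a * B + b = - of_real (sarea C D A) * ((B - C) * (B - D) * (B - A))"
  "a * C + b = of_real (sarea D A B) * ((C - D) * (C - A) * (C - B))"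
  "a * D + b = - of_real (sarea A B C) * ((D - A) * (D - B) * (D - C))"
proof -
  interpret B: noncyclic4 B C D A by (rule rotated)
  interpret C: noncyclic4 C D A B by (rule B.rotated)
  interpret D: noncyclic4 D A B C by (rule C.rotated)
  note rots = slope_rot[of B C D A] slope_rot[of C D A B] slope_rot[of D A B C]
    intercept_rot[of B C D A] intercept_rot[of C D A B] intercept_rot[of D A B C]
  show "a * A + b = of_real (sarea B C D) * ((A - B) * (A - C) * (A - D))" using weight_product by simp
  have "- (a * B + b) = of_real (sarea C D A) * ((B - C) * (B - D) * (B - A))"
    using B.weight_product unfolding rots by simp
  then show "a * B + b = - of_real (sarea C D A) * ((B - C) * (B - D) * (B - A))"
    by (metis minus_minus mult_minus_left)
  show "a * C + b = of_real (sarea D A B) * ((C - D) * (C - A) * (C - B))"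
    using C.weight_product unfolding rots by simp
  have "- (a * D + b) = of_real (sarea A B C) * ((D - A) * (D - B) * (D - C))"
    using D.weight_product unfolding rots by simp
  then show "a * D + b = - of_real (sarea A B C) * ((D - A) * (D - B) * (D - C))"
    by (metis minus_minus mult_minus_left)
qed

lemma linear_form_nonzero: "a * A + b \<noteq> 0" "a * B + b \<noteq> 0" "a * C + b \<noteq> 0" "a * D + b \<noteq> 0"
  unfolding weight_products using sarea_nonzero distinct_vertices by simp_all

text \<open>
  The angle conditions for a finite point \<open>p\<close> (\<open>u = 1\<close>, \<open>v = - p\<close>) and for the point at infinity (\<open>u = 0\<close>, \<open>v = 1\<close>)
  at once. The four quotients are, up to sign, those of the numbers \<open>l X / \<Prod> (X - Y)\<close>. These have vanishing moments, and if
  their quotients are real, they are proportional to the weights, which makes \<open>l\<close> proportional to the form \<open>a * z + b\<close>.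
\<close>

lemma real_ratios_iff:
  fixes u v :: complex
  defines "l \<equiv> \<lambda>X. u * X + v"
  assumes nz: "l A \<noteq> 0" "l B \<noteq> 0" "l C \<noteq> 0" "l D \<noteq> 0"
  shows "(l B / l A) / ((B - C) / (A - C) * ((B - D) / (A - D))) \<in> \<real> \<and>
      (l C / l B) / ((C - D) / (B - D) * ((C - A) / (B - A))) \<in> \<real> \<and>
      (l D / l C) / ((D - A) / (C - A) * ((D - B) / (C - B))) \<in> \<real> \<and>
      (l A / l D) / ((A - B) / (D - B) * ((A - C) / (D - C))) \<in> \<real> \<longleftrightarrow> u * b = v * a"
proof -
  note d = distinct_vertices
  define t1 t2 t3 t4 where t: "t1 = l A / ((A - B) * (A - C) * (A - D))" "t2 = l B / ((B - C) * (B - D) * (B - A))"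
    "t3 = l C / ((C - D) * (C - A) * (C - B))" "t4 = l D / ((D - A) * (D - B) * (D - C))"
  have tnz: "t1 \<noteq> 0" "t2 \<noteq> 0" "t3 \<noteq> 0" "t4 \<noteq> 0" using nz d by (simp_all add: t)
  have key: "(y / x) / (P / P' * (q / q')) = - ((y / (P * q * (Y - X))) / (x / (P' * q' * (X - Y))))"
    if "X \<noteq> Y" for x y P P' q q' X Y :: complex
  proof -
    have 1: "y / (P * q * (Y - X)) = - (y / (P * q * (X - Y)))"
      by (metis minus_diff_eq minus_divide_right mult_minus_right)
    show ?thesis unfolding 1 using that by (simp add: divide_simps)
  qed
  have "(l B / l A) / ((B - C) / (A - C) * ((B - D) / (A - D))) = - (t2 / t1)"
    using key[of A B "l B" "l A" "B - C" "A - C" "B - D" "A - D"] d by (simp add: t mult_ac)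
  moreover have "(l C / l B) / ((C - D) / (B - D) * ((C - A) / (B - A))) = - (t3 / t2)"
    using key[of B C "l C" "l B" "C - D" "B - D" "C - A" "B - A"] d by (simp add: t mult_ac)
  moreover have "(l D / l C) / ((D - A) / (C - A) * ((D - B) / (C - B))) = - (t4 / t3)"
    using key[of C D "l D" "l C" "D - A" "C - A" "D - B" "C - B"] d by (simp add: t mult_ac)
  moreover have "(l A / l D) / ((A - B) / (D - B) * ((A - C) / (D - C))) = - (t1 / t4)"
    using key[of D A "l A" "l D" "A - B" "D - B" "A - C" "D - C"] d by (simp add: t mult_ac)
  moreover have m: "- x \<in> \<real> \<longleftrightarrow> x \<in> \<real>" for x :: complex by (simp add: complex_is_Real_iff)
  moreover have "t2 / t1 \<in> \<real> \<and> t3 / t2 \<in> \<real> \<and> t4 / t3 \<in> \<real> \<and> t1 / t4 \<in> \<real> \<longleftrightarrow> u * b = v * a"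
  proof
    assume R: "t2 / t1 \<in> \<real> \<and> t3 / t2 \<in> \<real> \<and> t4 / t3 \<in> \<real> \<and> t1 / t4 \<in> \<real>"
    have "t1 + t2 + t3 + t4 = 0" "t1 * A + t2 * B + t3 * C + t4 * D = 0"
      unfolding t l_def using partial_fractions[OF d, of u v] by simp_all
    then have "t1 * of_real (sarea C D A) + t2 * of_real (sarea B C D) = 0"
      using real_weights_proportional R tnz by blast
    moreover have "of_real (sarea C D A) * l B = - t2 * (a * B + b)" "of_real (sarea B C D) * l A = t1 * (a * A + b)"
      unfolding weight_products t using d by simp_all
    ultimately have "l A * (a * B + b) * (t1 * t2) = l B * (a * A + b) * (t1 * t2)"
      by algebra
    then have "l A * (a * B + b) = l B * (a * A + b)" using tnz by simp
    then have "(A - B) * (u * b) = (A - B) * (v * a)" unfolding l_def by algebra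
    then show "u * b = v * a" using d by simp
  next
    assume ub: "u * b = v * a"
    obtain \<mu> where \<mu>: "l X = \<mu> * (a * X + b)" for X
    proof (cases "a = 0")
      case True
      then have "b \<noteq> 0" "u = 0" using linear_form_nonzero ub by auto
      then show thesis using that[of "v / b"] True by (simp add: l_def)
    next
      case False
      then have "v = u / a * b" using ub by (simp add: field_simps)
      then show thesis using that[of "u / a"] False by (simp add: l_def field_simps)
    qed
    have \<mu>0: "\<mu> \<noteq> 0" using nz \<mu>[of A] by auto
    have "t1 = \<mu> * of_real (sarea B C D)" "t2 = \<mu> * of_real (- sarea C D A)"
      "t3 = \<mu> * of_real (sarea D A B)" "t4 = \<mu> * of_real (- sarea A B C)"
      unfolding t \<mu> weight_products using d by simp_all
    then show "t2 / t1 \<in> \<real> \<and> t3 / t2 \<in> \<real> \<and> t4 / t3 \<in> \<real> \<and> t1 / t4 \<in> \<real>"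
      using \<mu>0 by (simp del: of_real_minus add: Reals_divide)
  qed
  ultimately show ?thesis by simp
qed

lemma generalized_circumcenter_iff: "generalized_circumcenter Q P \<longleftrightarrow> P = W"
proof (cases P)
  case None
  have "generalized_circumcenter Q P \<longleftrightarrow> 0 * b = 1 * a"
    unfolding generalized_circumcenter_def None subtended_def dangle_def quad.case option.case
    using real_ratios_iff[of 0 1] cong_pi_Arg_iff[of 1] distinct_vertices by simp
  then show ?thesis by (auto simp: None W_def)
next
  case (Some p)
  show ?thesis
  proof (cases "p \<in> {A, B, C, D}")
    case True
    then have "\<not> generalized_circumcenter Q P"
      unfolding generalized_circumcenter_def Some by auto
    moreover have "P \<noteq> W"
    proof
      assume "P = W"
      then have "a \<noteq> 0" "p = w" by (auto simp: Some W_def split: if_splits)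
      then have "a * p + b = 0" using slope_mult_w by simp
      then show False using True linear_form_nonzero by auto
    qed
    ultimately show ?thesis by simp
  next
    case False
    then have ne: "A \<noteq> p" "B \<noteq> p" "C \<noteq> p" "D \<noteq> p" by auto
    have "generalized_circumcenter Q P \<longleftrightarrow> 1 * b = - p * a"
      using False unfolding generalized_circumcenter_def Some subtended_def dangle_def quad.case option.case
      using real_ratios_iff[of 1 "- p"] distinct_vertices ne by (simp add: cong_pi_Arg_iff)
    also have "\<dots> \<longleftrightarrow> a * p + b = 0" by (auto simp: eq_neg_iff_add_eq_0 mult.commute add.commute)
    also have "\<dots> \<longleftrightarrow> a \<noteq> 0 \<and> p = w"
    proof
      assume p: "a * p + b = 0"
      then have a: "a \<noteq> 0" using linear_form_nonzero(1) by auto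
      have "a * (p - w) = 0" using p slope_mult_w[OF a] by (simp add: algebra_simps)
      then show "a \<noteq> 0 \<and> p = w" using a by simp
    qed (use slope_mult_w in simp)
    finally show ?thesis by (auto simp: Some W_def)
  qed
qed

end

section \<open>The similarity ratio, centers and limits\<close>

lemma cot_Arg2pi: "cot (Arg2pi z) = Re z / Im z"
proof (cases "z = 0")
  case False
  then show ?thesis
    by (simp add: cot_def cos_Arg2pi[symmetric, of z] sin_Arg2pi[symmetric, of z])
qed (simp add: cot_def)

lemma cot_ccw_angle:
  assumes "Y \<noteq> Z"
  shows "cot (ccw_angle X Y Z) = (X - Y) \<bullet> (Z - Y) / sarea X Y Z"
proof -
  have "(X - Y) / (Z - Y) = (X - Y) * cnj (Z - Y) / of_real ((cmod (Z - Y))\<^sup>2)"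
    unfolding complex_norm_square by (rule complex_div_cnj[unfolded complex_norm_square])
  then have "Re ((X - Y) / (Z - Y)) = Re ((X - Y) * cnj (Z - Y)) / (cmod (Z - Y))\<^sup>2"
    "Im ((X - Y) / (Z - Y)) = Im ((X - Y) * cnj (Z - Y)) / (cmod (Z - Y))\<^sup>2"
    by (simp_all only: Re_divide_of_real Im_divide_of_real)
  then have "Re ((X - Y) / (Z - Y)) / Im ((X - Y) / (Z - Y)) = Re ((X - Y) * cnj (Z - Y)) / Im ((X - Y) * cnj (Z - Y))"
    using assms by simp
  moreover have "Re ((X - Y) * cnj (Z - Y)) = (X - Y) \<bullet> (Z - Y)" by (simp add: inner_complex_def algebra_simps)
  moreover have "Im ((X - Y) * cnj (Z - Y)) = sarea X Y Z" by (simp add: sarea_def algebra_simps)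
  ultimately show ?thesis by (simp add: ccw_angle_def cot_Arg2pi)
qed

context noncyclic4
begin

text \<open>
  The cotangents are quotients of inner products by areas. In each of the two sums the numerator over the common
  denominator is, up to sign, the defect.
\<close>

lemma ratio_eq: "ratio Q = r"
proof -
  define s1 s2 s3 s4 where s: "s1 = sarea B C D" "s2 = sarea C D A" "s3 = sarea D A B" "s4 = sarea A B C"
  define d1 d2 d3 d4 where d: "d1 = (D - A) \<bullet> (B - A)" "d2 = (A - B) \<bullet> (C - B)"
    "d3 = (B - C) \<bullet> (D - C)" "d4 = (C - D) \<bullet> (A - D)"
  note cartesian = inner_complex_def sarea_def defect_def wsum_def
  have "ratio Q = 1 / 4 * (d1 / s3 + d3 / s1) * (d2 / s4 + d4 / s2)"
    using distinct_vertices unfolding ratio_def by (simp add: cot_ccw_angle d s)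
  also have "\<dots> = (d1 * s1 + d3 * s3) * (d2 * s2 + d4 * s4) / (4 * (s1 * s2 * s3 * s4))"
    using sarea_nonzero by (simp add: s[symmetric] field_simps)
  also have "d1 * s1 + d3 * s3 = N"
    unfolding s d cartesian by simp algebra
  also have "d2 * s2 + d4 * s4 = - N"
    unfolding s d cartesian by simp algebra
  finally show ?thesis by (simp add: step_ratio_def s power2_eq_square)
qed

lemma gen_step: "gen Q (m + 2 * j) = map_quad (iterate j) (gen Q m)"
proof (cases "odd m")
  case True
  then obtain k where m: "m = 2 * k + 1" by (elim oddE)
  have "gen Q (2 * (j + k) + 1) = map_quad (iterate j) (gen Q (2 * k + 1))"
    unfolding gen_odd by (simp add: iterate_add)
  then show ?thesis by (simp add: m algebra_simps)
next
  case False
  then obtain k where "m = 2 * k" by (metis evenE)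
  then obtain i where m: "m = 2 * i + 2" by (metis add.commute diff_add_cancel distrib_left mult.right_neutral)
  have "gen Q (2 * (j + i) + 2) = map_quad (iterate j) (gen Q (2 * i + 2))"
    unfolding gen_even by (simp add: iterate_add)
  then show ?thesis by (simp add: m algebra_simps)
qed

lemma h_vertex_ne: "a \<noteq> 0 \<Longrightarrow> h A \<noteq> A"
proof
  assume a: "a \<noteq> 0" "h A = A"
  then have "(of_real r - 1) * (A - w) = 0" by (simp add: algebra_simps)
  then have "A = w" using r_eq_1 a by simp
  then show False using linear_form_nonzero(1) slope_mult_w[OF a(1)] by simp
qed

text \<open>
  The set \<open>K\<close> is specialized to the nonzero numbers and to \<open>{1}\<close>. Absolute values are enough because a negative factor
  of the homothety is absorbed by a rotation by \<open>pi\<close>.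
\<close>

lemma common_center_iff:
  assumes K: "\<And>k. \<bar>r powi k\<bar> \<in> K"
  shows "common_center K Q P \<longleftrightarrow> P = W"
proof
  assume "P = W"
  show "common_center K Q P"
    unfolding common_center_def
  proof (intro conjI allI impI)
    fix m n :: int assume "m \<noteq> n \<and> even (m - n)"
    then have "even (n - m)" by auto
    then obtain j where "n - m = 2 * j" by (rule evenE)
    then have "n = m + 2 * j" by simp
    then have n: "gen Q n = map_quad (iterate j) (gen Q m)" by (simp add: gen_step)
    show "spiral_image K P (gen Q m) (gen Q n)"
    proof (cases "a = 0")
      case True
      then have "iterate j = (\<lambda>z. z + 0)" using r_eq_1 by (auto simp: iterate_def)
      then show ?thesis using True unfolding spiral_image_def \<open>P = W\<close> W_def n
        by (auto intro!: exI[of _ 0])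
    next
      case False
      define \<rho> where "\<rho> = r powi j"
      \<comment> \<open>a negative real factor is a positive one followed by a half turn\<close>
      define t where "t = (if \<rho> \<ge> 0 then 0 else pi)"
      have "of_real \<bar>\<rho>\<bar> * cis t = of_real \<rho>" by (simp add: t_def)
      then have h: "homothety w \<bar>\<rho>\<bar> \<circ> rotation w t = iterate j"
        by (auto simp: homothety_def rotation_def iterate_def \<rho>_def mult.assoc[symmetric])
      have "\<exists>k t. k \<in> K \<and> map_quad (iterate j) (gen Q m) = map_quad (homothety w k \<circ> rotation w t) (gen Q m)"
      proof (intro exI conjI)
        show "\<bar>\<rho>\<bar> \<in> K" using K by (simp add: \<rho>_def)
        show "map_quad (iterate j) (gen Q m) = map_quad (homothety w \<bar>\<rho>\<bar> \<circ> rotation w t) (gen Q m)"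
          by (simp only: h)
      qed
      then show ?thesis using False by (simp add: spiral_image_def \<open>P = W\<close> W_def n)
    qed
  next
    assume "P \<noteq> None"
    then have "a \<noteq> 0" using \<open>P = W\<close> by (auto simp: W_def)
    have "gen Q 3 = map_quad (iterate 1) Q" using gen_step[of 1 1] by (simp add: gen_1)
    then have "gen Q 1 \<noteq> gen Q 3" using h_vertex_ne[OF \<open>a \<noteq> 0\<close>] by (simp add: gen_1 iterate_1)
    then show "\<exists>m n. even (m - n) \<and> gen Q m \<noteq> gen Q n" by (intro exI[of _ 1] exI[of _ 3]) simp
  qed
next
  assume cc: "common_center K Q P"
  then have "spiral_image K P (gen Q 1) (gen Q 3)" by (simp add: common_center_def)
  moreover have "gen Q 3 = map_quad (iterate 1) Q" using gen_step[of 1 1] by (simp add: gen_1)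
  ultimately have si: "spiral_image K P Q (map_quad (iterate 1) Q)" by (simp add: gen_1)
  show "P = W"
  proof (cases P)
    case None
    then obtain v where "A + v = h A" "B + v = h B" using si by (auto simp: spiral_image_def iterate_1)
    then have "(of_real r - 1) * (A - B) = 0" by algebra
    then have "r = 1" using distinct_vertices by simp
    then show ?thesis using r_eq_1 by (simp add: W_def None)
  next
    case (Some p)
    have a: "a \<noteq> 0"
    proof
      assume "a = 0"
      then have "iterate j = id" for j using r_eq_1 by (auto simp: iterate_def)
      then have g: "gen Q (m + 2 * j) = gen Q m" for m j
        by (simp add: gen_step quad.map_id)
      obtain m n where mn: "even (m - n)" "gen Q m \<noteq> gen Q n"
        using cc unfolding common_center_def Some by blast
      from mn(1) obtain j where "m - n = 2 * j" by (rule evenE)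
      then have "m = n + 2 * j" by simp
      then show False using g mn(2) by simp
    qed
    obtain k t where "map_quad (iterate 1) Q = map_quad (homothety p k \<circ> rotation p t) Q"
      using si by (auto simp: spiral_image_def Some)
    then have "h A = p + k * cis t * (A - p)" "h B = p + k * cis t * (B - p)"
      by (auto simp: iterate_1 homothety_def rotation_def mult.assoc)
    moreover define \<mu> where "\<mu> = k * cis t"
    ultimately have AB: "h A = p + \<mu> * (A - p)" "h B = p + \<mu> * (B - p)" by simp_all
    then have "(of_real r - \<mu>) * (A - B) = 0" by algebra
    then have "\<mu> = r" using distinct_vertices by simp
    then have "(1 - of_real r) * (p - w) = 0" using AB(1) by (simp add: algebra_simps)
    then have "p = w" using r_eq_1 a by simp
    then show ?thesis using a by (simp add: W_def Some)
  qed
qed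

lemma spiral_similarity_center_iff: "spiral_similarity_center Q P \<longleftrightarrow> P = W"
  unfolding spiral_similarity_center_def by (rule common_center_iff) (simp add: r_nonzero)

lemma limit_even_odd:
  fixes f :: "nat \<Rightarrow> complex"
  assumes "(\<lambda>n. f (2 * n)) \<longlonglongrightarrow> l" "(\<lambda>n. f (2 * n + 1)) \<longlonglongrightarrow> l"
  shows "f \<longlonglongrightarrow> l"
proof (rule LIMSEQ_I)
  fix e :: real assume "e > 0"
  obtain n1 where n1: "\<And>n. n \<ge> n1 \<Longrightarrow> norm (f (2 * n) - l) < e" using LIMSEQ_D[OF assms(1) \<open>e > 0\<close>] by blast
  obtain n2 where n2: "\<And>n. n \<ge> n2 \<Longrightarrow> norm (f (2 * n + 1) - l) < e" using LIMSEQ_D[OF assms(2) \<open>e > 0\<close>] by blast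
  show "\<exists>no. \<forall>n\<ge>no. norm (f n - l) < e"
  proof (intro exI allI impI)
    fix n assume n: "n \<ge> 2 * n1 + 2 * n2"
    show "norm (f n - l) < e"
    proof (cases "even n")
      case True
      then obtain k where "n = 2 * k" by (elim evenE)
      then show ?thesis using n1[of k] n by simp
    next
      case False
      then obtain k where "n = 2 * k + 1" by (elim oddE)
      then show ?thesis using n2[of k] n by simp
    qed
  qed
qed

text \<open>
  Both subsequences of one parity consist of images of one quadrilateral under powers of \<open>h\<close> that contract to \<open>w\<close>.
\<close>

lemma quads_converge_even_odd:
  assumes a: "a \<noteq> 0"
    and ev: "\<And>n. q (2 * n) = map_quad (iterate (e n)) q0" "(\<lambda>n. r powi e n) \<longlonglongrightarrow> 0"
    and od: "\<And>n. q (2 * n + 1) = map_quad (iterate (f n)) q1" "(\<lambda>n. r powi f n) \<longlonglongrightarrow> 0"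
  shows "quads_converge q P \<longleftrightarrow> P = W"
proof -
  have l: "(\<lambda>n. iterate (e n) z) \<longlonglongrightarrow> w" if "(\<lambda>n. r powi e n) \<longlonglongrightarrow> 0" for e and z
  proof -
    have "(\<lambda>n. w + of_real (r powi e n) * (z - w)) \<longlonglongrightarrow> w + of_real 0 * (z - w)"
      by (intro tendsto_intros that)
    then show ?thesis by (simp add: iterate_def)
  qed
  have v: "vA (map_quad g x) = g (vA x)" "vB (map_quad g x) = g (vB x)" "vC (map_quad g x) = g (vC x)" "vD (map_quad g x) = g (vD x)"
    for g :: "complex \<Rightarrow> complex" and x by (cases x; simp)+
  have lim: "(\<lambda>n. vA (q n)) \<longlonglongrightarrow> w" "(\<lambda>n. vB (q n)) \<longlonglongrightarrow> w" "(\<lambda>n. vC (q n)) \<longlonglongrightarrow> w" "(\<lambda>n. vD (q n)) \<longlonglongrightarrow> w"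
    by (rule limit_even_odd; unfold ev(1) od(1) v; rule l[OF ev(2)] l[OF od(2)])+
  show ?thesis
  proof
    assume qc: "quads_converge q P"
    show "P = W"
    proof (cases P)
      case None
      then have "filterlim (\<lambda>n. vA (q n)) at_infinity sequentially"
        using qc by (simp add: quads_converge_def point_limit_def)
      then have False using not_tendsto_and_filterlim_at_infinity[OF _ lim(1)] by simp
      then show ?thesis ..
    next
      case (Some p)
      then have "(\<lambda>n. vA (q n)) \<longlonglongrightarrow> p" using qc by (simp add: quads_converge_def point_limit_def)
      then have "p = w" using lim(1) by (rule LIMSEQ_unique)
      then show ?thesis using a by (simp add: W_def Some)
    qed
  next
    assume "P = W"
    then show "quads_converge q P" using lim a by (simp add: quads_converge_def point_limit_def W_def)
  qed
qed

text \<open>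
  A vertex of the next generation is the center of a circle through the vertex of the same name.
\<close>

lemma gen_2_ne: "gen Q 2 \<noteq> gen Q 1"
proof
  assume "gen Q 2 = gen Q 1"
  then have "O3 = A" by (simp add: gen_1 gen_2)
  moreover have "dist O3 A = dist O3 D" using dist_ccenter(1)[of D A B] sarea_nonzero by simp
  ultimately show False using radii_pos(3) by simp
qed

text \<open>
  Since \<open>r \<noteq> 1\<close> for finite \<open>W\<close>, the least period is \<open>2\<close> for \<open>r = 1\<close> and \<open>4\<close> for \<open>r = - 1\<close>.
\<close>

lemma limit_or_rotation_center_iff: "limit_or_rotation_center Q P \<longleftrightarrow> P = W"
proof -
  consider "\<bar>r\<bar> < 1" | "\<bar>r\<bar> > 1" | "\<bar>r\<bar> = 1" by linarith
  then show ?thesis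
  proof cases
    case 1
    then have a: "a \<noteq> 0" using r_eq_1 by auto
    have "(\<lambda>n. r ^ n / r) \<longlonglongrightarrow> 0 / r"
      by (intro tendsto_divide tendsto_const LIMSEQ_power_zero) (use 1 r_nonzero in auto)
    moreover have "r powi (int n - 1) = r ^ n / r" for n using r_nonzero by (simp add: power_int_diff)
    ultimately have e: "(\<lambda>n. r powi (int n - 1)) \<longlonglongrightarrow> 0" by simp
    have f: "(\<lambda>n. r powi int n) \<longlonglongrightarrow> 0" using LIMSEQ_power_zero[of r] 1 by simp
    have "quads_converge (\<lambda>n. gen Q (int n)) P \<longleftrightarrow> P = W"
    proof (rule quads_converge_even_odd[OF a _ e _ f])
      show "gen Q (int (2 * n)) = map_quad (iterate (int n - 1)) Q2" for n
        using gen_even[of "int n - 1"] by (simp add: algebra_simps)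
      show "gen Q (int (2 * n + 1)) = map_quad (iterate (int n)) Q" for n
        using gen_odd[of "int n"] by (simp add: algebra_simps)
    qed
    then show ?thesis using 1 by (simp add: limit_or_rotation_center_def ratio_eq)
  next
    case 2
    then have a: "a \<noteq> 0" using r_eq_1 by auto
    have "(\<lambda>n. (1 / r) ^ n / r) \<longlonglongrightarrow> 0 / r"
      by (intro tendsto_divide tendsto_const LIMSEQ_power_zero) (use 2 r_nonzero in \<open>auto simp: divide_simps\<close>)
    moreover have "r powi (- int n - 1) = (1 / r) ^ n / r" for n
      using r_nonzero by (simp add: power_int_diff power_int_minus power_one_over field_simps)
    ultimately have e: "(\<lambda>n. r powi (- int n - 1)) \<longlonglongrightarrow> 0" by simp
    have "quads_converge (\<lambda>n. gen Q (- int n)) P \<longleftrightarrow> P = W"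
    proof (rule quads_converge_even_odd[OF a _ e _ e])
      show "gen Q (- int (2 * n)) = map_quad (iterate (- int n - 1)) Q2" for n
        using gen_even[of "- int n - 1"] by (simp add: algebra_simps)
      show "gen Q (- int (2 * n + 1)) = map_quad (iterate (- int n - 1)) Q" for n
        using gen_odd[of "- int n - 1"] by (simp add: algebra_simps)
    qed
    then show ?thesis using 2 by (simp add: limit_or_rotation_center_def ratio_eq)
  next
    case 3
    have "\<bar>r powi k\<bar> \<in> {1}" for k using 3 by (simp add: power_int_abs)
    then have cc: "common_center {1} Q P \<longleftrightarrow> P = W" by (rule common_center_iff)
    have "least_period (gen Q) 2 \<or> least_period (gen Q) 4"
    proof (cases "r = 1")
      case True
      then have "gen Q (n + 2) = gen Q n" for n
        using gen_step[of n 1] by (simp add: iterate_def[abs_def] quad.map_ident)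
      moreover have "\<not> (\<forall>n. gen Q (n + j) = gen Q n)" if "0 < j" "j < 2" for j
      proof -
        have "j = 1" using that by simp
        then show ?thesis using gen_2_ne by (metis one_add_one)
      qed
      ultimately show ?thesis by (auto simp: least_period_def)
    next
      case False
      then have r: "r = - 1" and a: "a \<noteq> 0" using 3 r_eq_1 by auto
      have p: "gen Q (n + 4) = gen Q n" for n
        using gen_step[of n 2] by (simp add: iterate_def[abs_def] quad.map_ident r)
      have 31: "gen Q 3 \<noteq> gen Q 1"
        using gen_step[of 1 1] h_vertex_ne[OF a] by (simp add: gen_1 iterate_1)
      have "\<not> (\<forall>n. gen Q (n + j) = gen Q n)" if j: "0 < j" "j < 4" for j
      proof
        assume all: "\<forall>n. gen Q (n + j) = gen Q n"
        have "j = 1 \<or> j = 2 \<or> j = 3" using j by auto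
        then show False
        proof (elim disjE)
          assume "j = 1"
          then show False using spec[OF all, of 1] gen_2_ne by simp
        next
          assume "j = 2"
          then show False using spec[OF all, of 1] 31 by simp
        next
          assume "j = 3"
          then show False using spec[OF all, of 2] p[of 1] gen_2_ne by simp
        qed
      qed
      then show ?thesis using p by (auto simp: least_period_def)
    qed
    then show ?thesis using 3 cc by (simp add: limit_or_rotation_center_def ratio_eq)
  qed
qed

end

section \<open>Pedal quadrilaterals\<close>

lemma foot_inner:
  assumes "X \<noteq> Y"
  shows "foot P X Y = X + of_real (((P - X) \<bullet> (Y - X)) / (cmod (Y - X))\<^sup>2) * (Y - X)"
  unfolding foot_def
proof (rule the_equality)
  have F: "F \<in> affine hull {X, Y} \<longleftrightarrow> (\<exists>t::real. F = X + of_real t * (Y - X))" for F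
    by (auto simp: affine_hull_2_alt scaleR_conv_of_real)
  have o: "orthogonal (P - (X + of_real t * (Y - X))) (Y - X) \<longleftrightarrow> t = ((P - X) \<bullet> (Y - X)) / (cmod (Y - X))\<^sup>2" for t
  proof -
    have "P - (X + of_real t * (Y - X)) = (P - X) - t *\<^sub>R (Y - X)" by (simp add: scaleR_conv_of_real)
    then have "orthogonal (P - (X + of_real t * (Y - X))) (Y - X) \<longleftrightarrow> (P - X) \<bullet> (Y - X) = t * (cmod (Y - X))\<^sup>2"
      by (simp only: orthogonal_def inner_diff_left[of "P - X"] inner_scaleR_left power2_norm_eq_inner right_minus_eq)
    then show ?thesis using assms by (auto simp: eq_divide_eq)
  qed
  show "X + of_real (((P - X) \<bullet> (Y - X)) / (cmod (Y - X))\<^sup>2) * (Y - X) \<in> affine hull {X, Y} \<and>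
      orthogonal (P - (X + of_real (((P - X) \<bullet> (Y - X)) / (cmod (Y - X))\<^sup>2) * (Y - X))) (Y - X)"
    using F o by blast
  show "G = X + of_real (((P - X) \<bullet> (Y - X)) / (cmod (Y - X))\<^sup>2) * (Y - X)"
    if "G \<in> affine hull {X, Y} \<and> orthogonal (P - G) (Y - X)" for G
    using that F[of G] o by auto
qed

text \<open>
  For a unit direction \<open>e\<close> of the line \<open>XY\<close> this is \<open>e\<^sup>2\<close>: the reflection in the line is \<open>P \<mapsto> X + dir_square X Y * cnj (P - X)\<close>,
  and the foot of the perpendicular is the midpoint of \<open>P\<close> and its reflection.
\<close>

definition dir_square :: "complex \<Rightarrow> complex \<Rightarrow> complex" where
  "dir_square X Y = (Y - X) / cnj (Y - X)"

lemma foot_eq: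
  assumes "X \<noteq> Y"
  shows "foot P X Y = (P + X + dir_square X Y * cnj (P - X)) / 2"
    and "foot P X Y = (P + Y + dir_square X Y * cnj (P - Y)) / 2"
proof -
  define V where "V = Y - X"
  define z where "z = P - X"
  have V: "V \<noteq> 0" "cnj V \<noteq> 0" using assms by (simp_all add: V_def)
  define \<rho> where "\<rho> = z \<bullet> V"
  have \<rho>: "2 * of_real \<rho> = z * cnj V + cnj z * V"
    using complex_add_cnj[of "z * cnj V"] by (simp add: \<rho>_def inner_complex_def)
  have "of_real (\<rho> / (cmod V)\<^sup>2) * V = (2 * of_real \<rho>) / (2 * (V * cnj V)) * V"
    unfolding complex_norm_square[symmetric] by simp
  also have "\<dots> = (z + V / cnj V * cnj z) / 2"
    unfolding \<rho> using V by (simp add: field_simps)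
  finally have "foot P X Y = X + (z + V / cnj V * cnj z) / 2"
    unfolding foot_inner[OF assms] V_def z_def \<rho>_def by simp
  also have "\<dots> = (P + X + dir_square X Y * cnj (P - X)) / 2"
    unfolding dir_square_def V_def[symmetric] z_def[symmetric] by (simp add: z_def field_simps)
  finally show 1: "foot P X Y = (P + X + dir_square X Y * cnj (P - X)) / 2" .
  have "dir_square X Y * cnj (Y - X) = Y - X" unfolding dir_square_def using V by (simp add: V_def)
  then have "X + dir_square X Y * cnj (P - X) = Y + dir_square X Y * cnj (P - Y)"
    by (simp add: algebra_simps)
  then show "foot P X Y = (P + Y + dir_square X Y * cnj (P - Y)) / 2" unfolding 1 by (simp add: add.assoc)
qed

lemma dir_square_diff:
  assumes "X \<noteq> Y" "Y \<noteq> Z"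
  shows "dir_square Y Z - dir_square X Y = 2 * \<i> * of_real (sarea X Y Z) / cnj ((Z - Y) * (Y - X))"
proof -
  define U V where "U = Y - X" and "V = Z - Y"
  have nz: "cnj U \<noteq> 0" "cnj V \<noteq> 0" using assms by (simp_all add: U_def V_def)
  have "2 * \<i> * of_real (sarea X Y Z) = V * cnj U - U * cnj V"
    unfolding of_real_sarea U_def V_def by (simp add: algebra_simps)
  then show ?thesis
    unfolding dir_square_def U_def[symmetric] V_def[symmetric] using nz by (simp add: field_simps)
qed

lemma foot_at_infinity:
  assumes "X \<noteq> Y"
  shows "((\<lambda>t::real. foot (t *\<^sub>R e) X Y /\<^sub>R t) \<longlongrightarrow> (e + dir_square X Y * cnj e) / 2) at_top"
proof -
  define c where "c = (X - dir_square X Y * cnj X) / 2"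
  have "((\<lambda>t::real. inverse t) \<longlongrightarrow> 0) at_top" by (rule tendsto_inverse_0_at_top[OF filterlim_ident])
  then have "((\<lambda>t::real. (e + dir_square X Y * cnj e) / 2 + inverse t *\<^sub>R c) \<longlongrightarrow> (e + dir_square X Y * cnj e) / 2 + 0 *\<^sub>R c) at_top"
    by (intro tendsto_intros)
  moreover have "eventually (\<lambda>t::real. (e + dir_square X Y * cnj e) / 2 + inverse t *\<^sub>R c = foot (t *\<^sub>R e) X Y /\<^sub>R t) at_top"
    using eventually_gt_at_top[of "0::real"]
  proof eventually_elim
    case (elim t)
    then show ?case unfolding foot_eq(1)[OF assms] c_def
      by (simp add: scaleR_conv_of_real field_simps)
  qed
  ultimately show ?thesis by (simp add: filterlim_cong)
qed

lemma parallelogram_shape: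
  fixes q :: "complex quad"
  assumes U: "vB q - vA q = U" "vC q - vD q = U" and V: "vD q - vA q = V"
  defines "\<kappa> \<equiv> (U \<bullet> V) / (cmod U * cmod V)"
  shows "nondeg_parallelogram q \<longleftrightarrow> Im (cnj U * V) \<noteq> 0" "quad_angles q = {arccos \<kappa>, arccos (- \<kappa>)}"
proof -
  have C: "vC q - vB q = V" using U V by (simp add: algebra_simps)
  have CA: "vC q - vA q = U + V" using U V by (metis diff_add_cancel add_diff_eq add.commute)
  show "nondeg_parallelogram q \<longleftrightarrow> Im (cnj U * V) \<noteq> 0"
    unfolding nondeg_parallelogram_def collinear_sarea sarea_def CA U by (simp add: algebra_simps)
  have m: "vA q - vB q = - U" "vD q - vC q = - U" "vB q - vC q = - V" "vA q - vD q = - V"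
    using U V C by (metis minus_diff_eq)+
  show "quad_angles q = {arccos \<kappa>, arccos (- \<kappa>)}"
    unfolding quad_angles_def vangle_def U V C m \<kappa>_def
    by (auto simp: inner_commute mult.commute)
qed

context noncyclic4
begin

text \<open>
  The sides of the pedal quadrilateral of \<open>p\<close> are these numbers times the conjugates of \<open>p - B\<close>, \<open>p - C\<close>, \<open>p - D\<close>, \<open>p - A\<close>.
  The interpolated form replaces the products of sides in the denominators by a diagonal and a value of the form.
\<close>

lemma pedal_sides:
  "(dir_square B C - dir_square A B) / 2 = \<i> * of_real (sarea C D A * sarea A B C) * cnj ((B - D) / (a * B + b))"
  "(dir_square C D - dir_square B C) / 2 = \<i> * of_real (sarea B C D * sarea D A B) * cnj ((A - C) / (a * C + b))"
  "(dir_square D A - dir_square C D) / 2 = - \<i> * of_real (sarea C D A * sarea A B C) * cnj ((B - D) / (a * D + b))"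
  "(dir_square A B - dir_square D A) / 2 = - \<i> * of_real (sarea B C D * sarea D A B) * cnj ((A - C) / (a * A + b))"
proof -
  note d = distinct_vertices
  have f: "1 / ((C - B) * (B - A)) = of_real (sarea C D A) * ((B - D) / (a * B + b))"
    "1 / ((D - C) * (C - B)) = of_real (sarea D A B) * ((A - C) / (a * C + b))"
    "1 / ((A - D) * (D - C)) = - of_real (sarea A B C) * ((B - D) / (a * D + b))"
    "1 / ((B - A) * (A - D)) = - of_real (sarea B C D) * ((A - C) / (a * A + b))"
    unfolding weight_products using d sarea_nonzero by (simp_all add: divide_simps) (simp_all add: algebra_simps)
  have g: "(2 * \<i> * of_real s / cnj z) / 2 = \<i> * of_real s * cnj (1 / z)" for s z
    by simp
  show "(dir_square B C - dir_square A B) / 2 = \<i> * of_real (sarea C D A * sarea A B C) * cnj ((B - D) / (a * B + b))"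
    unfolding dir_square_diff[OF d(1) d(4)] g f unfolding complex_cnj_mult by (simp add: mult_ac)
  show "(dir_square C D - dir_square B C) / 2 = \<i> * of_real (sarea B C D * sarea D A B) * cnj ((A - C) / (a * C + b))"
    unfolding dir_square_diff[OF d(4) d(6)] g f unfolding complex_cnj_mult by (simp add: mult_ac)
  show "(dir_square D A - dir_square C D) / 2 = - \<i> * of_real (sarea C D A * sarea A B C) * cnj ((B - D) / (a * D + b))"
    unfolding dir_square_diff[OF d(6) d(3)[symmetric]] g f unfolding complex_cnj_mult by (simp add: mult_ac)
  show "(dir_square A B - dir_square D A) / 2 = - \<i> * of_real (sarea B C D * sarea D A B) * cnj ((A - C) / (a * A + b))"
    unfolding dir_square_diff[OF d(3)[symmetric] d(1)] g f unfolding complex_cnj_mult by (simp add: mult_ac)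
qed

lemma varignon_shape:
  "nondeg_parallelogram (varignon Q) \<longleftrightarrow> Im (cnj (B - D) * (A - C)) \<noteq> 0"
  "quad_angles (varignon Q) = {arccos (((B - D) \<bullet> (A - C)) / (cmod (B - D) * cmod (A - C))),
     arccos (- (((B - D) \<bullet> (A - C)) / (cmod (B - D) * cmod (A - C))))}"
proof -
  have s: "vB (varignon Q) - vA (varignon Q) = - (1/2) *\<^sub>R (A - C)" "vC (varignon Q) - vD (varignon Q) = - (1/2) *\<^sub>R (A - C)"
    "vD (varignon Q) - vA (varignon Q) = - (1/2) *\<^sub>R (B - D)"
    by (simp_all add: varignon_def midpoint_def algebra_simps)
  show "nondeg_parallelogram (varignon Q) \<longleftrightarrow> Im (cnj (B - D) * (A - C)) \<noteq> 0"
  proof -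
    have "Im (cnj (- (1/2) *\<^sub>R (A - C)) * (- (1/2) *\<^sub>R (B - D))) = - (1/4) * Im (cnj (B - D) * (A - C))"
      by (simp add: field_simps)
    moreover have "u \<noteq> 0 \<longleftrightarrow> v \<noteq> 0" if "u = - (1/4) * v" for u v :: real
      using that by simp
    ultimately show ?thesis unfolding parallelogram_shape(1)[OF s] by blast
  qed
  have "(- (1/2) *\<^sub>R (A - C)) \<bullet> (- (1/2) *\<^sub>R (B - D)) / (cmod (- (1/2) *\<^sub>R (A - C)) * cmod (- (1/2) *\<^sub>R (B - D)))
      = ((B - D) \<bullet> (A - C)) / (cmod (B - D) * cmod (A - C))"
    unfolding inner_scaleR_left inner_scaleR_right norm_scaleR inner_commute[of "A - C"] by simp
  then show "quad_angles (varignon Q) = {arccos (((B - D) \<bullet> (A - C)) / (cmod (B - D) * cmod (A - C))),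
     arccos (- (((B - D) \<bullet> (A - C)) / (cmod (B - D) * cmod (A - C))))}"
    unfolding parallelogram_shape(2)[OF s] by (simp only:)
qed

text \<open>
  A finite point \<open>p\<close> is the case \<open>\<gamma> = - 1\<close>, \<open>\<delta> = p\<close>; the limiting shape in direction \<open>e\<close> is the case \<open>\<gamma> = 0\<close>, \<open>\<delta> = e\<close>.
  Opposite sides contain the same diagonal and the same areas, so that only the values at \<open>B\<close> and \<open>D\<close> are compared.
\<close>

lemma parallelogram_iff:
  fixes \<gamma> \<delta> :: complex
  shows "(dir_square B C - dir_square A B) / 2 * cnj (\<gamma> * B + \<delta>) = - ((dir_square D A - dir_square C D) / 2 * cnj (\<gamma> * D + \<delta>)) \<longleftrightarrow> \<gamma> * b = \<delta> * a"
proof -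
  define s where "s = sarea C D A * sarea A B C"
  have s: "s \<noteq> 0" using sarea_nonzero by (simp add: s_def)
  have BD: "B - D \<noteq> 0" using distinct_vertices by simp
  have "(dir_square B C - dir_square A B) / 2 * cnj (\<gamma> * B + \<delta>) = \<i> * of_real s * cnj ((B - D) * ((\<gamma> * B + \<delta>) / (a * B + b)))"
    "- ((dir_square D A - dir_square C D) / 2 * cnj (\<gamma> * D + \<delta>)) = \<i> * of_real s * cnj ((B - D) * ((\<gamma> * D + \<delta>) / (a * D + b)))"
    unfolding pedal_sides s_def[symmetric] by simp_all
  then have "?thesis \<longleftrightarrow> ((\<gamma> * B + \<delta>) / (a * B + b) = (\<gamma> * D + \<delta>) / (a * D + b) \<longleftrightarrow> \<gamma> * b = \<delta> * a)"
    using s BD by (simp only: mult_cancel_left complex_cnj_cancel_iff) simp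
  also have "(\<gamma> * B + \<delta>) / (a * B + b) = (\<gamma> * D + \<delta>) / (a * D + b) \<longleftrightarrow> (\<gamma> * B + \<delta>) * (a * D + b) = (\<gamma> * D + \<delta>) * (a * B + b)"
    using linear_form_nonzero by (simp add: frac_eq_eq)
  also have "\<dots> \<longleftrightarrow> (B - D) * (\<gamma> * b - \<delta> * a) = 0" by (simp add: algebra_simps)
  also have "\<dots> \<longleftrightarrow> \<gamma> * b = \<delta> * a" using BD by simp
  finally show ?thesis by simp
qed

text \<open>
  When the values of the form cancel, the sides are the conjugated diagonals up to a common complex factor and two real
  factors. Conjugation and the signs of the real factors only exchange the two angles of a parallelogram.
\<close>

lemma pedal_shape:
  fixes \<mu> :: complex
  assumes \<mu>: "\<mu> \<noteq> 0"
    and g: "\<And>X. g X = \<mu> * (a * X + b)"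
    and v: "vB q - vA q = (dir_square B C - dir_square A B) / 2 * cnj (g B)"
      "vC q - vD q = - ((dir_square D A - dir_square C D) / 2 * cnj (g D))"
      "vD q - vA q = - ((dir_square A B - dir_square D A) / 2 * cnj (g A))"
    and nd: "nondeg_parallelogram (varignon Q)"
  shows "nondeg_parallelogram q" "quad_angles q = quad_angles (varignon Q)"
proof -
  define x y where "x = sarea C D A * sarea A B C" and "y = sarea B C D * sarea D A B"
  have xy: "x \<noteq> 0" "y \<noteq> 0" using sarea_nonzero by (simp_all add: x_def y_def)
  define U V where "U = of_real x * (\<i> * cnj \<mu> * cnj (B - D))" and "V = of_real y * (\<i> * cnj \<mu> * cnj (A - C))"
  have k: "c * cnj (x / y) * cnj (m * y) = c * (cnj m * cnj x)" if "y \<noteq> 0" for c x y m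
    using that by simp
  have s: "vB q - vA q = U" "vC q - vD q = U" "vD q - vA q = V"
    unfolding v g pedal_sides U_def V_def x_def y_def k[OF linear_form_nonzero(1)] k[OF linear_form_nonzero(2)] k[OF linear_form_nonzero(4)]
    by (simp_all add: mult_ac del: complex_cnj_diff)
  have UV: "cnj U * V = of_real (x * y * (cmod \<mu>)\<^sup>2) * (cnj (A - C) * (B - D))"
  proof -
    have "cnj U * V = of_real (x * y) * (\<mu> * cnj \<mu>) * (cnj (A - C) * (B - D))"
      unfolding U_def V_def by (simp add: mult_ac del: complex_cnj_diff)
    then show ?thesis unfolding complex_norm_square[symmetric] by simp
  qed
  have m: "x * y * (cmod \<mu>)\<^sup>2 \<noteq> 0" using xy \<mu> by simp
  have ir: "Im (of_real c * z) = c * Im z" "Re (of_real c * z) = c * Re z" for c z by simp_all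
  have "Im (cnj (A - C) * (B - D)) = - Im (cnj (B - D) * (A - C))" by (simp add: algebra_simps)
  then show "nondeg_parallelogram q"
    using nd m unfolding parallelogram_shape(1)[OF s] UV varignon_shape(1) ir by simp
  have "U \<bullet> V = x * y * (cmod \<mu>)\<^sup>2 * ((B - D) \<bullet> (A - C))"
    unfolding inner_complex_cnj UV ir by (simp add: algebra_simps)
  moreover have "cmod U * cmod V = \<bar>x * y\<bar> * (cmod \<mu>)\<^sup>2 * (cmod (B - D) * cmod (A - C))"
    unfolding U_def V_def norm_mult complex_mod_cnj by (simp add: abs_mult power2_eq_square)
  moreover define \<kappa> where "\<kappa> = (B - D) \<bullet> (A - C) / (cmod (B - D) * cmod (A - C))"
  ultimately have "U \<bullet> V / (cmod U * cmod V) = x * y / \<bar>x * y\<bar> * \<kappa>"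
    using \<mu> by simp
  moreover have "x * y / \<bar>x * y\<bar> = 1 \<or> x * y / \<bar>x * y\<bar> = - 1" using xy by (auto simp: abs_if)
  ultimately have "U \<bullet> V / (cmod U * cmod V) = \<kappa> \<or> U \<bullet> V / (cmod U * cmod V) = - \<kappa>"
    by (elim disjE) simp_all
  then show "quad_angles q = quad_angles (varignon Q)"
    unfolding parallelogram_shape(2)[OF s] varignon_shape(2) \<kappa>_def[symmetric]
    by (elim disjE) (simp_all add: insert_commute)
qed

lemma pedal_parallelogram_iff:
  assumes nd: "nondeg_parallelogram (varignon Q)"
  shows "pedal_parallelogram Q P \<longleftrightarrow> P = W"
proof (cases P)
  case (Some p)
  note d = distinct_vertices and d2 = distinct_vertices[symmetric]
  define q where "q = pedal Q p"
  have v: "vA q = (p + B + dir_square A B * cnj (p - B)) / 2" "vA q = (p + A + dir_square A B * cnj (p - A)) / 2"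
    "vB q = (p + B + dir_square B C * cnj (p - B)) / 2" "vC q = (p + D + dir_square C D * cnj (p - D)) / 2"
    "vD q = (p + D + dir_square D A * cnj (p - D)) / 2" "vD q = (p + A + dir_square D A * cnj (p - A)) / 2"
    unfolding q_def pedal_def quad.sel using foot_eq[OF d(1)] foot_eq[OF d(4)] foot_eq[OF d(6)] foot_eq[OF d2(3)] by metis+
  have s: "vB q - vA q = (dir_square B C - dir_square A B) / 2 * cnj ((- 1) * B + p)"
      "vC q - vD q = - ((dir_square D A - dir_square C D) / 2 * cnj ((- 1) * D + p))"
    unfolding v(1,3,4,5) by (simp_all add: field_simps)
  have s3: "vD q - vA q = - ((dir_square A B - dir_square D A) / 2 * cnj ((- 1) * A + p))"
    unfolding v(2,6) by (simp add: field_simps)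
  show ?thesis
  proof
    assume "pedal_parallelogram Q P"
    then have "vB q - vA q = vC q - vD q"
      by (simp add: pedal_parallelogram_def Some nondeg_parallelogram_def q_def)
    then have e: "- 1 * b = p * a" unfolding s parallelogram_iff .
    then have "a \<noteq> 0" using linear_form_nonzero(1) by auto
    then show "P = W" using e by (simp add: Some W_def w_def field_simps)
  next
    assume "P = W"
    then have a: "a \<noteq> 0" and "p = w" by (auto simp: Some W_def split: if_splits)
    have "(- 1) * X + p = (- 1 / a) * (a * X + b)" for X
      using a \<open>p = w\<close> by (simp add: w_def field_simps)
    from pedal_shape[of "- 1 / a" "\<lambda>X. (- 1) * X + p" q, OF _ this s s3 nd] a show "pedal_parallelogram Q P"
      by (simp add: pedal_parallelogram_def Some q_def)
  qed
next
  case None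
  note d = distinct_vertices and d2 = distinct_vertices[symmetric]
  define L where "L e = Quad ((e + dir_square A B * cnj e) / 2) ((e + dir_square B C * cnj e) / 2)
    ((e + dir_square C D * cnj e) / 2) ((e + dir_square D A * cnj e) / 2)" for e
  have lim: "((\<lambda>t::real. vA (pedal Q (t *\<^sub>R e)) /\<^sub>R t) \<longlongrightarrow> vA (L e)) at_top"
    "((\<lambda>t::real. vB (pedal Q (t *\<^sub>R e)) /\<^sub>R t) \<longlongrightarrow> vB (L e)) at_top"
    "((\<lambda>t::real. vC (pedal Q (t *\<^sub>R e)) /\<^sub>R t) \<longlongrightarrow> vC (L e)) at_top"
    "((\<lambda>t::real. vD (pedal Q (t *\<^sub>R e)) /\<^sub>R t) \<longlongrightarrow> vD (L e)) at_top" for e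
    unfolding pedal_def L_def quad.sel by (intro foot_at_infinity d d2)+
  have s: "vB (L e) - vA (L e) = (dir_square B C - dir_square A B) / 2 * cnj (0 * B + e)"
      "vC (L e) - vD (L e) = - ((dir_square D A - dir_square C D) / 2 * cnj (0 * D + e))"
      "vD (L e) - vA (L e) = - ((dir_square A B - dir_square D A) / 2 * cnj (0 * A + e))" for e
    unfolding L_def quad.sel by (simp_all add: field_simps)
  show ?thesis
  proof
    assume "pedal_parallelogram Q P"
    then have "\<exists>L. nondeg_parallelogram L \<and> quad_angles L = quad_angles (varignon Q) \<and>
               ((\<lambda>t::real. vA (pedal Q (t *\<^sub>R 1)) /\<^sub>R t) \<longlongrightarrow> vA L) at_top \<and>
               ((\<lambda>t::real. vB (pedal Q (t *\<^sub>R 1)) /\<^sub>R t) \<longlongrightarrow> vB L) at_top \<and>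
               ((\<lambda>t::real. vC (pedal Q (t *\<^sub>R 1)) /\<^sub>R t) \<longlongrightarrow> vC L) at_top \<and>
               ((\<lambda>t::real. vD (pedal Q (t *\<^sub>R 1)) /\<^sub>R t) \<longlongrightarrow> vD L) at_top"
      unfolding pedal_parallelogram_def None option.case using norm_one by blast
    then obtain L' where L': "nondeg_parallelogram L'"
        "((\<lambda>t::real. vA (pedal Q (t *\<^sub>R 1)) /\<^sub>R t) \<longlongrightarrow> vA L') at_top"
        "((\<lambda>t::real. vB (pedal Q (t *\<^sub>R 1)) /\<^sub>R t) \<longlongrightarrow> vB L') at_top"
        "((\<lambda>t::real. vC (pedal Q (t *\<^sub>R 1)) /\<^sub>R t) \<longlongrightarrow> vC L') at_top"
        "((\<lambda>t::real. vD (pedal Q (t *\<^sub>R 1)) /\<^sub>R t) \<longlongrightarrow> vD L') at_top" by blast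
    note u = tendsto_unique[OF trivial_limit_at_top_linorder]
    have "vB (L 1) - vA (L 1) = vC (L 1) - vD (L 1)"
      using L'(1) u[OF lim(1) L'(2)] u[OF lim(2) L'(3)] u[OF lim(3) L'(4)] u[OF lim(4) L'(5)]
      by (simp add: nondeg_parallelogram_def)
    then have "0 * b = 1 * a" unfolding s parallelogram_iff .
    then show "P = W" by (simp add: None W_def)
  next
    assume "P = W"
    then have a: "a = 0" by (auto simp: None W_def split: if_splits)
    then have b: "b \<noteq> 0" using linear_form_nonzero(1) by auto
    have "nondeg_parallelogram (L e) \<and> quad_angles (L e) = quad_angles (varignon Q)" if "norm e = 1" for e
    proof -
      have "0 * X + e = (e / b) * (a * X + b)" for X using a b by simp
      moreover have "e / b \<noteq> 0" using that b by auto
      ultimately show ?thesis using pedal_shape[of "e / b" "\<lambda>X. 0 * X + e" "L e", OF _ _ s nd] by blast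
    qed
    then show "pedal_parallelogram Q P"
      unfolding pedal_parallelogram_def None option.case using lim by blast
  qed
qed

end

section \<open>Equivalence of the characterizations\<close>

theorem mainTheorem1:
  fixes Q :: "complex quad"
  assumes "nondegenerate Q" and "\<not> cyclic Q"
  shows "\<exists>!W. \<forall>P :: complex option.
           (spiral_similarity_center Q P \<longleftrightarrow> P = W) \<and>
           (limit_or_rotation_center Q P \<longleftrightarrow> P = W) \<and>
           (common_point_CS Q P \<longleftrightarrow> P = W) \<and>
           (isoptic Q P \<longleftrightarrow> P = W) \<and>
           (generalized_circumcenter Q P \<longleftrightarrow> P = W) \<and>
           (isodynamic Q P \<longleftrightarrow> P = W) \<and>
           (inverse_of_vertices Q P \<longleftrightarrow> P = W) \<and>
           (inverse_of_isogonal_conjugates Q P \<longleftrightarrow> P = W) \<and>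
           (common_point_CS_generations Q P \<longleftrightarrow> P = W) \<and>
           (nondeg_parallelogram (varignon Q) \<longrightarrow> (pedal_parallelogram Q P \<longleftrightarrow> P = W))"
proof (cases Q)
  case (Quad A B C D)
  then interpret noncyclic4 A B C D using assms by (simp add: noncyclic4_iff)
  show ?thesis
    unfolding Quad
    by (rule ex1I[of _ W])
      (simp_all add: spiral_similarity_center_iff limit_or_rotation_center_iff CS_iff isoptic_iff
        generalized_circumcenter_iff isodynamic_iff inverse_of_vertices_iff
        inverse_of_isogonal_conjugates_iff CS_generations_iff pedal_parallelogram_iff)
qed

end
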